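(* Fix $r\ge2$ and positive integers $p_1,\dots,p_r$, and let $n_m\to\infty$ as $m\to\infty$. Let $W_m=(W_m(1),\dots,W_m(r))^T$, $m\ge1$, be a sequence of random vectors such that each $W_m(k)$ is a centered, unit variance degenerate $U$-statistic of order $p_k$ with finite fourth moment, whose argument is the vector of independent random elements $(X_1^{(m)},\dots,X_{n_m}^{(m)})$. Let $\mathbf{\Sigma}\in\mathbb{R}^{r\times r}$ be a positive semi-definite matrix with $\mathbf{\Sigma}(j,j)=1$ for $j=1,\dots,r$, and let $N=(N(1),\dots,N(r))^T\sim N_r(0,\mathbf{\Sigma})$ be a centered Gaussian vector with covariance matrix $\mathbf{\Sigma}$. Assume: (i) the covariance matrix of $W_m$ converges to $\mathbf{\Sigma}$ as $m\to\infty$; (ii) $\varrho_{n_m,k}^2\to0$ as $m\to\infty$, for every $k=1,\dots,r$; (iii) $\mathbb{E}[W_m(k)^4]\to3$ as $m\to\infty$, for every $k=1,\dots,r$; (iv) if $j\neq k$ but $p_j=p_k$, then $\mathbb{E}[W_m(j)^2W_m(k)^2]\to\mathbb{E}[N(j)^2N(k)^2]=1+2(\mathbf{\Sigma}(j,k))^2$ as $m\to\infty$. Then $W_m$ converges in distribution to $N$ as $m\to\infty$.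
   Context: For each $m$, $X_1^{(m)},\dots,X_{n_m}^{(m)}$ are independent random elements with values in arbitrary measurable spaces. Write $[n]=\{1,\dots,n\}$, $\mathcal{F}_J=\sigma(X_j^{(m)},j\in J)$ for $J\subseteq[n_m]$. The Hoeffding decomposition of an integrable $\mathcal{F}_{[n_m]}$-measurable random variable $T$ is the a.s. unique decomposition $T=\sum_{J\subseteq[n_m]}T_J$ with $T_J$ $\mathcal{F}_J$-measurable and $\mathbb{E}[T_J\mid\mathcal{F}_K]=0$ whenever $J\nsubseteq K$. $T$ is a degenerate $U$-statistic of order $p$ if $T_J=0$ whenever $|J|\ne p$. With $W_m(k)=\sum_{|J|=p_k}W_{m,J}(k)$ the Hoeffding decomposition of $W_m(k)$, set $$\varrho_{n_m,k}^2=\max_{1\le j\le n_m}\ \sum_{J\subseteq[n_m]:\,|J|=p_k,\ j\in J}\mathrm{Var}(W_{m,J}(k)).$$ *)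

theory Defs
  imports "HOL-Probability.Probability"
begin

text \<open>The sigma-algebra \<open>\<F>\<^sub>J = \<sigma>(X j, j \<in> J)\<close> on \<open>space M\<close>, where \<open>X j\<close> takes values
  in the measurable space \<open>E j\<close>. Only the sets of this measure object are meaningful, which is
  how sub-sigma-algebras are passed to \<open>real_cond_exp\<close>. For \<open>J = {}\<close> it is the trivial one.\<close>

definition gen_sigma ::
    "'a measure \<Rightarrow> (nat \<Rightarrow> 'b measure) \<Rightarrow> (nat \<Rightarrow> 'a \<Rightarrow> 'b) \<Rightarrow> nat set \<Rightarrow> 'a measure" where
  "gen_sigma M E X J =
     sigma (space M) (\<Union>j\<in>J. sets (vimage_algebra (space M) (X j) (E j)))"

text \<open>\<open>H\<close> is a Hoeffding decomposition of \<open>T\<close>, the component \<open>T\<^sub>J\<close> being \<open>H J\<close>; values of \<open>H\<close> at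
  index sets that are not subsets of \<open>{1..n}\<close> play no role. Integrability of the components is
  demanded because their conditional expectations are used (\<open>real_cond_exp\<close> is a total function).\<close>

definition hoeffding_decomposition ::
    "'a measure \<Rightarrow> (nat \<Rightarrow> 'b measure) \<Rightarrow> (nat \<Rightarrow> 'a \<Rightarrow> 'b) \<Rightarrow> nat \<Rightarrow>
     ('a \<Rightarrow> real) \<Rightarrow> (nat set \<Rightarrow> 'a \<Rightarrow> real) \<Rightarrow> bool" where
  "hoeffding_decomposition M E X n T H \<longleftrightarrow>
     integrable M T \<and>
     T \<in> borel_measurable (gen_sigma M E X {1..n}) \<and>
     (\<forall>J. J \<subseteq> {1..n} \<longrightarrow> integrable M (H J) \<and> H J \<in> borel_measurable (gen_sigma M E X J)) \<and>
     (AE x in M. T x = (\<Sum>J\<in>Pow {1..n}. H J x)) \<and>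
     (\<forall>J K. J \<subseteq> {1..n} \<longrightarrow> K \<subseteq> {1..n} \<longrightarrow> \<not> J \<subseteq> K \<longrightarrow>
        (AE x in M. real_cond_exp M (gen_sigma M E X K) (H J) x = 0))"

text \<open>The decomposition is a.s. unique, so the existential quantifier
  amounts to speaking of \<^emph>\<open>the\<close> Hoeffding decomposition of \<open>T\<close>.\<close>

definition degenerate_U_statistic ::
    "'a measure \<Rightarrow> (nat \<Rightarrow> 'b measure) \<Rightarrow> (nat \<Rightarrow> 'a \<Rightarrow> 'b) \<Rightarrow> nat \<Rightarrow> nat \<Rightarrow>
     ('a \<Rightarrow> real) \<Rightarrow> bool" where
  "degenerate_U_statistic M E X n p T \<longleftrightarrow>
     (\<exists>H. hoeffding_decomposition M E X n T H \<and>
          (\<forall>J. J \<subseteq> {1..n} \<longrightarrow> card J \<noteq> p \<longrightarrow> (AE x in M. H J x = 0)))"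

text \<open>The quantity \<open>\<varrho>\<^sup>2\<close>, for \<open>H\<close> the Hoeffding decomposition of a degenerate
  \<open>U\<close>-statistic of order \<open>p\<close>; it is meaningful only for \<open>n \<ge> 1\<close>.\<close>

definition rho_sq :: "'a measure \<Rightarrow> nat \<Rightarrow> nat \<Rightarrow> (nat set \<Rightarrow> 'a \<Rightarrow> real) \<Rightarrow> real" where
  "rho_sq M n p H =
     Max ((\<lambda>j. \<Sum>J | J \<subseteq> {1..n} \<and> card J = p \<and> j \<in> J. prob_space.variance M (H J)) ` {1..n})"

definition covariance_matrix :: "'a measure \<Rightarrow> ('a \<Rightarrow> real ^ 'r) \<Rightarrow> real ^ 'r ^ 'r" where
  "covariance_matrix M V =
     (\<chi> j k. prob_space.expectation M (\<lambda>x.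
        (V x $ j - prob_space.expectation M (\<lambda>y. V y $ j)) *
        (V x $ k - prob_space.expectation M (\<lambda>y. V y $ k))))"

definition pos_semidefinite :: "real ^ 'r ^ 'r \<Rightarrow> bool" where
  "pos_semidefinite A \<longleftrightarrow> transpose A = A \<and> (\<forall>u. 0 \<le> u \<bullet> (A *v u))"

text \<open>Real Gaussian variables may be degenerate (a.s. constant), so that Gaussian vectors
  with singular covariance matrix are included.\<close>

definition gaussian_rv :: "'a measure \<Rightarrow> ('a \<Rightarrow> real) \<Rightarrow> bool" where
  "gaussian_rv M Y \<longleftrightarrow>
     (\<exists>\<mu> \<sigma>. 0 < \<sigma> \<and> distributed M lborel Y (\<lambda>x. ennreal (normal_density \<mu> \<sigma> x))) \<or>
     (\<exists>c. Y \<in> borel_measurable M \<and> (AE x in M. Y x = c))"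

definition gaussian_vector :: "'a measure \<Rightarrow> ('a \<Rightarrow> real ^ 'r) \<Rightarrow> bool" where
  "gaussian_vector M V \<longleftrightarrow>
     V \<in> borel_measurable M \<and> (\<forall>u. gaussian_rv M (\<lambda>x. u \<bullet> V x))"

definition centered_gaussian_vector ::
    "'a measure \<Rightarrow> ('a \<Rightarrow> real ^ 'r) \<Rightarrow> real ^ 'r ^ 'r \<Rightarrow> bool" where
  "centered_gaussian_vector M V S \<longleftrightarrow>
     gaussian_vector M V \<and>
     (\<forall>k. prob_space.expectation M (\<lambda>x. V x $ k) = 0) \<and>
     covariance_matrix M V = S"

text \<open>Convergence in distribution; \<open>weak_conv_m\<close> from the library is limited to laws on the real
  line. The random vectors \<open>V m\<close> may live on different probability spaces.\<close>

definition converges_in_distribution ::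
    "(nat \<Rightarrow> 'a measure) \<Rightarrow> (nat \<Rightarrow> 'a \<Rightarrow> real ^ 'r) \<Rightarrow> 'c measure \<Rightarrow> ('c \<Rightarrow> real ^ 'r) \<Rightarrow> bool" where
  "converges_in_distribution M V Q N \<longleftrightarrow>
     (\<forall>f :: real ^ 'r \<Rightarrow> real. continuous_on UNIV f \<longrightarrow> bounded (range f) \<longrightarrow>
        (\<lambda>m. prob_space.expectation (M m) (\<lambda>x. f (V m x)))
          \<longlonglongrightarrow> prob_space.expectation Q (\<lambda>x. f (N x)))"

end

theory Submission
  imports Defs
begin

text \<open>
  Why the theorem holds. For a fixed \<open>m\<close> let \<open>f\<^sub>k = W\<^sub>m(k)\<close> with components \<open>F\<^sub>k\<^sub>,\<^sub>J\<close>, and for an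
  index \<open>j\<close> split \<open>f\<^sub>k = a\<^sub>j f\<^sub>k + d\<^sub>j f\<^sub>k\<close>, where \<open>d\<^sub>j f\<^sub>k\<close> collects the components with \<open>j \<in> J\<close>. Write \<open>E\<^sub>j\<close>
  for the conditional expectation given all variables except the \<open>j\<close>-th. Then \<open>E\<^sub>j (d\<^sub>j f\<^sub>k) = 0\<close>, and
  \<open>p\<^sub>k f\<^sub>k = \<Sum>\<^sub>j d\<^sub>j f\<^sub>k\<close> because every component is counted \<open>p\<^sub>k\<close> times. For \<open>S = \<Sum>\<^sub>l u\<^sub>l f\<^sub>l\<close>, expanding
  \<open>\<psi>(S)\<close> around \<open>a\<^sub>j S\<close> gives an approximate integration by parts (\<open>stein_local\<close>, \<open>stein_bound\<close>):
  \<open>2 p\<^sub>k E[f\<^sub>k \<psi>(S)] = E[\<psi>'(S) \<Sum>\<^sub>l u\<^sub>l \<Gamma>\<^sub>2(f\<^sub>k, f\<^sub>l)]\<close> up to an error that is small when all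
  \<open>\<Sum>\<^sub>j E (d\<^sub>j f\<^sub>l)^4\<close> are small, with \<open>\<Gamma>\<^sub>2(f, g) = \<Sum>\<^sub>j (d\<^sub>j f d\<^sub>j g + E\<^sub>j (d\<^sub>j f d\<^sub>j g))\<close>, which is twice the
  carre du champ of the generator \<open>f \<mapsto> \<Sum>\<^sub>j (E\<^sub>j f - f)\<close>. Its mean is \<open>2 p\<^sub>k\<close> times the covariance of
  \<open>f\<^sub>k\<close> and \<open>f\<^sub>l\<close>. If \<open>\<Gamma>\<^sub>2\<close> concentrates at its mean, then \<open>s \<mapsto> E e^{i s <u, W>}\<close> almost solves the
  differential equation of the Gaussian characteristic function, and \<open>char_bound\<close> follows by
  integrating it.

  So two facts are needed. First, \<open>\<Gamma>\<^sub>2(f, g)\<close> multiplies the component at \<open>N\<close> of the product \<open>f g\<close>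
  by \<open>p + q - |N|\<close> (\<open>Gamma2_hcomp\<close>). Hence the components of the top order \<open>p + q\<close> drop out, and the
  variance of \<open>\<Gamma>\<^sub>2\<close> is controlled by \<open>E f\<^sup>2 g\<^sup>2 - (E f g)\<^sup>2\<close> minus the squared norm of the top part
  (\<open>Gamma2_variance\<close>). The top part is \<open>\<Sum> F\<^sub>J G\<^sub>K\<close> over disjoint \<open>J, K\<close>; its squared norm is a sum over
  quadruples of disjoint sets which, by conditional independence, is a sum of squared norms of
  contractions up to terms with overlapping index sets. The overlaps are bounded by \<open>\<rho>\<^sup>2\<close>, and dropping
  all squares but the explicit ones gives the lower bound \<open>1 + (E f g)\<^sup>2 - C \<rho>\<^sup>2\<close>
  (\<open>top_energy_lower_bound\<close>). Therefore the variance of \<open>\<Gamma>\<^sub>2\<close> is at most a constant times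
  \<open>E f\<^sup>2 g\<^sup>2 - 1 - 2 (E f g)\<^sup>2 + C \<rho>\<^sup>2\<close> (\<open>low_energy_le\<close>), which tends to \<open>0\<close> under the assumptions
  on the moments. For equal orders the mixed moments converge by assumption; for
  different orders \<open>E f\<^sup>2 g\<^sup>2 \<longrightarrow> 1\<close> is automatic, since \<open>f\<^sup>2\<close> and \<open>g\<^sup>2\<close> then have almost all of their
  non-constant part in different orders (\<open>mixed_moment_orders_differ\<close>). This is why componentwise
  convergence implies joint convergence.

  Second, \<open>\<Sum>\<^sub>j E (d\<^sub>j f)^4 \<le> 3 E[f\<^sup>2 \<Gamma>\<^sub>2(f, f)] - 2 p E f^4\<close> by an exact expansion
  (\<open>fourth_moment_Dpart_le\<close>, \<open>fourth_sum_le\<close>), and the right-hand side tends to \<open>6 p - 6 p = 0\<close>.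

  Finally, convergence of \<open>E cos <u, W>\<close> and \<open>E sin <u, W>\<close> together with bounded second moments
  yields convergence in distribution, because a bounded continuous function is, on a large ball,
  uniformly close to a trigonometric polynomial that stays bounded everywhere
  (\<open>weak_convergence_from_trig\<close>).
\<close>

section \<open>Elementary inequalities and an alternating sum\<close>

lemma abs_add_power_le: "\<bar>a + b :: real\<bar> ^ k \<le> 2 ^ k * (\<bar>a\<bar> ^ k + \<bar>b\<bar> ^ k)"
proof -
  have "\<bar>a + b\<bar> \<le> 2 * max \<bar>a\<bar> \<bar>b\<bar>" by (auto simp: max_def)
  then have "\<bar>a + b\<bar> ^ k \<le> 2 ^ k * max \<bar>a\<bar> \<bar>b\<bar> ^ k"
    by (metis abs_ge_zero power_mono power_mult_distrib)
  also have "max \<bar>a\<bar> \<bar>b\<bar> ^ k \<le> \<bar>a\<bar> ^ k + \<bar>b\<bar> ^ k" by (auto simp: max_def)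
  finally show ?thesis by simp
qed

lemma abs_mult_le_sum_squares: "\<bar>a * b :: real\<bar> \<le> a\<^sup>2 + b\<^sup>2"
proof -
  have "2 * (\<bar>a\<bar> * \<bar>b\<bar>) \<le> \<bar>a\<bar>\<^sup>2 + \<bar>b\<bar>\<^sup>2"
    using sum_squares_bound[of "\<bar>a\<bar>" "\<bar>b\<bar>"] by (simp only: mult.assoc)
  moreover have "0 \<le> \<bar>a\<bar> * \<bar>b\<bar>" by simp
  ultimately show ?thesis unfolding abs_mult power2_abs by linarith
qed

lemma young: "\<eta> > 0 \<Longrightarrow> \<bar>x\<bar> * \<bar>y\<bar> \<le> (\<eta> * y\<^sup>2 + x\<^sup>2 / \<eta>) / (2::real)"
proof -
  assume "\<eta> > 0"
  have "0 \<le> (\<eta> * \<bar>y\<bar> - \<bar>x\<bar>)\<^sup>2 / \<eta>" using \<open>\<eta> > 0\<close> by simp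
  also have "\<dots> = \<eta> * y\<^sup>2 + x\<^sup>2 / \<eta> - 2 * (\<bar>x\<bar> * \<bar>y\<bar>)"
    using \<open>\<eta> > 0\<close> by (simp add: power2_eq_square field_simps)
  finally show ?thesis by simp
qed

text \<open>Rational \<open>t\<close> suffice by continuity. This matters for conditional expectations, where only countably
  many almost sure inequalities can be combined.\<close>

lemma discriminant_le:
  fixes u v w :: real
  assumes "u \<ge> 0" "\<And>t. t \<in> \<rat> \<Longrightarrow> 0 \<le> t\<^sup>2 * u + 2 * t * w + v"
  shows "w\<^sup>2 \<le> u * v"
proof -
  have nn: "0 \<le> t\<^sup>2 * u + 2 * t * w + v" for t
  proof (rule continuous_ge_on_closure[of \<rat> "\<lambda>t. t\<^sup>2 * u + 2 * t * w + v"])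
    show "continuous_on (closure \<rat>) (\<lambda>t. t\<^sup>2 * u + 2 * t * w + v)" by (intro continuous_intros)
    show "t \<in> closure \<rat>" using Rats_closure_real by simp
  qed (use assms(2) in auto)
  show ?thesis
  proof (cases "u = 0")
    case True
    have "w = 0"
    proof (rule ccontr)
      assume "w \<noteq> 0"
      then show False using nn[of "- (v + 1) / (2 * w)"] True by (simp add: field_simps)
    qed
    then show ?thesis using True by simp
  next
    case False
    then have pos: "u > 0" using assms by simp
    have "0 \<le> u * ((- w / u)\<^sup>2 * u + 2 * (- w / u) * w + v)"
      by (intro mult_nonneg_nonneg nn) (use pos in simp)
    also have "\<dots> = u * v - w\<^sup>2"
      using pos by (simp add: divide_simps) (simp add: algebra_simps power2_eq_square)
    finally show ?thesis by simp
  qed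
qed

text \<open>Adding or removing \<open>j\<close> flips the sign and leaves \<open>b\<close> unchanged, so the subsets cancel in pairs.\<close>

lemma alternating_Pow_sum_0:
  fixes b :: "nat set \<Rightarrow> real"
  assumes "finite J" "j \<in> J" "\<And>L. b (insert j L) = b L"
  shows "(\<Sum>L\<in>Pow J. (-1) ^ card L * b L) = 0"
proof -
  let ?J = "J - {j}"
  have J: "J = insert j ?J" using assms by auto
  have "(\<Sum>L\<in>Pow J. (-1) ^ card L * b L) = (\<Sum>L\<in>Pow ?J \<union> insert j ` Pow ?J. (-1) ^ card L * b L)"
    by (subst J, subst Pow_insert) simp
  also have "\<dots> = (\<Sum>L\<in>Pow ?J. (-1) ^ card L * b L) + (\<Sum>L\<in>insert j ` Pow ?J. (-1) ^ card L * b L)"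
    using assms(1) by (intro sum.union_disjoint) auto
  also have "(\<Sum>L\<in>insert j ` Pow ?J. (-1) ^ card L * b L) = (\<Sum>L\<in>Pow ?J. (-1) ^ card (insert j L) * b (insert j L))"
    by (intro sum.reindex_cong[OF _ refl]) (auto simp: inj_on_def)
  also have "\<dots> = (\<Sum>L\<in>Pow ?J. - ((-1) ^ card L * b L))"
  proof (rule sum.cong[OF refl])
    fix L assume "L \<in> Pow ?J"
    then have "finite L" "j \<notin> L" using assms(1) finite_subset by auto
    then show "(-1) ^ card (insert j L) * b (insert j L) = - ((-1) ^ card L * b L)"
      by (simp add: assms(3))
  qed
  finally show ?thesis by (simp add: sum_negf)
qed

section \<open>Sigma-algebras generated by independent variables\<close>

text \<open>The setting for a fixed \<open>m\<close>, with an arbitrary finite index set.\<close>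

locale indep_family = prob_space M for M :: "'a measure" +
  fixes E :: "nat \<Rightarrow> 'b measure" and X :: "nat \<Rightarrow> 'a \<Rightarrow> 'b" and I :: "nat set"
  assumes finite_index: "finite I" and indep_X: "indep_vars E X I"
begin

text \<open>The \<sigma>-algebra \<open>\<F>\<^sub>J\<close>. Intersecting with \<open>I\<close> yields a sub-\<sigma>-algebra of \<open>M\<close> for every set \<open>J\<close> of indices.\<close>

definition sig :: "nat set \<Rightarrow> 'a measure" where
  "sig J = gen_sigma M E X (J \<inter> I)"

abbreviation CE :: "nat set \<Rightarrow> ('a \<Rightarrow> real) \<Rightarrow> 'a \<Rightarrow> real" where
  "CE J \<equiv> real_cond_exp M (sig J)"

definition evs :: "nat \<Rightarrow> 'a set set" where
  "evs j = sets (vimage_algebra (space M) (X j) (E j))"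

lemma X_measurable: "j \<in> I \<Longrightarrow> X j \<in> measurable M (E j)"
  using indep_X by (auto simp: indep_vars_def2)

lemma evs_eq: "j \<in> I \<Longrightarrow> evs j = {X j -` A \<inter> space M | A. A \<in> sets (E j)}"
  unfolding evs_def
  by (subst sets_vimage_algebra2) (use X_measurable in \<open>auto dest: measurable_space\<close>)

lemma evs_in_events: "j \<in> I \<Longrightarrow> evs j \<subseteq> events"
  using X_measurable by (auto simp: evs_eq intro: measurable_sets)

lemma evs_union_in_Pow: "(\<Union>j\<in>J \<inter> I. evs j) \<subseteq> Pow (space M)"
  using evs_in_events sets.sets_into_space by blast

lemma space_sig [simp]: "space (sig J) = space M"
  unfolding sig_def gen_sigma_def using evs_union_in_Pow[unfolded evs_def]
  by (simp add: space_measure_of_conv)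

lemma sets_sig: "sets (sig J) = sigma_sets (space M) (\<Union>j\<in>J \<inter> I. evs j)"
  unfolding sig_def gen_sigma_def evs_def[symmetric]
  by (simp add: sets_measure_of evs_union_in_Pow)

lemma sig_subalgebra: "subalgebra M (sig J)"
  unfolding subalgebra_def sets_sig
  using evs_in_events by (auto intro!: sets.sigma_sets_subset)

sublocale ce: sigma_finite_subalgebra M "sig J" for J
  by (intro finite_measure_subalgebra_is_sigma_finite)
    (simp add: finite_measure_subalgebra_def finite_measure_subalgebra_axioms_def sig_subalgebra
      finite_measure_axioms)

lemma sets_sig_mono: "J \<inter> I \<subseteq> K \<Longrightarrow> sets (sig J) \<subseteq> sets (sig K)"
  unfolding sets_sig by (intro sigma_sets_mono') blast

lemma sig_mono: "J \<inter> I \<subseteq> K \<Longrightarrow> subalgebra (sig K) (sig J)"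
  unfolding subalgebra_def using sets_sig_mono[of J K] by simp

lemma measurable_sig_mono: "f \<in> measurable (sig J) N \<Longrightarrow> J \<inter> I \<subseteq> K \<Longrightarrow> f \<in> measurable (sig K) N"
  using measurable_from_subalg[OF sig_mono] by blast

lemma measurable_sig: "f \<in> measurable (sig J) N \<Longrightarrow> f \<in> measurable M N"
  using measurable_from_subalg[OF sig_subalgebra] .

lemma Int_stable_evs: "j \<in> I \<Longrightarrow> Int_stable (evs j)"
  unfolding evs_def by (simp add: Int_stable_def sets.Int)

lemma indep_sig:
  assumes "J \<inter> K \<inter> I = {}"
  shows "indep_set (sets (sig J)) (sets (sig K))"
proof -
  let ?I = "\<lambda>b. case b of True \<Rightarrow> J \<inter> I | False \<Rightarrow> K \<inter> I"
  have "indep_sets (\<lambda>b. sigma_sets (space M) (\<Union>i\<in>?I b. evs i)) UNIV"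
  proof (rule indep_sets_collect_sigma)
    have "indep_sets (\<lambda>i. {X i -` A \<inter> space M | A. A \<in> sets (E i)}) I"
      using indep_X by (simp add: indep_vars_def2)
    then have "indep_sets evs I"
      by (subst indep_sets_cong[OF refl, of _ _ "\<lambda>i. {X i -` A \<inter> space M | A. A \<in> sets (E i)}"])
        (auto simp: evs_eq)
    then show "indep_sets evs (\<Union>j\<in>UNIV. ?I j)"
      by (rule indep_sets_mono_index[rotated]) (auto split: bool.splits)
    show "Int_stable (evs i)" if "i \<in> ?I b" for i b
      using that by (auto intro: Int_stable_evs split: bool.splits)
    show "disjoint_family ?I"
      using assms by (auto simp: disjoint_family_on_def split: bool.splits)
  qed
  then have "indep_sets (\<lambda>b. case b of True \<Rightarrow> sets (sig J) | False \<Rightarrow> sets (sig K)) UNIV"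
    by (rule iffD1[OF indep_sets_cong, rotated 2]) (auto simp: sets_sig split: bool.splits)
  then show ?thesis unfolding indep_set_def .
qed

lemma indep_var_sig:
  fixes f g :: "'a \<Rightarrow> real"
  assumes "J \<inter> K \<inter> I = {}" and f: "f \<in> borel_measurable (sig J)" and g: "g \<in> borel_measurable (sig K)"
  shows "indep_var borel f borel g"
  unfolding indep_var_eq
proof (intro conjI)
  show "random_variable borel f" "random_variable borel g"
    using f g by (auto intro: measurable_sig)
  have *: "sigma_sets (space M) {h -` A \<inter> space M |A. A \<in> sets borel} \<subseteq> sets (sig L)"
    if "h \<in> borel_measurable (sig L)" for h L
  proof -
    have "{h -` A \<inter> space M |A. A \<in> sets borel} \<subseteq> sets (sig L)"
      using measurable_sets[OF that] by auto
    then show ?thesis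
      using sets.sigma_sets_subset[of _ "sig L"] by simp
  qed
  from *[OF f] *[OF g] show "indep_set (sigma_sets (space M) {f -` A \<inter> space M |A. A \<in> sets borel})
     (sigma_sets (space M) {g -` A \<inter> space M |A. A \<in> sets borel})"
    using indep_sig[OF assms(1)] unfolding indep_set_def
    by (elim indep_sets_mono_sets) (auto split: bool.splits)
qed

lemma indep_sig_expectation:
  fixes f g :: "'a \<Rightarrow> real"
  assumes "J \<inter> K \<inter> I = {}" and "f \<in> borel_measurable (sig J)" and "g \<in> borel_measurable (sig K)"
    and "integrable M f" "integrable M g"
  shows "expectation (\<lambda>x. f x * g x) = expectation f * expectation g"
  using indep_var_lebesgue_integral[OF indep_var_sig[OF assms(1-3)]] assms by auto

lemma CE_measurable: "CE J f \<in> borel_measurable (sig J)"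
  by simp

text \<open>The identity \<open>E[E[\<cdot> | \<F>\<^sub>K] | \<F>\<^sub>J] = E[\<cdot> | \<F>\<^sub>J\<^sub>\<inter>\<^sub>K]\<close>, the form in which independence enters everything below:
  the variables in \<open>J - K\<close> are independent of \<open>\<F>\<^sub>K\<close> and carry no information on \<open>f\<close>.\<close>

lemma CE_commute:
  fixes f :: "'a \<Rightarrow> real"
  assumes f: "integrable M f" "f \<in> borel_measurable (sig K)"
  shows "AE x in M. CE J f x = CE (J \<inter> K) f x"
proof (rule ce.real_cond_exp_charact)
  let ?g = "CE (J \<inter> K) f"
  show f': "integrable M f" by fact
  show g': "integrable M ?g" using f(1) by (rule ce.real_cond_exp_int)
  show "?g \<in> borel_measurable (sig J)"
    by (rule measurable_sig_mono[OF CE_measurable]) auto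
  fix A assume "A \<in> sets (sig J)"
  \<comment> \<open>Sets of this form generate \<open>\<F>\<^sub>J\<close> and are stable under intersection, and on them the claim is a
    consequence of the independence of \<open>\<F>\<^sub>K\<close> and \<open>\<F>\<^sub>J\<^sub>-\<^sub>K\<close>.\<close>
  let ?P = "{B \<inter> C | B C. B \<in> sets (sig (J \<inter> K)) \<and> C \<in> sets (sig (J - K))}"
  have evM: "B \<in> sets (sig L) \<Longrightarrow> B \<in> events" for B L
    using sig_subalgebra by (auto simp: subalgebra_def)
  have intA: "integrable M (\<lambda>x. indicator B x * h x)" if "B \<in> events" "integrable M h"
    for B and h :: "'a \<Rightarrow> real"
    using integrable_mult_indicator[OF that] by simp
  have gen: "sets (sig J) = sigma_sets (space M) ?P"
  proof
    have "(\<Union>j\<in>J \<inter> I. evs j) \<subseteq> ?P"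
    proof clarify
      fix j B assume j: "j \<in> J" "j \<in> I" "B \<in> evs j"
      have B: "B \<in> sets (sig L)" if "j \<in> L" for L
        unfolding sets_sig using that j by (auto intro!: sigma_sets.Basic)
      have Bs: "B \<subseteq> space M" using B[OF j(1)] evM sets.sets_into_space by blast
      show "\<exists>B' C. B = B' \<inter> C \<and> B' \<in> sets (sig (J \<inter> K)) \<and> C \<in> sets (sig (J - K))"
      proof (cases "j \<in> K")
        case True
        with B[of "J \<inter> K"] j Bs show ?thesis
          by (intro exI[of _ B] exI[of _ "space M"]) (use sets.top[of "sig (J - K)"] in auto)
      next
        case False
        with B[of "J - K"] j Bs show ?thesis
          by (intro exI[of _ B] exI[of _ "space M"]) 
             (use sets.top[of "sig (J \<inter> K)"] in \<open>auto intro!: exI[of _ "space M"] exI[of _ B]\<close>)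
      qed
    qed
    then show "sets (sig J) \<subseteq> sigma_sets (space M) ?P"
      unfolding sets_sig[of J] by (rule sigma_sets_mono')
    have "?P \<subseteq> sets (sig J)"
      using sets_sig_mono[of "J \<inter> K" J] sets_sig_mono[of "J - K" J] by auto
    then show "sigma_sets (space M) ?P \<subseteq> sets (sig J)"
      using sets.sigma_sets_subset[of ?P "sig J"] by simp
  qed
  have stable: "Int_stable ?P"
  proof (rule Int_stableI, clarify)
    fix B C B' C' assume "B \<in> sets (sig (J \<inter> K))" "C \<in> sets (sig (J - K))"
      "B' \<in> sets (sig (J \<inter> K))" "C' \<in> sets (sig (J - K))"
    then show "\<exists>B'' C''. B \<inter> C \<inter> (B' \<inter> C') = B'' \<inter> C'' \<and> B'' \<in> sets (sig (J \<inter> K)) \<and> C'' \<in> sets (sig (J - K))"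
      by (intro exI[of _ "B \<inter> B'"] exI[of _ "C \<inter> C'"]) auto
  qed
  have Pow: "?P \<subseteq> Pow (space M)" using evM sets.sets_into_space by blast
  have swap: "(\<integral>x\<in>A. h x \<partial>M) = (\<integral>x. indicator A x * h x \<partial>M)" for A and h :: "'a \<Rightarrow> real"
    by (simp add: set_lebesgue_integral_def)
  have A_gen: "A \<in> sigma_sets (space M) ?P" using \<open>A \<in> sets (sig J)\<close> gen by simp
  show "(\<integral>x\<in>A. f x \<partial>M) = (\<integral>x\<in>A. ?g x \<partial>M)" unfolding swap using stable Pow A_gen
  proof (induction rule: sigma_sets_induct_disjoint)
    case (basic A)
    then obtain B C where A: "A = B \<inter> C" "B \<in> sets (sig (J \<inter> K))" "C \<in> sets (sig (J - K))" by auto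
    have split: "(\<integral>x. indicator A x * h x \<partial>M) = (\<integral>x. indicator B x * h x \<partial>M) * prob C"
      if h: "h \<in> borel_measurable (sig K)" "integrable M h" for h
    proof -
      have "(\<integral>x. indicator A x * h x \<partial>M) = (\<integral>x. (indicator B x * h x) * indicator C x \<partial>M)"
        unfolding A by (intro Bochner_Integration.integral_cong) (auto simp: indicator_def)
      also have "\<dots> = (\<integral>x. indicator B x * h x \<partial>M) * (\<integral>x. indicator C x \<partial>M)"
      proof (rule indep_sig_expectation)
        have "B \<in> sets (sig K)" using A(2) sets_sig_mono[of "J \<inter> K" K] by auto
        then show "(\<lambda>x. indicator B x * h x) \<in> borel_measurable (sig K)" using h by measurable
        show "(indicator C :: 'a \<Rightarrow> real) \<in> borel_measurable (sig (J - K))" using A(3) by measurable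
        show "integrable M (\<lambda>x. indicator B x * h x)" using A evM h by (intro intA) auto
        show "integrable M (indicator C :: 'a \<Rightarrow> real)" using evM[OF A(3)] by (simp add: emeasure_eq_measure)
      qed auto
      also have "(\<integral>x. indicator C x \<partial>M) = prob C" using evM[OF A(3)] by simp
      finally show ?thesis .
    qed
    have "(\<integral>x. indicator B x * ?g x \<partial>M) = (\<integral>x. indicator B x * f x \<partial>M)"
      using A(2) evM f by (intro ce.real_cond_exp_intg intA) auto
    moreover have "?g \<in> borel_measurable (sig K)"
      by (rule measurable_sig_mono[OF CE_measurable]) auto
    ultimately show ?case using split[OF f(2) f(1)] split[OF _ g'] by simp
  next
    case empty
    then show ?case by simp
  next
    case (compl A)
    then have A: "A \<in> events" using evM gen by blast
    have *: "(\<integral>x. indicator (space M - A) x * h x \<partial>M) = (\<integral>x. h x \<partial>M) - (\<integral>x. indicator A x * h x \<partial>M)"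
      if "integrable M h" for h :: "'a \<Rightarrow> real"
    proof -
      have "(\<integral>x. indicator (space M - A) x * h x \<partial>M) = (\<integral>x. h x - indicator A x * h x \<partial>M)"
        by (intro Bochner_Integration.integral_cong) (auto simp: indicator_def)
      then show ?thesis using that intA[OF A that] by simp
    qed
    show ?case using *[OF f'] *[OF g'] compl ce.real_cond_exp_int(2)[OF f'] by simp
  next
    case (union A)
    then have A: "\<And>i. A i \<in> events" using evM gen by blast
    have *: "(\<integral>x. indicator (\<Union>i. A i) x * h x \<partial>M) = (\<Sum>i. \<integral>x. indicator (A i) x * h x \<partial>M)"
      if h: "integrable M h" for h :: "'a \<Rightarrow> real"
      unfolding swap[symmetric]
    proof (rule lebesgue_integral_countable_add)
      show "set_integrable M (\<Union>i. A i) h"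
        unfolding set_integrable_def using A by (intro integrable_mult_indicator h) auto
    qed (use A union(1) in \<open>auto simp: disjoint_family_on_def\<close>)
    show ?case using *[OF f'] *[OF g'] union(3) by simp
  qed
qed

section \<open>Square-integrable functions and the Hoeffding decomposition\<close>

text \<open>The \<open>\<F>\<^sub>J\<close>-measurable functions with integrable \<open>k\<close>-th power; only even \<open>k\<close> are used, so that this is
  the usual space of functions with finite \<open>k\<close>-th moment.\<close>

definition Lp :: "nat \<Rightarrow> nat set \<Rightarrow> ('a \<Rightarrow> real) set" where
  "Lp k J = {f \<in> borel_measurable (sig J). integrable M (\<lambda>x. f x ^ k)}"

abbreviation "L2 \<equiv> Lp 2"
abbreviation "L4 \<equiv> Lp 4"
abbreviation ip :: "('a \<Rightarrow> real) \<Rightarrow> ('a \<Rightarrow> real) \<Rightarrow> real" where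
  "ip f g \<equiv> expectation (\<lambda>x. f x * g x)"

lemma Lp_meas_sig: "f \<in> Lp k J \<Longrightarrow> f \<in> borel_measurable (sig J)"
  by (simp add: Lp_def)

lemma Lp_meas [measurable_dest]: "f \<in> Lp k J \<Longrightarrow> f \<in> borel_measurable M"
  by (auto simp: Lp_def intro: measurable_sig)

lemma Lp_power_integrable: "f \<in> Lp k J \<Longrightarrow> integrable M (\<lambda>x. f x ^ k)"
  by (simp add: Lp_def)

lemma LpI: "f \<in> borel_measurable (sig J) \<Longrightarrow> integrable M (\<lambda>x. f x ^ k) \<Longrightarrow> f \<in> Lp k J"
  by (simp add: Lp_def)

lemma Lp_mono: "f \<in> Lp k J \<Longrightarrow> J \<inter> I \<subseteq> K \<Longrightarrow> f \<in> Lp k K"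
  by (auto simp: Lp_def intro: measurable_sig_mono)

lemma integrable_dominated:
  fixes f g :: "'a \<Rightarrow> real"
  assumes "integrable M g" "f \<in> borel_measurable M" "\<And>x. \<bar>f x\<bar> \<le> g x"
  shows "integrable M f"
  by (rule Bochner_Integration.integrable_bound[OF assms(1,2)]) (use assms(3) in \<open>auto intro: order_trans[OF _ abs_ge_self]\<close>)

lemma Lp_add:
  assumes "even k" "f \<in> Lp k J" "g \<in> Lp k J"
  shows "(\<lambda>x. f x + g x) \<in> Lp k J"
proof (rule LpI)
  show "(\<lambda>x. f x + g x) \<in> borel_measurable (sig J)"
    using assms(2,3)[THEN Lp_meas_sig] by measurable
  have "integrable M (\<lambda>x. 2 ^ k * (f x ^ k + g x ^ k))"
    using assms(2,3)[THEN Lp_power_integrable] by simp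
  then show "integrable M (\<lambda>x. (f x + g x) ^ k)"
  proof (rule integrable_dominated)
    show "(\<lambda>x. (f x + g x) ^ k) \<in> borel_measurable M"
      using assms(2,3)[THEN Lp_meas] by measurable
    show "\<bar>(f x + g x) ^ k\<bar> \<le> 2 ^ k * (f x ^ k + g x ^ k)" for x
      using abs_add_power_le[of "f x" "g x" k] assms(1) by (simp add: power_even_abs power_abs)
  qed
qed

lemma Lp_cmult: "f \<in> Lp k J \<Longrightarrow> (\<lambda>x. c * f x) \<in> Lp k J"
  by (auto simp: Lp_def power_mult_distrib)

lemma Lp_const: "(\<lambda>x. c) \<in> Lp k J"
  by (auto simp: Lp_def)

lemma Lp_uminus: "f \<in> Lp k J \<Longrightarrow> (\<lambda>x. - f x) \<in> Lp k J"
  using Lp_cmult[of f k J "-1"] by simp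

lemma Lp_diff: "even k \<Longrightarrow> f \<in> Lp k J \<Longrightarrow> g \<in> Lp k J \<Longrightarrow> (\<lambda>x. f x - g x) \<in> Lp k J"
  using Lp_add[of k f J "\<lambda>x. - g x"] Lp_uminus[of g k J] by simp

lemma Lp_sum: "even k \<Longrightarrow> (\<And>i. i \<in> A \<Longrightarrow> f i \<in> Lp k J) \<Longrightarrow> (\<lambda>x. \<Sum>i\<in>A. f i x) \<in> Lp k J"
  by (induction A rule: infinite_finite_induct) (auto intro: Lp_const Lp_add)

lemma L2_mult_integrable:
  assumes "f \<in> L2 J" "g \<in> L2 K"
  shows "integrable M (\<lambda>x. f x * g x)"
proof (rule integrable_dominated)
  show "integrable M (\<lambda>x. f x ^ 2 + g x ^ 2)"
    using assms[THEN Lp_power_integrable] by simp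
  show "(\<lambda>x. f x * g x) \<in> borel_measurable M" using assms[THEN Lp_meas] by measurable
  show "\<bar>f x * g x\<bar> \<le> f x ^ 2 + g x ^ 2" for x
    by (rule abs_mult_le_sum_squares)
qed

lemma L2_integrable: "f \<in> L2 J \<Longrightarrow> integrable M f"
  using L2_mult_integrable[of f J "\<lambda>x. 1" J] Lp_const[of 1] by simp

lemma L2_mult_bounded:
  assumes "f \<in> L2 J" "g \<in> borel_measurable (sig K)" "\<And>x. \<bar>g x\<bar> \<le> c"
  shows "(\<lambda>x. f x * g x) \<in> L2 (J \<union> K)"
proof (rule LpI)
  have "f \<in> borel_measurable (sig (J \<union> K))" "g \<in> borel_measurable (sig (J \<union> K))"
    using measurable_sig_mono[OF Lp_meas_sig[OF assms(1)], of "J \<union> K"] measurable_sig_mono[OF assms(2), of "J \<union> K"] by auto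
  then show m: "(\<lambda>x. f x * g x) \<in> borel_measurable (sig (J \<union> K))" by measurable
  have "integrable M (\<lambda>x. c ^ 2 * f x ^ 2)" using Lp_power_integrable[OF assms(1)] by simp
  then show "integrable M (\<lambda>x. (f x * g x) ^ 2)"
  proof (rule integrable_dominated)
    show "(\<lambda>x. (f x * g x) ^ 2) \<in> borel_measurable M" using measurable_sig[OF m] by measurable
    show "\<bar>(f x * g x) ^ 2\<bar> \<le> c ^ 2 * f x ^ 2" for x
      using power_mono[OF assms(3)[of x], of 2] mult_right_mono[of "(g x)\<^sup>2" "c\<^sup>2" "(f x)\<^sup>2"]
      by (simp add: power_mult_distrib mult.commute)
  qed
qed

lemma L4_mult:
  assumes "f \<in> L4 J" "g \<in> L4 K"
  shows "(\<lambda>x. f x * g x) \<in> L2 (J \<union> K)"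
proof (rule LpI)
  have "f \<in> borel_measurable (sig (J \<union> K))" "g \<in> borel_measurable (sig (J \<union> K))"
    using measurable_sig_mono[OF Lp_meas_sig[OF assms(1)], of "J \<union> K"]
      measurable_sig_mono[OF Lp_meas_sig[OF assms(2)], of "J \<union> K"] by auto
  then show m: "(\<lambda>x. f x * g x) \<in> borel_measurable (sig (J \<union> K))" by measurable
  have "integrable M (\<lambda>x. f x ^ 4 + g x ^ 4)" using assms[THEN Lp_power_integrable] by simp
  then show "integrable M (\<lambda>x. (f x * g x) ^ 2)"
  proof (rule integrable_dominated)
    show "(\<lambda>x. (f x * g x) ^ 2) \<in> borel_measurable M" using measurable_sig[OF m] by measurable
    show "\<bar>(f x * g x) ^ 2\<bar> \<le> f x ^ 4 + g x ^ 4" for x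
      using abs_mult_le_sum_squares[of "f x ^ 2" "g x ^ 2"] by (simp add: power_mult_distrib)
  qed
qed

lemma L4_L2: "f \<in> L4 J \<Longrightarrow> f \<in> L2 J"
  using L4_mult[of f J "\<lambda>x. 1" J] Lp_const[of 1] by simp

lemma CE_Lp:
  assumes k: "even k" "f \<in> Lp k K" and int: "integrable M f"
  shows "CE J f \<in> Lp k J" and "expectation (\<lambda>x. CE J f x ^ k) \<le> expectation (\<lambda>x. f x ^ k)"
proof -
  have conv: "convex_on UNIV (\<lambda>x::real. x ^ k)" using k(1) by (rule convex_power_even)
  have I: "integrable M (\<lambda>x. CE J f x ^ k)"
    by (rule ce.integrable_convex_cond_exp[OF int, of UNIV])
      (use Lp_power_integrable[OF k(2)] conv in auto)
  then show "CE J f \<in> Lp k J" by (intro LpI CE_measurable)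
  have "AE x in M. CE J f x ^ k \<le> CE J (\<lambda>x. f x ^ k) x"
    by (rule ce.real_cond_exp_jensens_inequality(2)[OF int, of UNIV 0 0 "\<lambda>x. x ^ k"])
      (use Lp_power_integrable[OF k(2)] conv in auto)
  then have "expectation (\<lambda>x. CE J f x ^ k) \<le> expectation (CE J (\<lambda>x. f x ^ k))"
    by (intro integral_mono_AE I ce.real_cond_exp_int(1) Lp_power_integrable[OF k(2)])
  then show "expectation (\<lambda>x. CE J f x ^ k) \<le> expectation (\<lambda>x. f x ^ k)"
    using ce.real_cond_exp_int(2)[OF Lp_power_integrable[OF k(2)]] by simp
qed

lemma CE_L2: "f \<in> L2 K \<Longrightarrow> CE J f \<in> L2 J"
  by (rule CE_Lp) (auto intro: L2_integrable)

lemma CE_L4: "f \<in> L4 K \<Longrightarrow> CE J f \<in> L4 J"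
  by (rule CE_Lp) (auto intro: L2_integrable L4_L2)

lemma CE_ip:
  assumes "f \<in> L2 K" "V \<in> L2 J"
  shows "ip (CE J f) V = ip f V"
  using ce.real_cond_exp_intg(2)[of V f J] L2_mult_integrable[OF assms(2,1)] assms
  by (simp add: Lp_meas_sig Lp_meas mult.commute)

lemma ip_cong_AE:
  assumes "AE x in M. f x = g x" "f \<in> borel_measurable M" "g \<in> borel_measurable M" "V \<in> borel_measurable M"
  shows "ip f V = ip g V"
  by (rule integral_cong_AE) (use assms in auto)

text \<open>Since the right-hand side depends only on \<open>L \<inter> K\<close>, adding to \<open>L\<close> an index outside \<open>K\<close> changes nothing; this
  makes the alternating sums defining Hoeffding components vanish.\<close>

lemma CE_inter_ip:
  assumes f: "f \<in> L2 I" and V: "V \<in> L2 K"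
  shows "ip (CE L f) V = ip (CE (L \<inter> K) f) V"
proof -
  have "ip (CE L f) V = ip (CE K (CE L f)) V"
    by (rule CE_ip[OF CE_L2[OF f] V, symmetric])
  also have "\<dots> = ip (CE (L \<inter> K) f) V"
  proof (rule ip_cong_AE)
    have "AE x in M. CE K (CE L f) x = CE (K \<inter> L) (CE L f) x"
      by (rule CE_commute) (use L2_integrable[OF CE_L2[OF f, of L]] CE_measurable in auto)
    moreover have "AE x in M. CE (K \<inter> L) (CE L f) x = CE (K \<inter> L) f x"
      by (rule ce.real_cond_exp_nested_subalg[OF sig_subalgebra sig_mono])
        (use L2_integrable[OF f] in auto)
    ultimately show "AE x in M. CE K (CE L f) x = CE (L \<inter> K) f x"
      by (auto simp: Int_commute)
  qed (use V Lp_meas in auto)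
  finally show ?thesis .
qed

text \<open>The components at \<open>J\<close> in a Hoeffding decomposition, described by orthogonality: vanishing
  of all conditional expectations given \<open>\<F>\<^sub>K\<close> with \<open>J \<nsubseteq> K\<close> is tested against square-integrable functions,
  which avoids almost sure identities.\<close>

definition pure :: "nat set \<Rightarrow> ('a \<Rightarrow> real) \<Rightarrow> bool" where
  "pure J f \<longleftrightarrow> J \<subseteq> I \<and> f \<in> L2 J \<and> (\<forall>K V. \<not> J \<subseteq> K \<longrightarrow> V \<in> L2 K \<longrightarrow> ip f V = 0)"

lemma pure_L2: "pure J f \<Longrightarrow> f \<in> L2 J" and pure_subset: "pure J f \<Longrightarrow> J \<subseteq> I"
  and pure_ip: "pure J f \<Longrightarrow> \<not> J \<subseteq> K \<Longrightarrow> V \<in> L2 K \<Longrightarrow> ip f V = 0"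
  by (auto simp: pure_def)

lemma pure_orth: "pure J f \<Longrightarrow> pure K g \<Longrightarrow> J \<noteq> K \<Longrightarrow> ip f g = 0"
  using pure_ip[of J f K g] pure_ip[of K g J f] pure_L2 by (fastforce simp: mult.commute)

lemma indicator_L2: "A \<in> sets (sig J) \<Longrightarrow> (indicator A :: 'a \<Rightarrow> real) \<in> L2 J"
proof (rule LpI)
  assume A: "A \<in> sets (sig J)"
  then show m: "(indicator A :: 'a \<Rightarrow> real) \<in> borel_measurable (sig J)" by measurable
  show "integrable M (\<lambda>x. (indicator A x :: real) ^ 2)"
  proof (rule integrable_dominated[of "\<lambda>_. 1"])
    show "(\<lambda>x. (indicator A x :: real) ^ 2) \<in> borel_measurable M"
      by (rule borel_measurable_power[OF measurable_sig[OF m]])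
    show "\<bar>(indicator A x :: real) ^ 2\<bar> \<le> 1" for x
      by (simp split: split_indicator)
  qed simp
qed

lemma CE_eqI_sets:
  assumes "f \<in> L2 K" "g \<in> L2 J" "\<And>A. A \<in> sets (sig J) \<Longrightarrow> ip f (indicator A) = ip g (indicator A)"
  shows "AE x in M. CE J f x = g x"
proof (rule ce.real_cond_exp_charact)
  fix A assume "A \<in> sets (sig J)"
  from assms(3)[OF this]
  show "(\<integral>x\<in>A. f x \<partial>M) = (\<integral>x\<in>A. g x \<partial>M)" by (simp add: set_lebesgue_integral_def mult.commute)
qed (use assms in \<open>auto intro: L2_integrable Lp_meas_sig\<close>)

lemma CE_eqI:
  assumes "f \<in> L2 K" "g \<in> L2 J" "\<And>V. V \<in> L2 J \<Longrightarrow> ip f V = ip g V"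
  shows "AE x in M. CE J f x = g x"
  using CE_eqI_sets[OF assms(1,2) assms(3)[OF indicator_L2]] .

lemma CE_self: "f \<in> L2 J \<Longrightarrow> J \<inter> I \<subseteq> K \<Longrightarrow> AE x in M. CE K f x = f x"
  by (rule CE_eqI) (auto intro: Lp_mono)

lemma pure_cmult: "pure J f \<Longrightarrow> pure J (\<lambda>x. c * f x)"
  by (auto simp: pure_def Lp_cmult mult.assoc)

lemma ip_add_left:
  "f \<in> L2 J \<Longrightarrow> g \<in> L2 K \<Longrightarrow> h \<in> L2 L \<Longrightarrow> ip (\<lambda>x. f x + g x) h = ip f h + ip g h"
  by (simp add: distrib_right Bochner_Integration.integral_add L2_mult_integrable)

lemma ip_sum_left:
  "(\<And>i. i \<in> A \<Longrightarrow> f i \<in> L2 J) \<Longrightarrow> g \<in> L2 K \<Longrightarrow> ip (\<lambda>x. \<Sum>i\<in>A. f i x) g = (\<Sum>i\<in>A. ip (f i) g)"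
  unfolding sum_distrib_right by (rule Bochner_Integration.integral_sum) (rule L2_mult_integrable)

lemma ip_sum_sum:
  assumes "\<And>i. i \<in> A \<Longrightarrow> f i \<in> L2 J" "\<And>i. i \<in> B \<Longrightarrow> g i \<in> L2 K"
  shows "ip (\<lambda>x. \<Sum>i\<in>A. f i x) (\<lambda>x. \<Sum>i\<in>B. g i x) = (\<Sum>i\<in>A. \<Sum>j\<in>B. ip (f i) (g j))"
proof -
  have "ip (\<lambda>x. \<Sum>i\<in>A. f i x) (\<lambda>x. \<Sum>i\<in>B. g i x) = (\<Sum>i\<in>A. ip (f i) (\<lambda>x. \<Sum>i\<in>B. g i x))"
    by (rule ip_sum_left[of _ _ J _ K]) (use assms in \<open>simp_all add: Lp_sum\<close>)
  also have "\<dots> = (\<Sum>i\<in>A. \<Sum>j\<in>B. ip (f i) (g j))"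
    unfolding sum_distrib_left
    by (intro sum.cong refl Bochner_Integration.integral_sum L2_mult_integrable[of _ J _ K]) (simp_all add: assms)
  finally show ?thesis .
qed

lemma pure_add: "pure J f \<Longrightarrow> pure J g \<Longrightarrow> pure J (\<lambda>x. f x + g x)"
  unfolding pure_def using ip_add_left[of f J g J] by (auto simp: Lp_add)

lemma pure_0: "J \<subseteq> I \<Longrightarrow> pure J (\<lambda>x. 0)"
  by (simp add: pure_def Lp_const)

lemma pure_sum: "J \<subseteq> I \<Longrightarrow> (\<And>i. i \<in> A \<Longrightarrow> pure J (f i)) \<Longrightarrow> pure J (\<lambda>x. \<Sum>i\<in>A. f i x)"
  by (induction A rule: infinite_finite_induct) (auto intro: pure_0 pure_add)

lemma pure_diff: "pure J f \<Longrightarrow> pure J g \<Longrightarrow> pure J (\<lambda>x. f x - g x)"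
  using pure_add[of J f "\<lambda>x. - g x"] pure_cmult[of J g "-1"] by simp

text \<open>The Hoeffding component of \<open>Z\<close> at \<open>J\<close>, by Moebius inversion of \<open>E[Z | \<F>\<^sub>J] = \<Sum>\<^sub>L\<^sub>\<subseteq>\<^sub>J Z\<^sub>L\<close>.\<close>

definition hcomp :: "('a \<Rightarrow> real) \<Rightarrow> nat set \<Rightarrow> 'a \<Rightarrow> real" where
  "hcomp Z J x = (-1) ^ card J * (\<Sum>L\<in>Pow J. (-1) ^ card L * CE L Z x)"

lemma sum_hcomp: "finite S \<Longrightarrow> (\<Sum>J\<in>Pow S. hcomp Z J x) = CE S Z x"
  unfolding hcomp_def
  by (rule inclusion_exclusion_symmetric[symmetric, of "\<lambda>S. \<Sum>L\<in>Pow S. (-1) ^ card L * CE L Z x"]) auto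

lemma hcomp_L2: "J \<subseteq> I \<Longrightarrow> Z \<in> L2 I \<Longrightarrow> hcomp Z J \<in> L2 J"
  unfolding hcomp_def
  by (intro Lp_cmult Lp_sum) (auto intro: Lp_mono[OF CE_L2])

lemma hcomp_pure:
  assumes "J \<subseteq> I" "Z \<in> L2 I"
  shows "pure J (hcomp Z J)"
  unfolding pure_def
proof (intro conjI allI impI)
  fix K V assume "\<not> J \<subseteq> K" and V: "V \<in> L2 K"
  then obtain j where j: "j \<in> J" "j \<notin> K" by auto
  have "ip (hcomp Z J) V = (-1) ^ card J * (\<Sum>L\<in>Pow J. (-1) ^ card L * ip (CE L Z) V)"
  proof -
    have "ip (hcomp Z J) V = (-1) ^ card J * ip (\<lambda>x. \<Sum>L\<in>Pow J. (-1) ^ card L * CE L Z x) V"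
      unfolding hcomp_def by (simp add: mult.assoc)
    also have "ip (\<lambda>x. \<Sum>L\<in>Pow J. (-1) ^ card L * CE L Z x) V = (\<Sum>L\<in>Pow J. ip (\<lambda>x. (-1) ^ card L * CE L Z x) V)"
      by (rule ip_sum_left[OF _ V, of _ _ J]) (auto intro!: Lp_cmult Lp_mono[OF CE_L2[OF assms(2)]])
    finally show ?thesis by (simp add: mult.assoc)
  qed
  also have "(\<Sum>L\<in>Pow J. (-1) ^ card L * ip (CE L Z) V) = 0"
  proof (rule alternating_Pow_sum_0[OF _ j(1)])
    show "finite J" using assms finite_index finite_subset by blast
    show "ip (CE (insert j L) Z) V = ip (CE L Z) V" for L
      using CE_inter_ip[OF assms(2) V, of "insert j L"] CE_inter_ip[OF assms(2) V, of L] j by simp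
  qed
  finally show "ip (hcomp Z J) V = 0" by simp
qed (use assms hcomp_L2 in auto)

lemma sum_hcomp_AE: "Z \<in> L2 I \<Longrightarrow> AE x in M. Z x = (\<Sum>J\<in>Pow I. hcomp Z J x)"
  using CE_self[of Z I I] by (auto simp: sum_hcomp finite_index)

lemma ip_sum_pure:
  assumes "\<And>J. J \<subseteq> I \<Longrightarrow> pure J (F J)" "\<And>J. J \<subseteq> I \<Longrightarrow> pure J (G J)"
  shows "ip (\<lambda>x. \<Sum>J\<in>Pow I. F J x) (\<lambda>x. \<Sum>J\<in>Pow I. G J x) = (\<Sum>J\<in>Pow I. ip (F J) (G J))"
proof -
  have "ip (\<lambda>x. \<Sum>J\<in>Pow I. F J x) (\<lambda>x. \<Sum>J\<in>Pow I. G J x) = (\<Sum>J\<in>Pow I. \<Sum>K\<in>Pow I. ip (F J) (G K))"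
    by (rule ip_sum_sum[of _ _ I _ _ I]) (auto intro: Lp_mono[OF pure_L2] assms)
  also have "\<dots> = (\<Sum>J\<in>Pow I. \<Sum>K\<in>Pow I. if J = K then ip (F J) (G J) else 0)"
    by (intro sum.cong refl) (auto intro: pure_orth assms)
  finally show ?thesis by (simp add: finite_index)
qed

lemma parseval:
  assumes "Z \<in> L2 I" "Y \<in> L2 I"
  shows "ip Z Y = (\<Sum>J\<in>Pow I. ip (hcomp Z J) (hcomp Y J))"
proof -
  have m: "(\<lambda>x. \<Sum>J\<in>Pow I. hcomp U J x) \<in> borel_measurable M" if "U \<in> L2 I" for U
    by (rule Lp_meas[of _ 2 I], rule Lp_sum) (auto intro: Lp_mono[OF hcomp_L2[OF _ that]])
  have "ip Z Y = ip (\<lambda>x. \<Sum>J\<in>Pow I. hcomp Z J x) (\<lambda>x. \<Sum>J\<in>Pow I. hcomp Y J x)"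
    by (rule integral_cong_AE)
      (use sum_hcomp_AE[OF assms(1)] sum_hcomp_AE[OF assms(2)] m[OF assms(1)] m[OF assms(2)] assms[THEN Lp_meas] in auto)
  also have "\<dots> = (\<Sum>J\<in>Pow I. ip (hcomp Z J) (hcomp Y J))"
    by (rule ip_sum_pure) (auto intro: hcomp_pure assms)
  finally show ?thesis .
qed

lemma ip_self_zero: "f \<in> L2 J \<Longrightarrow> ip f f = 0 \<Longrightarrow> AE x in M. f x = 0"
  using integral_nonneg_eq_0_iff_AE[of M "\<lambda>x. f x * f x"] L2_mult_integrable[of f J f J] by auto

lemma ip_self_nonneg: "ip f f \<ge> 0"
  by (rule Bochner_Integration.integral_nonneg) simp

lemma ip_Cauchy_Schwarz:
  assumes "f \<in> L2 J" "g \<in> L2 K"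
  shows "(ip f g)\<^sup>2 \<le> ip f f * ip g g"
proof -
  have nn: "0 \<le> t\<^sup>2 * ip f f + 2 * t * ip f g + ip g g" for t
  proof -
    have "0 \<le> expectation (\<lambda>x. (t * f x + g x)\<^sup>2)" by simp
    also have "\<dots> = expectation (\<lambda>x. t\<^sup>2 * (f x * f x) + 2 * t * (f x * g x) + g x * g x)"
      by (intro Bochner_Integration.integral_cong) (auto simp: power2_eq_square algebra_simps)
    also have "\<dots> = t\<^sup>2 * ip f f + 2 * t * ip f g + ip g g"
      using L2_mult_integrable[OF assms] L2_mult_integrable[OF assms(1) assms(1)]
        L2_mult_integrable[OF assms(2) assms(2)] by simp
    finally show ?thesis .
  qed
  then show ?thesis by (intro discriminant_le ip_self_nonneg)
qed

lemma CE_empty: "f \<in> L2 K \<Longrightarrow> AE x in M. CE {} f x = expectation f"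
proof (rule CE_eqI)
  assume f: "f \<in> L2 K"
  show "(\<lambda>x. expectation f) \<in> L2 {}" by (rule Lp_const)
  fix V assume V: "V \<in> L2 {}"
  show "ip f V = ip (\<lambda>x. expectation f) V"
    using indep_sig_expectation(1)[of K "{}" f V] f V by (simp add: Lp_meas_sig L2_integrable)
qed

lemma hcomp_empty: "Z \<in> L2 I \<Longrightarrow> AE x in M. hcomp Z {} x = expectation Z"
  using CE_empty[of Z I] by (simp add: hcomp_def)

lemma hcomp_L4: "J \<subseteq> I \<Longrightarrow> Z \<in> L4 I \<Longrightarrow> hcomp Z J \<in> L4 J"
  unfolding hcomp_def
  by (intro Lp_cmult Lp_sum) (auto intro: Lp_mono[OF CE_L4])

section \<open>Products of two degenerate U-statistics\<close>

lemma L2_mult_indicator: "f \<in> L2 J \<Longrightarrow> A \<in> sets (sig K) \<Longrightarrow> (\<lambda>x. f x * indicator A x) \<in> L2 (J \<union> K)"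
  by (rule L2_mult_bounded[of _ _ _ _ 1]) (auto simp: indicator_def)

text \<open>Testing with indicators is enough. Products of two components are only square-integrable, so they
  can be multiplied by a bounded function but not directly by a square-integrable one.\<close>

lemma pureI_sets:
  assumes "J \<subseteq> I" "f \<in> L2 J"
    "\<And>K A. \<not> J \<subseteq> K \<Longrightarrow> A \<in> sets (sig K) \<Longrightarrow> ip f (indicator A) = 0"
  shows "pure J f"
  unfolding pure_def
proof (intro conjI allI impI)
  fix K V assume K: "\<not> J \<subseteq> K" and V: "V \<in> L2 K"
  have "AE x in M. CE K f x = 0"
    by (rule CE_eqI_sets[OF assms(2) Lp_const]) (use assms(3)[OF K] in auto)
  then have "ip (CE K f) V = ip (\<lambda>x. 0) V"
    by (rule ip_cong_AE) (use V Lp_meas in auto)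
  then show "ip f V = 0" using CE_ip[OF assms(2) V] by simp
qed (use assms in auto)

text \<open>The kernels of a degenerate \<open>U\<close>-statistic of order \<open>p\<close> with finite fourth moments. All other
  components are identically \<open>0\<close>, not just almost surely, so that sums can range over all subsets
  of \<open>I\<close>.\<close>

definition degen :: "nat \<Rightarrow> (nat set \<Rightarrow> 'a \<Rightarrow> real) \<Rightarrow> bool" where
  "degen p F \<longleftrightarrow> (\<forall>J. (J \<subseteq> I \<and> card J = p \<longrightarrow> pure J (F J) \<and> F J \<in> L4 J)
                   \<and> (\<not> (J \<subseteq> I \<and> card J = p) \<longrightarrow> F J = (\<lambda>_. 0)))"

definition Ustat :: "(nat set \<Rightarrow> 'a \<Rightarrow> real) \<Rightarrow> 'a \<Rightarrow> real" where
  "Ustat F x = (\<Sum>J\<in>Pow I. F J x)"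

text \<open>The part \<open>d\<^sub>j f = f - E\<^sub>j f\<close> of \<open>f = Ustat F\<close> that depends on the \<open>j\<close>-th variable.\<close>

definition Dpart :: "(nat set \<Rightarrow> 'a \<Rightarrow> real) \<Rightarrow> nat \<Rightarrow> 'a \<Rightarrow> real" where
  "Dpart F j x = (\<Sum>J\<in>{J\<in>Pow I. j \<in> J}. F J x)"

text \<open>A version of \<open>E\<^sub>j f\<close> for \<open>f = Ustat F\<close>.\<close>

definition Apart :: "(nat set \<Rightarrow> 'a \<Rightarrow> real) \<Rightarrow> nat \<Rightarrow> 'a \<Rightarrow> real" where
  "Apart F j x = (\<Sum>J\<in>Pow (I - {j}). F J x)"

text \<open>Twice the carre du champ of \<open>f \<mapsto> \<Sum>\<^sub>j (E\<^sub>j f - f)\<close>.\<close>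

definition Gamma2 :: "(nat set \<Rightarrow> 'a \<Rightarrow> real) \<Rightarrow> (nat set \<Rightarrow> 'a \<Rightarrow> real) \<Rightarrow> 'a \<Rightarrow> real" where
  "Gamma2 F G x = (\<Sum>j\<in>I. Dpart F j x * Dpart G j x + CE (I - {j}) (\<lambda>x. Dpart F j x * Dpart G j x) x)"

text \<open>The component of \<open>Ustat F * Ustat G\<close> at \<open>N\<close> if \<open>card N\<close> is the sum of the orders, and \<open>0\<close> for
  all other \<open>N\<close>.\<close>

definition top_part :: "(nat set \<Rightarrow> 'a \<Rightarrow> real) \<Rightarrow> (nat set \<Rightarrow> 'a \<Rightarrow> real) \<Rightarrow> nat set \<Rightarrow> 'a \<Rightarrow> real" where
  "top_part F G N x = (\<Sum>J\<in>Pow N. F J x * G (N - J) x)"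

lemma degen_L4: "degen p F \<Longrightarrow> F J \<in> L4 J"
  unfolding degen_def using Lp_const[of 0 4 J] by metis

lemma degen_L2: "degen p F \<Longrightarrow> F J \<in> L2 J"
  using degen_L4 L4_L2 by blast

lemma degen_pure: "degen p F \<Longrightarrow> J \<subseteq> I \<Longrightarrow> pure J (F J)"
  unfolding degen_def using pure_0[of J] by metis

lemma degen_0: "degen p F \<Longrightarrow> \<not> (J \<subseteq> I \<and> card J = p) \<Longrightarrow> F J = (\<lambda>_. 0)"
  unfolding degen_def by blast

lemma Ustat_split: "j \<in> I \<Longrightarrow> Ustat F x = Apart F j x + Dpart F j x"
proof -
  have "Pow I = Pow (I - {j}) \<union> {J\<in>Pow I. j \<in> J}" by auto
  then have "Ustat F x = (\<Sum>J\<in>Pow (I - {j}) \<union> {J\<in>Pow I. j \<in> J}. F J x)" by (simp only: Ustat_def)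
  also have "\<dots> = Apart F j x + Dpart F j x"
    unfolding Apart_def Dpart_def by (intro sum.union_disjoint) (auto simp: finite_index)
  finally show ?thesis .
qed

lemma Ustat_L4: "degen p F \<Longrightarrow> Ustat F \<in> L4 I"
  unfolding Ustat_def by (intro Lp_sum) (auto intro: Lp_mono[OF degen_L4])

lemma Ustat_L2: "degen p F \<Longrightarrow> Ustat F \<in> L2 I"
  using Ustat_L4 L4_L2 by blast

lemma Dpart_L4: "degen p F \<Longrightarrow> Dpart F j \<in> L4 I"
  unfolding Dpart_def by (intro Lp_sum) (auto intro: Lp_mono[OF degen_L4])

lemma Dpart_L2: "degen p F \<Longrightarrow> Dpart F j \<in> L2 I"
  using Dpart_L4 L4_L2 by blast

lemma Apart_L4: "degen p F \<Longrightarrow> Apart F j \<in> L4 (I - {j})"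
  unfolding Apart_def by (intro Lp_sum) (auto intro: Lp_mono[OF degen_L4])

lemma Ustat_mult_L2: "degen p F \<Longrightarrow> degen q G \<Longrightarrow> (\<lambda>x. Ustat F x * Ustat G x) \<in> L2 I"
  using L4_mult[OF Ustat_L4 Ustat_L4] by fastforce

lemma Dpart_mult_L2: "degen p F \<Longrightarrow> degen q G \<Longrightarrow> (\<lambda>x. Dpart F j x * Dpart G j x) \<in> L2 I"
  using L4_mult[OF Dpart_L4 Dpart_L4] by fastforce

lemma Dpart_ip_0:
  assumes "degen p F" "V \<in> L2 K" "j \<notin> K"
  shows "ip (Dpart F j) V = 0"
proof -
  have "ip (Dpart F j) V = (\<Sum>J\<in>{J\<in>Pow I. j \<in> J}. ip (F J) V)"
    unfolding Dpart_def
    by (rule ip_sum_left[of _ _ I _ K]) (use assms in \<open>auto intro: Lp_mono[OF degen_L2]\<close>)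
  also have "\<dots> = 0"
    using assms by (intro sum.neutral) (auto intro!: pure_ip[OF degen_pure])
  finally show ?thesis .
qed

lemma sum_over_members:
  fixes f :: "nat set \<Rightarrow> real"
  shows "(\<Sum>j\<in>I. \<Sum>J\<in>{J\<in>Pow I. j \<in> J}. f J) = (\<Sum>J\<in>Pow I. real (card J) * f J)"
proof -
  have "(\<Sum>j\<in>I. \<Sum>J\<in>{J\<in>Pow I. j \<in> J}. f J) = (\<Sum>J\<in>Pow I. \<Sum>j\<in>{j\<in>I. j \<in> J}. f J)"
    by (rule sum.swap_restrict) (auto simp: finite_index)
  also have "\<dots> = (\<Sum>J\<in>Pow I. real (card J) * f J)"
  proof (rule sum.cong[OF refl])
    fix J assume "J \<in> Pow I"
    then have "{j\<in>I. j \<in> J} = J" by auto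
    then show "(\<Sum>j\<in>{j\<in>I. j \<in> J}. f J) = real (card J) * f J" by simp
  qed
  finally show ?thesis .
qed

lemma sum_Dpart: "degen p F \<Longrightarrow> (\<Sum>j\<in>I. Dpart F j x) = real p * Ustat F x"
  unfolding Dpart_def Ustat_def sum_over_members sum_distrib_left
  using degen_0[of p F] by (intro sum.cong) auto

text \<open>The mixed terms have zero conditional mean because \<open>E\<^sub>j (d\<^sub>j f) = 0\<close>.\<close>

lemma CE_Ustat_mult:
  assumes F: "degen p F" and G: "degen q G" and j: "j \<in> I"
  shows "AE x in M. CE (I - {j}) (\<lambda>x. Ustat F x * Ustat G x) x =
    Apart F j x * Apart G j x + CE (I - {j}) (\<lambda>x. Dpart F j x * Dpart G j x) x"
proof (rule CE_eqI_sets[OF Ustat_mult_L2[OF F G]])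
  let ?K = "I - {j}"
  let ?D = "\<lambda>x. Dpart F j x * Dpart G j x"
  have aa: "(\<lambda>x. Apart F j x * Apart G j x) \<in> L2 ?K"
    using L4_mult[OF Apart_L4[OF F, of j] Apart_L4[OF G, of j]] by simp
  have dd: "?D \<in> L2 I" using Dpart_mult_L2 F G .
  show "(\<lambda>x. Apart F j x * Apart G j x + CE ?K ?D x) \<in> L2 ?K"
    by (intro Lp_add aa CE_L2[OF dd]) simp
  fix A assume A: "A \<in> sets (sig ?K)"
  let ?ind = "indicator A :: 'a \<Rightarrow> real"
  have i1: "?ind \<in> L2 ?K" using A by (rule indicator_L2)
  have cross: "ip (Dpart F j) (\<lambda>x. Apart G j x * ?ind x) = 0" if "degen p F" "degen q G" for p q F G
    by (rule Dpart_ip_0[OF that(1), of _ ?K])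
      (use L2_mult_indicator[OF L4_L2[OF Apart_L4[OF that(2), of j]] A] in auto)
  have int: "integrable M (\<lambda>x. Dpart F j x * (Apart G j x * ?ind x))" if "degen p F" "degen q G" for p q F G
    by (rule L2_mult_integrable[OF Dpart_L2[OF that(1)] L2_mult_indicator[OF L4_L2[OF Apart_L4[OF that(2)]] A]])
  have "ip (\<lambda>x. Ustat F x * Ustat G x) ?ind =
     expectation (\<lambda>x. (Apart F j x * Apart G j x * ?ind x + ?D x * ?ind x)
        + (Dpart F j x * (Apart G j x * ?ind x) + Dpart G j x * (Apart F j x * ?ind x)))"
    by (intro Bochner_Integration.integral_cong) (auto simp: Ustat_split[OF j] algebra_simps)
  also have "\<dots> = (ip (\<lambda>x. Apart F j x * Apart G j x) ?ind + ip ?D ?ind)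
        + (ip (Dpart F j) (\<lambda>x. Apart G j x * ?ind x) + ip (Dpart G j) (\<lambda>x. Apart F j x * ?ind x))"
    using int[OF F G] int[OF G F] L2_mult_integrable[OF aa i1] L2_mult_integrable[OF dd i1] by simp
  also have "\<dots> = ip (\<lambda>x. Apart F j x * Apart G j x) ?ind + ip (CE ?K ?D) ?ind"
    using cross[OF F G] cross[OF G F] CE_ip[OF dd i1] by simp
  also have "\<dots> = ip (\<lambda>x. Apart F j x * Apart G j x + CE ?K ?D x) ?ind"
    by (rule ip_add_left[symmetric, OF aa CE_L2[OF dd] i1])
  finally show "ip (\<lambda>x. Ustat F x * Ustat G x) ?ind = ip (\<lambda>x. Apart F j x * Apart G j x + CE ?K ?D x) ?ind" .
qed

text \<open>Summing \<open>d\<^sub>j f d\<^sub>j g + E\<^sub>j (d\<^sub>j f d\<^sub>j g) = d\<^sub>j f g + f d\<^sub>j g - (f g - E\<^sub>j (f g))\<close> over \<open>j\<close> produces the factors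
  \<open>p\<close>, \<open>q\<close> and, in the component at \<open>N\<close>, the number \<open>card N\<close> of indices \<open>j\<close> that the component depends on.\<close>

lemma Gamma2_hcomp:
  assumes F: "degen p F" and G: "degen q G"
  defines "Z \<equiv> \<lambda>x. Ustat F x * Ustat G x"
  shows "AE x in M. Gamma2 F G x = (\<Sum>N\<in>Pow I. (real (p + q) - real (card N)) * hcomp Z N x)"
proof -
  have Z: "Z \<in> L2 I" unfolding Z_def using Ustat_mult_L2 F G .
  have "AE x in M. \<forall>j\<in>I. CE (I - {j}) Z x =
    Apart F j x * Apart G j x + CE (I - {j}) (\<lambda>x. Dpart F j x * Dpart G j x) x"
    using finite_index CE_Ustat_mult[OF F G] by (intro AE_finite_allI) (auto simp: Z_def)
  then show ?thesis using sum_hcomp_AE[OF Z]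
  proof eventually_elim
    fix x assume h: "\<forall>j\<in>I. CE (I - {j}) Z x =
        Apart F j x * Apart G j x + CE (I - {j}) (\<lambda>x. Dpart F j x * Dpart G j x) x"
      and Zx: "Z x = (\<Sum>J\<in>Pow I. hcomp Z J x)"
    have *: "Z x - CE (I - {j}) Z x = (\<Sum>N\<in>{N\<in>Pow I. j \<in> N}. hcomp Z N x)" if "j \<in> I" for j
      using Ustat_split[OF that, of "hcomp Z" x] that
      unfolding Zx Ustat_def Apart_def Dpart_def
      using sum_hcomp[of "I - {j}" Z x] finite_index by simp
    have "Gamma2 F G x = (\<Sum>j\<in>I. Dpart F j x * Ustat G x + Dpart G j x * Ustat F x - (Z x - CE (I - {j}) Z x))"
      unfolding Gamma2_def
    proof (rule sum.cong[OF refl])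
      fix j assume j: "j \<in> I"
      show "Dpart F j x * Dpart G j x + CE (I - {j}) (\<lambda>x. Dpart F j x * Dpart G j x) x =
         Dpart F j x * Ustat G x + Dpart G j x * Ustat F x - (Z x - CE (I - {j}) Z x)"
        using h[rule_format, OF j] Ustat_split[OF j, of F x] Ustat_split[OF j, of G x]
        unfolding Z_def by (simp add: algebra_simps)
    qed
    also have "\<dots> = real (p + q) * Z x - (\<Sum>j\<in>I. Z x - CE (I - {j}) Z x)"
      using sum_Dpart[OF F, of x] sum_Dpart[OF G, of x]
      unfolding sum_subtractf sum.distrib sum_distrib_right[symmetric] by (simp add: Z_def algebra_simps)
    also have "(\<Sum>j\<in>I. Z x - CE (I - {j}) Z x) = (\<Sum>N\<in>Pow I. real (card N) * hcomp Z N x)"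
      unfolding sum_over_members[symmetric] using * by (intro sum.cong) auto
    finally show "Gamma2 F G x = (\<Sum>N\<in>Pow I. (real (p + q) - real (card N)) * hcomp Z N x)"
      unfolding Zx left_diff_distrib sum_subtractf sum_distrib_left .
  qed
qed

text \<open>If \<open>j\<close> lies in \<open>J\<close> but not in \<open>L\<close>, then \<open>G K\<close> and the \<open>\<F>\<^sub>L\<close>-measurable test function do not involve \<open>j\<close>,
  and \<open>F J\<close> averages to \<open>0\<close> over the \<open>j\<close>-th variable.\<close>

lemma pure_disjoint_mult:
  assumes F: "degen p F" and G: "degen q G" and "J \<inter> K = {}" "J \<subseteq> I" "K \<subseteq> I"
  shows "pure (J \<union> K) (\<lambda>x. F J x * G K x)"
proof (rule pureI_sets)
  show "J \<union> K \<subseteq> I" using assms by auto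
  show "(\<lambda>x. F J x * G K x) \<in> L2 (J \<union> K)" by (rule L4_mult[OF degen_L4[OF F] degen_L4[OF G]])
  fix L A assume L: "\<not> J \<union> K \<subseteq> L" and A: "A \<in> sets (sig L)"
  let ?ind = "indicator A :: 'a \<Rightarrow> real"
  consider j where "j \<in> J" "j \<notin> L" | j where "j \<in> K" "j \<notin> L" using L by blast
  then show "ip (\<lambda>x. F J x * G K x) ?ind = 0"
  proof cases
    case 1
    have "ip (\<lambda>x. F J x * G K x) ?ind = ip (F J) (\<lambda>x. G K x * ?ind x)" by (simp add: mult.assoc)
    also have "\<dots> = 0"
      by (rule pure_ip[OF degen_pure[OF F] _ L2_mult_indicator[OF degen_L2[OF G] A]]) (use 1 assms in auto)
    finally show ?thesis .
  next
    case 2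
    have "ip (\<lambda>x. F J x * G K x) ?ind = ip (G K) (\<lambda>x. F J x * ?ind x)" by (simp add: ac_simps)
    also have "\<dots> = 0"
      by (rule pure_ip[OF degen_pure[OF G] _ L2_mult_indicator[OF degen_L2[OF F] A]]) (use 2 assms in auto)
    finally show ?thesis .
  qed
qed

lemma top_part_pure:
  assumes F: "degen p F" and G: "degen q G" and "N \<subseteq> I"
  shows "pure N (top_part F G N)"
  unfolding top_part_def
proof (rule pure_sum[OF assms(3)])
  fix J assume "J \<in> Pow N"
  then show "pure N (\<lambda>x. F J x * G (N - J) x)"
    using pure_disjoint_mult[OF F G, of J "N - J"] assms(3) by (auto simp: Un_absorb1)
qed

lemma hcomp_ip:
  assumes "Z \<in> L2 I" "pure N Y"
  shows "ip (hcomp Z N) Y = ip Z Y"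
proof -
  have Y: "Y \<in> L2 I" and N: "N \<subseteq> I" using pure_L2[OF assms(2)] pure_subset[OF assms(2)] Lp_mono by auto
  have c: "hcomp Z J \<in> L2 I" if "J \<in> Pow I" for J
    using that hcomp_L2[OF _ assms(1)] by (auto intro: Lp_mono)
  have "ip Z Y = ip (\<lambda>x. \<Sum>J\<in>Pow I. hcomp Z J x) Y"
    by (rule ip_cong_AE) (use sum_hcomp_AE[OF assms(1)] assms(1) Y c in \<open>auto intro!: Lp_meas\<close>)
  also have "\<dots> = (\<Sum>J\<in>Pow I. ip (hcomp Z J) Y)"
    by (rule ip_sum_left[OF c Y])
  also have "\<dots> = (\<Sum>J\<in>Pow I. if J = N then ip (hcomp Z N) Y else 0)"
    by (intro sum.cong refl) (auto intro: pure_orth hcomp_pure assms)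
  finally show ?thesis using N by (simp add: finite_index)
qed

text \<open>Both sides are pure at \<open>N\<close>, and they have the same inner product with their difference, because no
  product \<open>F\<^sub>J G\<^sub>K\<close> other than those from partitions of \<open>N\<close> can involve all indices of \<open>N\<close>.\<close>

lemma hcomp_top:
  assumes F: "degen p F" and G: "degen q G" and N: "N \<subseteq> I" "card N \<ge> p + q"
  defines "Z \<equiv> \<lambda>x. Ustat F x * Ustat G x"
  shows "AE x in M. hcomp Z N x = top_part F G N x"
proof -
  let ?Y = "\<lambda>x. hcomp Z N x - top_part F G N x"
  have Z: "Z \<in> L2 I" unfolding Z_def using Ustat_mult_L2 F G .
  have Y: "pure N ?Y" by (intro pure_diff hcomp_pure top_part_pure[OF F G] N Z)
  note Y2 = pure_L2[OF Y]
  have FG: "(\<lambda>x. F J x * G K x) \<in> L2 (J \<union> K)" for J K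
    by (rule L4_mult[OF degen_L4[OF F] degen_L4[OF G]])
  \<comment> \<open>If \<open>J \<union> K\<close> does not contain \<open>N\<close>, purity of \<open>?Y\<close> kills the summand; since \<open>card N\<close> is at least
    \<open>p + q\<close>, the only other case is a partition of \<open>N\<close> into \<open>J\<close> and \<open>K\<close>.\<close>
  have summand: "ip (\<lambda>x. F J x * G K x) ?Y = (if K = N - J then if J \<subseteq> N then ip (\<lambda>x. F J x * G (N - J) x) ?Y else 0 else 0)"
    if "J \<subseteq> I" "K \<subseteq> I" for J K
  proof (cases "J \<subseteq> N \<and> K = N - J")
    case False
    have "ip (\<lambda>x. F J x * G K x) ?Y = 0"
    proof (cases "card J = p \<and> card K = q")
      case True
      have fin: "finite J" "finite K" "finite N" using that N finite_index finite_subset by blast+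
      have "\<not> N \<subseteq> J \<union> K"
      proof
        assume sub: "N \<subseteq> J \<union> K"
        have "card (J \<union> K) + card (J \<inter> K) = p + q" using card_Un_Int[OF fin(1,2)] True by simp
        moreover have "card N \<le> card (J \<union> K)" using sub fin by (intro card_mono) auto
        ultimately have "card (J \<union> K) = card N" "card (J \<inter> K) = 0" using N by auto
        then have "N = J \<union> K" "J \<inter> K = {}" using card_subset_eq[OF _ sub] fin by auto
        then show False using False by auto
      qed
      then have "ip ?Y (\<lambda>x. F J x * G K x) = 0" using pure_ip[OF Y _ FG] by blast
      then show ?thesis by (simp add: mult.commute)
    next
      case False
      then have "F J = (\<lambda>_. 0) \<or> G K = (\<lambda>_. 0)" using degen_0[OF F, of J] degen_0[OF G, of K] by auto
      then show ?thesis by auto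
    qed
    with False show ?thesis by auto
  qed auto
  have "ip Z ?Y = ip (\<lambda>x. \<Sum>J\<in>Pow I. \<Sum>K\<in>Pow I. F J x * G K x) ?Y"
    unfolding Z_def Ustat_def sum_product ..
  also have "\<dots> = (\<Sum>J\<in>Pow I. ip (\<lambda>x. \<Sum>K\<in>Pow I. F J x * G K x) ?Y)"
    by (rule ip_sum_left[OF _ Y2, of _ _ I]) (auto intro!: Lp_sum Lp_mono[OF FG])
  also have "\<dots> = (\<Sum>J\<in>Pow I. \<Sum>K\<in>Pow I. ip (\<lambda>x. F J x * G K x) ?Y)"
    by (intro sum.cong refl ip_sum_left[OF _ Y2, of _ _ I]) (auto intro!: Lp_mono[OF FG])
  also have "\<dots> = (\<Sum>J\<in>Pow I. \<Sum>K\<in>Pow I. if K = N - J then if J \<subseteq> N then ip (\<lambda>x. F J x * G (N - J) x) ?Y else 0 else 0)"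
    by (intro sum.cong refl summand) auto
  also have "\<dots> = (\<Sum>J\<in>Pow I. if J \<subseteq> N then ip (\<lambda>x. F J x * G (N - J) x) ?Y else 0)"
    using N by (intro sum.cong refl) (auto simp: finite_index)
  also have "\<dots> = (\<Sum>J\<in>Pow N. ip (\<lambda>x. F J x * G (N - J) x) ?Y)"
    using N by (intro sum.mono_neutral_cong_right) (auto simp: finite_index)
  also have "\<dots> = ip (\<lambda>x. \<Sum>J\<in>Pow N. F J x * G (N - J) x) ?Y"
    by (rule ip_sum_left[OF _ Y2, of _ _ I, symmetric]) (use N in \<open>auto intro!: Lp_mono[OF FG]\<close>)
  also have "\<dots> = ip (top_part F G N) ?Y"
    by (simp only: top_part_def)
  finally have eq: "ip Z ?Y = ip (top_part F G N) ?Y" .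
  have "ip ?Y ?Y = ip (hcomp Z N) ?Y - ip (top_part F G N) ?Y"
    using L2_mult_integrable[OF hcomp_L2[OF N(1) Z] Y2] L2_mult_integrable[OF pure_L2[OF top_part_pure[OF F G N(1)]] Y2]
    by (simp add: left_diff_distrib)
  also have "\<dots> = 0" using eq hcomp_ip[OF Z Y] by simp
  finally show ?thesis using ip_self_zero[OF Y2] by auto
qed

lemma top_part_0:
  assumes F: "degen p F" and G: "degen q G" and N: "N \<subseteq> I" "card N \<noteq> p + q"
  shows "top_part F G N = (\<lambda>_. 0)"
proof (rule ext)
  fix x
  have "F J x * G (N - J) x = 0" if "J \<in> Pow N" for J
  proof -
    have "finite N" using N finite_index finite_subset by blast
    then have "card N = card J + card (N - J)" using that
      by (metis Pow_iff add.commute card_Diff_subset card_mono finite_subset le_add_diff_inverse2)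
    then have "card J \<noteq> p \<or> card (N - J) \<noteq> q" using N by auto
    then show ?thesis using degen_0[OF F, of J] degen_0[OF G, of "N - J"] by auto
  qed
  then show "top_part F G N x = 0" unfolding top_part_def by (intro sum.neutral) auto
qed

definition top_energy :: "(nat set \<Rightarrow> 'a \<Rightarrow> real) \<Rightarrow> (nat set \<Rightarrow> 'a \<Rightarrow> real) \<Rightarrow> real" where
  "top_energy F G = (\<Sum>N\<in>Pow I. ip (top_part F G N) (top_part F G N))"

text \<open>The squared norm of the part of \<open>Ustat F * Ustat G\<close> of orders strictly between \<open>0\<close> and \<open>p + q\<close>,
  written through moments so that it can be estimated; the identification is \<open>low_energy_eq\<close>.\<close>

definition low_energy :: "(nat set \<Rightarrow> 'a \<Rightarrow> real) \<Rightarrow> (nat set \<Rightarrow> 'a \<Rightarrow> real) \<Rightarrow> real" where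
  "low_energy F G = expectation (\<lambda>x. (Ustat F x)\<^sup>2 * (Ustat G x)\<^sup>2) - (ip (Ustat F) (Ustat G))\<^sup>2 - top_energy F G"

lemma hcomp_ip_top:
  assumes F: "degen p F" and G: "degen q G" and N: "N \<subseteq> I" "card N \<ge> p + q"
  shows "ip (hcomp (\<lambda>x. Ustat F x * Ustat G x) N) (hcomp (\<lambda>x. Ustat F x * Ustat G x) N) = ip (top_part F G N) (top_part F G N)"
  by (rule integral_cong_AE)
    (use hcomp_top[OF assms] Lp_meas[OF hcomp_L2[OF N(1) Ustat_mult_L2[OF F G]]] Lp_meas[OF pure_L2[OF top_part_pure[OF F G N(1)]]] in auto)

lemma hcomp_ip_empty:
  assumes "Z \<in> L2 I"
  shows "ip (hcomp Z {}) (hcomp Z {}) = (expectation Z)\<^sup>2"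
proof -
  have "ip (hcomp Z {}) (hcomp Z {}) = ip (\<lambda>x. expectation Z) (\<lambda>x. expectation Z)"
    by (rule integral_cong_AE)
      (use hcomp_empty[OF assms] Lp_meas[OF hcomp_L2[OF _ assms, of "{}"]] in auto)
  then show ?thesis by (simp add: power2_eq_square prob_space)
qed

lemma low_energy_eq:
  assumes F: "degen p F" and G: "degen q G" and pos: "p + q > 0"
  defines "Z \<equiv> \<lambda>x. Ustat F x * Ustat G x"
  shows "low_energy F G = (\<Sum>N\<in>{N\<in>Pow I. N \<noteq> {} \<and> card N < p + q}. ip (hcomp Z N) (hcomp Z N))"
proof -
  have Z: "Z \<in> L2 I" unfolding Z_def using Ustat_mult_L2 F G .
  let ?A = "{N\<in>Pow I. N \<noteq> {} \<and> card N < p + q}" and ?B = "{N\<in>Pow I. card N \<ge> p + q}"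
  have split: "Pow I = insert {} (?A \<union> ?B)" using pos by auto
  have "ip Z Z = (\<Sum>N\<in>insert {} (?A \<union> ?B). ip (hcomp Z N) (hcomp Z N))"
    using parseval[OF Z Z] by (simp only: split[symmetric])
  also have "\<dots> = ip (hcomp Z {}) (hcomp Z {}) + (\<Sum>N\<in>?A \<union> ?B. ip (hcomp Z N) (hcomp Z N))"
    using pos by (intro sum.insert) (auto simp: finite_index)
  also have "(\<Sum>N\<in>?A \<union> ?B. ip (hcomp Z N) (hcomp Z N)) =
      (\<Sum>N\<in>?A. ip (hcomp Z N) (hcomp Z N)) + (\<Sum>N\<in>?B. ip (hcomp Z N) (hcomp Z N))"
    by (intro sum.union_disjoint) (auto simp: finite_index)
  also have "(\<Sum>N\<in>?B. ip (hcomp Z N) (hcomp Z N)) = (\<Sum>N\<in>?B. ip (top_part F G N) (top_part F G N))"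
    unfolding Z_def by (intro sum.cong refl hcomp_ip_top[OF F G]) auto
  also have "\<dots> = top_energy F G"
    unfolding top_energy_def
  proof (rule sum.mono_neutral_left)
    show "\<forall>N\<in>Pow I - ?B. ip (top_part F G N) (top_part F G N) = 0"
    proof
      fix N assume "N \<in> Pow I - ?B"
      then have "top_part F G N = (\<lambda>_. 0)" by (intro top_part_0[OF F G]) auto
      then show "ip (top_part F G N) (top_part F G N) = 0" by simp
    qed
  qed (auto simp: finite_index)
  also have "ip (hcomp Z {}) (hcomp Z {}) = (ip (Ustat F) (Ustat G))\<^sup>2"
    using hcomp_ip_empty[OF Z] by (simp add: Z_def)
  also have "ip Z Z = expectation (\<lambda>x. (Ustat F x)\<^sup>2 * (Ustat G x)\<^sup>2)"
    unfolding Z_def by (simp add: power2_eq_square ac_simps)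
  finally show ?thesis unfolding low_energy_def by simp
qed

lemma low_energy_nonneg: "degen p F \<Longrightarrow> degen q G \<Longrightarrow> p + q > 0 \<Longrightarrow> low_energy F G \<ge> 0"
  by (subst low_energy_eq) (auto intro!: sum_nonneg ip_self_nonneg)

text \<open>The weights \<open>p + q - card N\<close> vanish at the top order and are at most \<open>p + q\<close> below it, and no component lies
  above it, so the bound does not involve the number of variables.\<close>

lemma Gamma2_variance:
  assumes F: "degen p F" and G: "degen q G" and pos: "p + q > 0"
  defines "\<mu> \<equiv> real (p + q) * ip (Ustat F) (Ustat G)"
  shows "(\<lambda>x. Gamma2 F G x - \<mu>) \<in> L2 I"
    and "expectation (\<lambda>x. (Gamma2 F G x - \<mu>)\<^sup>2) \<le> (real (p + q))\<^sup>2 * low_energy F G"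
proof -
  define Z where "Z = (\<lambda>x. Ustat F x * Ustat G x)"
  have Z: "Z \<in> L2 I" unfolding Z_def using Ustat_mult_L2 F G .
  have gam: "Gamma2 F G \<in> L2 I"
    unfolding Gamma2_def
    by (intro Lp_sum Lp_add) (auto intro: Dpart_mult_L2 F G Lp_mono[OF CE_L2[OF Dpart_mult_L2[OF F G]]])
  then show gmu: "(\<lambda>x. Gamma2 F G x - \<mu>) \<in> L2 I"
    by (intro Lp_diff Lp_const) auto
  \<comment> \<open>The weight at the empty set is \<open>0\<close> because the mean has been subtracted.\<close>
  define w where "w N = (if N = {} then 0 else real (p + q) - real (card N))" for N :: "nat set"
  have ez: "\<mu> = real (p + q) * expectation Z" by (simp add: \<mu>_def Z_def)
  have ae: "AE x in M. Gamma2 F G x - \<mu> = (\<Sum>N\<in>Pow I. w N * hcomp Z N x)"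
    using Gamma2_hcomp[OF F G] hcomp_empty[OF Z]
  proof eventually_elim
    fix x assume g: "Gamma2 F G x = (\<Sum>N\<in>Pow I. (real (p + q) - real (card N)) * hcomp (\<lambda>x. Ustat F x * Ustat G x) N x)"
      and e: "hcomp Z {} x = expectation Z"
    have "(\<Sum>N\<in>Pow I. (real (p + q) - real (card N)) * hcomp Z N x) - (\<Sum>N\<in>Pow I. w N * hcomp Z N x)
       = (\<Sum>N\<in>Pow I. if N = {} then real (p + q) * hcomp Z {} x else 0)"
      unfolding sum_subtractf[symmetric] by (intro sum.cong) (auto simp: w_def)
    also have "\<dots> = \<mu>" by (simp add: finite_index e ez)
    finally show "Gamma2 F G x - \<mu> = (\<Sum>N\<in>Pow I. w N * hcomp Z N x)" using g unfolding Z_def by simp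
  qed
  have wp: "J \<subseteq> I \<Longrightarrow> pure J (\<lambda>x. w J * hcomp Z J x)" for J
    by (intro pure_cmult hcomp_pure Z)
  have "expectation (\<lambda>x. (Gamma2 F G x - \<mu>)\<^sup>2) = ip (\<lambda>x. \<Sum>N\<in>Pow I. w N * hcomp Z N x) (\<lambda>x. \<Sum>N\<in>Pow I. w N * hcomp Z N x)"
  proof (rule integral_cong_AE)
    show "AE x in M. (Gamma2 F G x - \<mu>)\<^sup>2 = (\<Sum>N\<in>Pow I. w N * hcomp Z N x) * (\<Sum>N\<in>Pow I. w N * hcomp Z N x)"
      using ae by (auto simp: power2_eq_square)
    show "(\<lambda>x. (Gamma2 F G x - \<mu>)\<^sup>2) \<in> borel_measurable M" using Lp_meas[OF gmu] by measurable
    have "(\<lambda>x. \<Sum>N\<in>Pow I. w N * hcomp Z N x) \<in> L2 I"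
      by (intro Lp_sum) (auto intro: Lp_mono[OF pure_L2[OF wp]])
    from Lp_meas[OF this] show "(\<lambda>x. (\<Sum>N\<in>Pow I. w N * hcomp Z N x) * (\<Sum>N\<in>Pow I. w N * hcomp Z N x)) \<in> borel_measurable M"
      by measurable
  qed
  also have "\<dots> = (\<Sum>N\<in>Pow I. ip (\<lambda>x. w N * hcomp Z N x) (\<lambda>x. w N * hcomp Z N x))"
    by (rule ip_sum_pure) (use wp in auto)
  also have "\<dots> = (\<Sum>N\<in>Pow I. (w N)\<^sup>2 * ip (hcomp Z N) (hcomp Z N))"
  proof (rule sum.cong[OF refl])
    fix N
    have "ip (\<lambda>x. w N * hcomp Z N x) (\<lambda>x. w N * hcomp Z N x) = expectation (\<lambda>x. (w N)\<^sup>2 * (hcomp Z N x * hcomp Z N x))"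
      by (intro Bochner_Integration.integral_cong) (auto simp: power2_eq_square)
    then show "ip (\<lambda>x. w N * hcomp Z N x) (\<lambda>x. w N * hcomp Z N x) = (w N)\<^sup>2 * ip (hcomp Z N) (hcomp Z N)" by simp
  qed
  also have "\<dots> = (\<Sum>N\<in>{N\<in>Pow I. N \<noteq> {} \<and> card N < p + q}. (w N)\<^sup>2 * ip (hcomp Z N) (hcomp Z N))"
  proof (rule sum.mono_neutral_right)
    show "\<forall>N\<in>Pow I - {N \<in> Pow I. N \<noteq> {} \<and> card N < p + q}. (w N)\<^sup>2 * ip (hcomp Z N) (hcomp Z N) = 0"
    proof
      fix N assume N: "N \<in> Pow I - {N \<in> Pow I. N \<noteq> {} \<and> card N < p + q}"
      show "(w N)\<^sup>2 * ip (hcomp Z N) (hcomp Z N) = 0"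
      proof (cases "N = {} \<or> card N = p + q")
        case False
        then have "ip (hcomp Z N) (hcomp Z N) = ip (top_part F G N) (top_part F G N)"
          unfolding Z_def using N by (intro hcomp_ip_top[OF F G]) auto
        then show ?thesis using top_part_0[OF F G, of N] False N by auto
      qed (auto simp: w_def)
    qed
  qed (auto simp: finite_index)
  also have "\<dots> \<le> (\<Sum>N\<in>{N\<in>Pow I. N \<noteq> {} \<and> card N < p + q}. (real (p + q))\<^sup>2 * ip (hcomp Z N) (hcomp Z N))"
    by (intro sum_mono mult_right_mono ip_self_nonneg power_mono) (auto simp: w_def)
  also have "\<dots> = (real (p + q))\<^sup>2 * low_energy F G"
    using low_energy_eq[OF F G pos] by (simp add: sum_distrib_left Z_def)
  finally show "expectation (\<lambda>x. (Gamma2 F G x - \<mu>)\<^sup>2) \<le> (real (p + q))\<^sup>2 * low_energy F G" .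
qed

section \<open>Contractions and the component of highest order\<close>

text \<open>Nonnegativity of \<open>E[(t f + g)\<^sup>2 | \<F>\<^sub>L]\<close> for all rational \<open>t\<close>.\<close>

lemma CE_Cauchy_Schwarz:
  assumes f: "f \<in> L2 J" and g: "g \<in> L2 K"
  shows "AE x in M. (CE L (\<lambda>x. f x * g x) x)\<^sup>2 \<le> CE L (\<lambda>x. f x * f x) x * CE L (\<lambda>x. g x * g x) x"
proof -
  note ff = L2_mult_integrable[OF f f] and gg = L2_mult_integrable[OF g g] and fg = L2_mult_integrable[OF f g]
  have one: "AE x in M. 0 \<le> t\<^sup>2 * CE L (\<lambda>x. f x * f x) x + 2 * t * CE L (\<lambda>x. f x * g x) x + CE L (\<lambda>x. g x * g x) x" for t
  proof -
    have e: "(\<lambda>x. (t * f x + g x)\<^sup>2) = (\<lambda>x. (t\<^sup>2 * (f x * f x) + 2 * t * (f x * g x)) + g x * g x)"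
      by (rule ext) (simp add: power2_eq_square algebra_simps)
    have "AE x in M. 0 \<le> CE L (\<lambda>x. (t * f x + g x)\<^sup>2) x"
      using Lp_meas[OF f] Lp_meas[OF g] by (intro ce.real_cond_exp_pos) auto
    moreover have "AE x in M. CE L (\<lambda>x. (t * f x + g x)\<^sup>2) x =
        CE L (\<lambda>x. t\<^sup>2 * (f x * f x) + 2 * t * (f x * g x)) x + CE L (\<lambda>x. g x * g x) x"
      unfolding e using ff gg fg by (intro ce.real_cond_exp_add) auto
    moreover have "AE x in M. CE L (\<lambda>x. t\<^sup>2 * (f x * f x) + 2 * t * (f x * g x)) x =
        CE L (\<lambda>x. t\<^sup>2 * (f x * f x)) x + CE L (\<lambda>x. 2 * t * (f x * g x)) x"
      using ff gg fg by (intro ce.real_cond_exp_add) auto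
    moreover have "AE x in M. CE L (\<lambda>x. t\<^sup>2 * (f x * f x)) x = t\<^sup>2 * CE L (\<lambda>x. f x * f x) x"
      by (rule ce.real_cond_exp_cmult[OF ff])
    moreover have "AE x in M. CE L (\<lambda>x. 2 * t * (f x * g x)) x = 2 * t * CE L (\<lambda>x. f x * g x) x"
      by (rule ce.real_cond_exp_cmult[OF fg])
    ultimately show ?thesis by eventually_elim simp
  qed
  have "AE x in M. \<forall>t\<in>\<rat>. 0 \<le> t\<^sup>2 * CE L (\<lambda>x. f x * f x) x + 2 * t * CE L (\<lambda>x. f x * g x) x + CE L (\<lambda>x. g x * g x) x"
    by (subst AE_ball_countable[OF countable_rat]) (use one in auto)
  moreover have "AE x in M. 0 \<le> CE L (\<lambda>x. f x * f x) x"
    using Lp_meas[OF f] by (intro ce.real_cond_exp_pos) auto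
  ultimately show ?thesis
    by eventually_elim (auto intro!: discriminant_le)
qed

lemma square_L2: "f \<in> L4 J \<Longrightarrow> (\<lambda>x. f x * f x) \<in> L2 J"
  using L4_mult[of f J f J] by simp

text \<open>After the conditional Cauchy-Schwarz inequality, \<open>E[f\<^sup>2 | \<F>\<^sub>A\<^sub>\<union>\<^sub>D]\<close> depends only on the variables in \<open>A\<close> and
  \<open>E[g\<^sup>2 | \<F>\<^sub>A\<^sub>\<union>\<^sub>D]\<close> only on those in \<open>D\<close>, so the expectation of their product factorizes.\<close>

lemma contraction_norm_le:
  assumes f: "f \<in> L4 (A \<union> B)" and g: "g \<in> L4 (B \<union> D)" and disj: "A \<inter> D = {}" "B \<inter> (A \<union> D) = {}"
  defines "h \<equiv> CE (A \<union> D) (\<lambda>x. f x * g x)"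
  shows "ip h h \<le> ip f f * ip g g"
proof -
  let ?L = "A \<union> D"
  have h2: "h \<in> L2 ?L" unfolding h_def by (rule CE_L2[OF L4_mult[OF f g]])
  have iff: "integrable M (\<lambda>x. f x * f x)" and igg: "integrable M (\<lambda>x. g x * g x)"
    using square_L2[OF f] square_L2[OF g] L2_integrable by auto
  have "AE x in M. CE ?L (\<lambda>x. f x * f x) x = CE (?L \<inter> (A \<union> B)) (\<lambda>x. f x * f x) x"
    by (rule CE_commute[OF iff Lp_meas_sig[OF square_L2[OF f]]])
  moreover have "?L \<inter> (A \<union> B) = A" using disj by auto
  moreover have "AE x in M. CE ?L (\<lambda>x. g x * g x) x = CE (?L \<inter> (B \<union> D)) (\<lambda>x. g x * g x) x"
    by (rule CE_commute[OF igg Lp_meas_sig[OF square_L2[OF g]]])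
  moreover have "?L \<inter> (B \<union> D) = D" using disj by auto
  moreover have "AE x in M. (h x)\<^sup>2 \<le> CE ?L (\<lambda>x. f x * f x) x * CE ?L (\<lambda>x. g x * g x) x"
    unfolding h_def by (rule CE_Cauchy_Schwarz[OF L4_L2[OF f] L4_L2[OF g]])
  ultimately have ae: "AE x in M. h x * h x \<le> CE A (\<lambda>x. f x * f x) x * CE D (\<lambda>x. g x * g x) x"
    by (auto simp: power2_eq_square)
  have "ip h h \<le> expectation (\<lambda>x. CE A (\<lambda>x. f x * f x) x * CE D (\<lambda>x. g x * g x) x)"
    by (rule integral_mono_AE[OF L2_mult_integrable[OF h2 h2]
          L2_mult_integrable[OF CE_L2[OF square_L2[OF f]] CE_L2[OF square_L2[OF g]]] ae])
  also have "\<dots> = expectation (CE A (\<lambda>x. f x * f x)) * expectation (CE D (\<lambda>x. g x * g x))"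
    by (rule indep_sig_expectation(1)[of A D])
      (use disj iff igg in \<open>auto intro: CE_measurable ce.real_cond_exp_int\<close>)
  also have "\<dots> = ip f f * ip g g"
    using ce.real_cond_exp_int(2)[OF iff] ce.real_cond_exp_int(2)[OF igg] by simp
  finally show ?thesis .
qed

text \<open>Given \<open>\<F>\<^sub>L\<close>, the variables in \<open>B\<close> and in \<open>C\<close> are independent.\<close>

lemma conditional_factorization:
  assumes f1: "f1 \<in> L2 (L \<union> B)" and f2: "f2 \<in> L2 (L \<union> C)" and disj: "B \<inter> C = {}"
  shows "ip f1 f2 = ip (CE L f1) (CE L f2)"
proof -
  have "ip f1 f2 = ip f2 f1" by (simp add: mult.commute)
  also have "\<dots> = ip (CE (L \<union> B) f2) f1" by (rule CE_ip[OF f2 f1, symmetric])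
  also have "\<dots> = ip (CE L f2) f1"
  proof (rule ip_cong_AE)
    have "(L \<union> B) \<inter> (L \<union> C) = L" using disj by auto
    then show "AE x in M. CE (L \<union> B) f2 x = CE L f2 x"
      using CE_commute[OF L2_integrable[OF f2] Lp_meas_sig[OF f2], of "L \<union> B"] by simp
  qed (use f1 Lp_meas in auto)
  also have "\<dots> = ip f1 (CE L f2)" by (simp add: mult.commute)
  also have "\<dots> = ip (CE L f1) (CE L f2)" by (rule CE_ip[OF f1 CE_L2[OF f2], symmetric])
  finally show ?thesis .
qed

definition disjoint_pairs :: "nat set \<Rightarrow> (nat set \<times> nat set) set" where
  "disjoint_pairs S = {(A, D). A \<subseteq> S \<and> D \<subseteq> S \<and> A \<inter> D = {}}"

lemma finite_disjoint_pairs: "S \<subseteq> I \<Longrightarrow> finite (disjoint_pairs S)"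
proof -
  assume "S \<subseteq> I"
  then have "finite S" using finite_index finite_subset by blast
  then have "finite (Pow S \<times> Pow S)" by simp
  then show ?thesis by (rule rev_finite_subset) (auto simp: disjoint_pairs_def)
qed

text \<open>The kernels \<open>F\<^sub>A\<^sub>\<union>\<^sub>B\<close> and \<open>G\<^sub>B\<^sub>\<union>\<^sub>D\<close> contracted over the variables in \<open>B\<close>.\<close>

definition contraction :: "(nat set \<Rightarrow> 'a \<Rightarrow> real) \<Rightarrow> (nat set \<Rightarrow> 'a \<Rightarrow> real) \<Rightarrow> nat set \<Rightarrow> nat set \<Rightarrow> nat set \<Rightarrow> 'a \<Rightarrow> real" where
  "contraction F G A D B = CE (A \<union> D) (\<lambda>x. F (A \<union> B) x * G (B \<union> D) x)"

definition sq_norm :: "(nat set \<Rightarrow> 'a \<Rightarrow> real) \<Rightarrow> nat set \<Rightarrow> real" where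
  "sq_norm F J = ip (F J) (F J)"

lemma sq_norm_nonneg: "sq_norm F J \<ge> 0"
  unfolding sq_norm_def by (rule ip_self_nonneg)

lemma degen_mult_L2: "degen p F \<Longrightarrow> degen q G \<Longrightarrow> (\<lambda>x. F J x * G K x) \<in> L2 (J \<union> K)"
  by (rule L4_mult[OF degen_L4 degen_L4])

text \<open>In \<open>E[F\<^sub>J G\<^sub>N\<^sub>-\<^sub>J F\<^sub>J\<^sub>' G\<^sub>N\<^sub>-\<^sub>J\<^sub>']\<close> put \<open>A = J \<inter> J'\<close>, \<open>B = J - J'\<close>, \<open>C = J' - J\<close> and let \<open>D\<close> be what remains of \<open>N\<close>. The
  expectation is \<open>E[F\<^sub>A\<^sub>\<union>\<^sub>B G\<^sub>B\<^sub>\<union>\<^sub>D F\<^sub>A\<^sub>\<union>\<^sub>C G\<^sub>C\<^sub>\<union>\<^sub>D]\<close>; the sets occurring with \<open>B\<close> and with \<open>C\<close> are both completed by \<open>A\<close>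
  and \<open>D\<close>, so conditioning on \<open>\<F>\<^sub>A\<^sub>\<union>\<^sub>D\<close> gives two contractions of the same shape. Without the constraint
  \<open>B \<inter> C = {}\<close> the sum over \<open>B\<close> and \<open>C\<close> would be a square.\<close>

lemma top_energy_quadruples:
  assumes F: "degen p F" and G: "degen q G"
  shows "top_energy F G = (\<Sum>(A, D)\<in>disjoint_pairs I. \<Sum>(B, C)\<in>disjoint_pairs (I - (A \<union> D)).
    ip (contraction F G A D B) (contraction F G A D C))"
proof -
  define e where "e = (\<lambda>(A, D, B, C). ip (\<lambda>x. F (A \<union> B) x * G (C \<union> D) x) (\<lambda>x. F (A \<union> C) x * G (B \<union> D) x))"
  have set_eqs: "J \<inter> J' \<union> (J - J') = J" "J \<inter> J' \<union> (J' - J) = J'"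
    "J \<subseteq> N \<Longrightarrow> J' \<subseteq> N \<Longrightarrow> J' - J \<union> (N - (J \<union> J')) = N - J"
    "J \<subseteq> N \<Longrightarrow> J' \<subseteq> N \<Longrightarrow> J - J' \<union> (N - (J \<union> J')) = N - J'" for N J J' :: "nat set"
    by auto
  let ?Q = "Sigma (disjoint_pairs I) (\<lambda>(A, D). disjoint_pairs (I - (A \<union> D)))"
  have "top_energy F G = (\<Sum>N\<in>Pow I. \<Sum>J\<in>Pow N. \<Sum>J'\<in>Pow N. ip (\<lambda>x. F J x * G (N - J) x) (\<lambda>x. F J' x * G (N - J') x))"
    unfolding top_energy_def
  proof (rule sum.cong[OF refl])
    fix N assume "N \<in> Pow I"
    then have L: "(\<lambda>x. F J x * G (N - J) x) \<in> L2 I" if "J \<in> Pow N" for J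
      using that by (intro Lp_mono[OF degen_mult_L2[OF F G]]) auto
    show "ip (top_part F G N) (top_part F G N) =
       (\<Sum>J\<in>Pow N. \<Sum>J'\<in>Pow N. ip (\<lambda>x. F J x * G (N - J) x) (\<lambda>x. F J' x * G (N - J') x))"
      unfolding top_part_def by (rule ip_sum_sum[OF L L])
  qed
  also have "\<dots> = (\<Sum>(N, J, J')\<in>Sigma (Pow I) (\<lambda>N. Pow N \<times> Pow N). ip (\<lambda>x. F J x * G (N - J) x) (\<lambda>x. F J' x * G (N - J') x))"
  proof -
    have fin: "finite (Pow N)" if "N \<in> Pow I" for N using that finite_index finite_subset by auto
    show ?thesis
      by (subst sum.Sigma[symmetric])
        (auto simp: finite_index fin sum.cartesian_product intro: finite_subset[OF _ finite_index])
  qed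
  also have "\<dots> = (\<Sum>((A, D), (B, C))\<in>?Q. e (A, D, B, C))"
    \<comment> \<open>\<open>A, B, C, D\<close> are the four cells of the two partitions \<open>{J, N - J}\<close> and \<open>{J', N - J'}\<close> of \<open>N\<close>.\<close>
    by (rule sum.reindex_bij_witness[where
          i = "\<lambda>((A, D), (B, C)). (A \<union> B \<union> C \<union> D, A \<union> B, A \<union> C)" and
          j = "\<lambda>(N, J, J'). ((J \<inter> J', N - (J \<union> J')), (J - J', J' - J))"])
      (auto simp: disjoint_pairs_def e_def set_eqs)
  also have "\<dots> = (\<Sum>(A, D)\<in>disjoint_pairs I. \<Sum>(B, C)\<in>disjoint_pairs (I - (A \<union> D)). e (A, D, B, C))"
    by (simp add: split_def sum.Sigma finite_disjoint_pairs)
  also have "\<dots> = (\<Sum>(A, D)\<in>disjoint_pairs I. \<Sum>(B, C)\<in>disjoint_pairs (I - (A \<union> D)).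
    ip (contraction F G A D B) (contraction F G A D C))"
  proof (intro sum.cong refl, clarify, intro sum.cong refl, clarify)
    fix A D B C assume "(A, D) \<in> disjoint_pairs I" and BC: "(B, C) \<in> disjoint_pairs (I - (A \<union> D))"
    have "e (A, D, B, C) = ip (\<lambda>x. F (A \<union> B) x * G (B \<union> D) x) (\<lambda>x. F (A \<union> C) x * G (C \<union> D) x)"
      unfolding e_def by (simp add: ac_simps)
    also have "\<dots> = ip (contraction F G A D B) (contraction F G A D C)"
      unfolding contraction_def
      by (rule conditional_factorization[of _ _ B _ C])
        (use BC in \<open>auto simp: disjoint_pairs_def intro: Lp_mono[OF degen_mult_L2[OF F G]]\<close>)
    finally show "e (A, D, B, C) = ip (contraction F G A D B) (contraction F G A D C)" .
  qed
  finally show ?thesis .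
qed

lemma contraction_L2: "degen p F \<Longrightarrow> degen q G \<Longrightarrow> contraction F G A D B \<in> L2 (A \<union> D)"
  unfolding contraction_def by (rule CE_L2[OF degen_mult_L2])

text \<open>The form of the bound is chosen so that each summand contains every one of \<open>A, B, C, D\<close> once, which keeps
  the sum over all of them under control.\<close>

lemma contraction_ip_le:
  assumes F: "degen p F" and G: "degen q G"
    and "A \<inter> D = {}" "B \<inter> (A \<union> D) = {}" "C \<inter> (A \<union> D) = {}"
  shows "ip (contraction F G A D B) (contraction F G A D C) \<le>
    (sq_norm F (A \<union> B) * sq_norm G (C \<union> D) + sq_norm F (A \<union> C) * sq_norm G (B \<union> D)) / 2"
proof -
  let ?h = "contraction F G A D"
  have n: "ip (?h B) (?h B) \<le> sq_norm F (A \<union> B) * sq_norm G (B \<union> D)" if "B \<inter> (A \<union> D) = {}" for B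
    unfolding contraction_def sq_norm_def
    by (rule contraction_norm_le[OF degen_L4[OF F] degen_L4[OF G] assms(3) that])
  have "(ip (?h B) (?h C))\<^sup>2 \<le> ip (?h B) (?h B) * ip (?h C) (?h C)"
    by (rule ip_Cauchy_Schwarz[OF contraction_L2[OF F G] contraction_L2[OF F G]])
  also have "\<dots> \<le> (sq_norm F (A \<union> B) * sq_norm G (B \<union> D)) * (sq_norm F (A \<union> C) * sq_norm G (C \<union> D))"
    by (intro mult_mono n assms ip_self_nonneg mult_nonneg_nonneg sq_norm_nonneg)
  also have "\<dots> = (sq_norm F (A \<union> B) * sq_norm G (C \<union> D)) * (sq_norm F (A \<union> C) * sq_norm G (B \<union> D))"
    by (simp add: ac_simps)
  also have "\<dots> \<le> ((sq_norm F (A \<union> B) * sq_norm G (C \<union> D) + sq_norm F (A \<union> C) * sq_norm G (B \<union> D)) / 2)\<^sup>2"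
  proof -
    have "x * y \<le> ((x + y) / 2)\<^sup>2" for x y :: real
      using sum_squares_bound[of x y] by (simp add: power2_eq_square field_simps)
    then show ?thesis .
  qed
  finally show ?thesis
    by (rule power2_le_imp_le) (intro divide_nonneg_nonneg add_nonneg_nonneg mult_nonneg_nonneg sq_norm_nonneg, simp)
qed

text \<open>The error of all decoupling steps: pairs of index sets that are not disjoint.\<close>

definition overlap :: "(nat set \<Rightarrow> 'a \<Rightarrow> real) \<Rightarrow> (nat set \<Rightarrow> 'a \<Rightarrow> real) \<Rightarrow> real" where
  "overlap F G = (\<Sum>J\<in>Pow I. \<Sum>K\<in>{K\<in>Pow I. J \<inter> K \<noteq> {}}. sq_norm F J * sq_norm G K)"

definition subsets_outside :: "nat set \<Rightarrow> nat set \<Rightarrow> nat set set" where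
  "subsets_outside A D = Pow (I - (A \<union> D))"

lemma sq_norm_0: "degen p F \<Longrightarrow> \<not> (J \<subseteq> I \<and> card J = p) \<Longrightarrow> sq_norm F J = 0"
  using degen_0[of p F J] by (simp add: sq_norm_def)

lemma overlap_count:
  assumes F: "degen p F" and G: "degen q G"
  shows "(\<Sum>(A, D)\<in>disjoint_pairs I. \<Sum>B\<in>subsets_outside A D. \<Sum>C\<in>{C\<in>subsets_outside A D. B \<inter> C \<noteq> {}}.
            sq_norm F (A \<union> B) * sq_norm G (C \<union> D)) \<le> 2 ^ (p + q) * overlap F G"
proof -
  let ?S = "Sigma (disjoint_pairs I) (\<lambda>z. Sigma (subsets_outside (fst z) (snd z)) (\<lambda>B. {C\<in>subsets_outside (fst z) (snd z). B \<inter> C \<noteq> {}}))"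
  let ?T = "Sigma (Pow I) (\<lambda>J. Sigma {K\<in>Pow I. J \<inter> K \<noteq> {}} (\<lambda>K. Pow J \<times> Pow K))"
  \<comment> \<open>A quadruple is determined by \<open>J = A \<union> B\<close>, \<open>K = C \<union> D\<close> and the subsets \<open>A \<subseteq> J\<close>, \<open>D \<subseteq> K\<close>, so each
    pair \<open>(J, K)\<close> arises at most \<open>2^p 2^q\<close> times.\<close>
  let ?\<phi> = "\<lambda>z. (fst (fst z) \<union> fst (snd z), (snd (snd z) \<union> snd (fst z), fst z))"
  have finr: "finite (subsets_outside A D)" for A D unfolding subsets_outside_def using finite_index by simp
  have finP: "finite J" if "J \<subseteq> I" for J using that finite_index finite_subset by blast
  have "(\<Sum>(A, D)\<in>disjoint_pairs I. \<Sum>B\<in>subsets_outside A D. \<Sum>C\<in>{C\<in>subsets_outside A D. B \<inter> C \<noteq> {}}.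
            sq_norm F (A \<union> B) * sq_norm G (C \<union> D))
     = (\<Sum>z\<in>?S. sq_norm F (fst (fst z) \<union> fst (snd z)) * sq_norm G (snd (snd z) \<union> snd (fst z)))"
    by (simp add: split_def sum.Sigma finr finite_disjoint_pairs)
  also have "\<dots> = (\<Sum>y\<in>?\<phi> ` ?S. sq_norm F (fst y) * sq_norm G (fst (snd y)))"
  proof (rule sum.reindex_cong[OF _ refl, symmetric])
    show "inj_on ?\<phi> ?S"
    proof (rule inj_onI)
      fix z z' assume z: "z \<in> ?S" "z' \<in> ?S" and eq: "?\<phi> z = ?\<phi> z'"
      obtain A D B C where zz: "z = ((A, D), (B, C))" by (metis surj_pair)
      obtain A' D' B' C' where zz': "z' = ((A', D'), (B', C'))" by (metis surj_pair)
      show "z = z'" using z eq unfolding zz zz' subsets_outside_def by auto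
    qed
  qed simp
  also have "\<dots> \<le> (\<Sum>y\<in>?T. sq_norm F (fst y) * sq_norm G (fst (snd y)))"
  proof (rule sum_mono2)
    show "finite ?T"
      using finite_index by (intro finite_SigmaI finite_cartesian_product) (auto simp: finP)
    show "?\<phi> ` ?S \<subseteq> ?T"
      by (auto simp: disjoint_pairs_def subsets_outside_def)
  qed (intro mult_nonneg_nonneg sq_norm_nonneg)
  also have "\<dots> = (\<Sum>J\<in>Pow I. \<Sum>K\<in>{K\<in>Pow I. J \<inter> K \<noteq> {}}. \<Sum>_\<in>Pow J \<times> Pow K. sq_norm F J * sq_norm G K)"
  proof -
    have f1: "finite (Sigma {K\<in>Pow I. J \<inter> K \<noteq> {}} (\<lambda>K. Pow J \<times> Pow K))" if "J \<in> Pow I" for J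
      using that finite_index by (intro finite_SigmaI finite_cartesian_product) (auto simp: finP)
    have f2: "\<forall>K\<in>{K\<in>Pow I. J \<inter> K \<noteq> {}}. finite (Pow J \<times> Pow K)" if "J \<in> Pow I" for J
      using that by (auto intro!: finite_cartesian_product simp: finP)
    have "(\<Sum>y\<in>?T. sq_norm F (fst y) * sq_norm G (fst (snd y))) = (\<Sum>J\<in>Pow I. \<Sum>y\<in>Sigma {K\<in>Pow I. J \<inter> K \<noteq> {}} (\<lambda>K. Pow J \<times> Pow K). sq_norm F J * sq_norm G (fst y))"
      using f1 finite_index by (subst sum.Sigma) (auto simp: split_def)
    also have "\<dots> = (\<Sum>J\<in>Pow I. \<Sum>K\<in>{K\<in>Pow I. J \<inter> K \<noteq> {}}. \<Sum>_\<in>Pow J \<times> Pow K. sq_norm F J * sq_norm G K)"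
      by (intro sum.cong refl, subst sum.Sigma) (use f2 finite_index in \<open>auto simp: split_def\<close>)
    finally show ?thesis .
  qed
  also have "\<dots> = (\<Sum>J\<in>Pow I. \<Sum>K\<in>{K\<in>Pow I. J \<inter> K \<noteq> {}}. 2 ^ (p + q) * (sq_norm F J * sq_norm G K))"
  proof (intro sum.cong refl)
    fix J K assume "J \<in> Pow I" "K \<in> {K\<in>Pow I. J \<inter> K \<noteq> {}}"
    then show "(\<Sum>_\<in>Pow J \<times> Pow K. sq_norm F J * sq_norm G K) = 2 ^ (p + q) * (sq_norm F J * sq_norm G K)"
      using sq_norm_0[OF F, of J] sq_norm_0[OF G, of K] finP
      by (cases "card J = p \<and> card K = q") (auto simp: card_cartesian_product card_Pow power_add)
  qed
  also have "\<dots> = 2 ^ (p + q) * overlap F G"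
    by (simp add: overlap_def sum_distrib_left)
  finally show ?thesis .
qed

lemma ip_Ustat: "degen p F \<Longrightarrow> degen q G \<Longrightarrow> ip (Ustat F) (Ustat G) = (\<Sum>J\<in>Pow I. ip (F J) (G J))"
  unfolding Ustat_def by (rule ip_sum_pure) (auto intro: degen_pure)

lemma ip_Ustat_self: "degen p F \<Longrightarrow> ip (Ustat F) (Ustat F) = (\<Sum>J\<in>Pow I. sq_norm F J)"
  by (simp add: ip_Ustat sq_norm_def)

lemma CE_zero: "AE x in M. CE L (\<lambda>x. 0) x = 0"
  by (rule CE_self[OF Lp_const]) auto

text \<open>If \<open>card A = p\<close>, only the summand with \<open>B = {}\<close> is present, and it is \<open>F\<^sub>A G\<^sub>D\<close>. If \<open>A\<close> and \<open>D\<close> are empty, the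
  contractions are the constants \<open>E[F\<^sub>B G\<^sub>B]\<close>, whose sum is the covariance. The remaining squares are
  bounded below by \<open>0\<close>.\<close>

lemma contraction_sum_ge:
  assumes F: "degen p F" and G: "degen q G" and pos: "p > 0" and AD: "(A, D) \<in> disjoint_pairs I"
  defines "H \<equiv> \<lambda>x. \<Sum>B\<in>subsets_outside A D. contraction F G A D B x"
  shows "ip H H \<ge> sq_norm F A * sq_norm G D + (if A = {} \<and> D = {} then (ip (Ustat F) (Ustat G))\<^sup>2 else 0)"
proof -
  have AD': "A \<subseteq> I" "D \<subseteq> I" "A \<inter> D = {}" using AD by (auto simp: disjoint_pairs_def)
  have finr: "finite (subsets_outside A D)" unfolding subsets_outside_def using finite_index by simp
  have H2: "H \<in> L2 (A \<union> D)" unfolding H_def by (intro Lp_sum contraction_L2[OF F G]) simp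
  consider "A = {}" "D = {}" | "card A = p" "card D = q" "A \<noteq> {}"
    | "\<not> (A = {} \<and> D = {})" "sq_norm F A * sq_norm G D = 0"
  proof -
    have "card A = p \<Longrightarrow> A \<noteq> {}" using pos by auto
    moreover have "\<not> (card A = p \<and> card D = q) \<Longrightarrow> sq_norm F A * sq_norm G D = 0"
      using sq_norm_0[OF F, of A] sq_norm_0[OF G, of D] by auto
    ultimately show ?thesis using that by blast
  qed
  then show ?thesis
  proof cases
    case 1
    have "AE x in M. \<forall>B\<in>Pow I. contraction F G {} {} B x = ip (F B) (G B)"
    proof (rule AE_finite_allI)
      show "finite (Pow I)" using finite_index by simp
      fix B
      show "AE x in M. contraction F G {} {} B x = ip (F B) (G B)"
        unfolding contraction_def using CE_empty[OF degen_mult_L2[OF F G, of B B]] by simp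
    qed
    then have ae: "AE x in M. H x = ip (Ustat F) (Ustat G)"
      unfolding H_def subsets_outside_def 1 ip_Ustat[OF F G] by eventually_elim simp
    have "ip H H = ip (\<lambda>x. ip (Ustat F) (Ustat G)) (\<lambda>x. ip (Ustat F) (Ustat G))"
      by (rule integral_cong_AE) (use ae Lp_meas[OF H2] in auto)
    moreover have "sq_norm F A = 0" using sq_norm_0[OF F, of A] 1 pos by auto
    ultimately show ?thesis using 1 by (simp add: power2_eq_square prob_space)
  next
    case 2
    have "AE x in M. \<forall>B\<in>subsets_outside A D. contraction F G A D B x = (if B = {} then F A x * G D x else 0)"
    proof (rule AE_finite_allI[OF finr])
      fix B assume B: "B \<in> subsets_outside A D"
      show "AE x in M. contraction F G A D B x = (if B = {} then F A x * G D x else 0)"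
      proof (cases "B = {}")
        case True
        then show ?thesis
          unfolding contraction_def using CE_self[OF degen_mult_L2[OF F G, of A D], of "A \<union> D"] by auto
      next
        case False
        have "finite A" "finite B" "A \<inter> B = {}"
          using B AD' finite_index finite_subset by (auto simp: subsets_outside_def intro: finite_subset)
        then have "card (A \<union> B) \<noteq> p" using False 2 by (simp add: card_Un_disjoint)
        then have "F (A \<union> B) = (\<lambda>_. 0)" by (intro degen_0[OF F]) auto
        then show ?thesis unfolding contraction_def using False CE_zero[of "A \<union> D"] by simp
      qed
    qed
    then have ae: "AE x in M. H x = F A x * G D x"
    proof eventually_elim
      fix x assume h: "\<forall>B\<in>subsets_outside A D. contraction F G A D B x = (if B = {} then F A x * G D x else 0)"
      have "H x = (\<Sum>B\<in>subsets_outside A D. if B = {} then F A x * G D x else 0)"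
        unfolding H_def using h by (intro sum.cong) auto
      also have "\<dots> = F A x * G D x" using finr by (simp add: subsets_outside_def)
      finally show "H x = F A x * G D x" .
    qed
    have "ip H H = ip (\<lambda>x. F A x * F A x) (\<lambda>x. G D x * G D x)"
      by (rule integral_cong_AE)
        (use ae Lp_meas[OF H2] Lp_meas[OF degen_L4[OF F, of A]] Lp_meas[OF degen_L4[OF G, of D]] in \<open>auto simp: ac_simps\<close>)
    also have "\<dots> = sq_norm F A * sq_norm G D"
      unfolding sq_norm_def
      by (rule indep_sig_expectation(1)[of A D])
        (use AD' square_L2[OF degen_L4[OF F, of A]] square_L2[OF degen_L4[OF G, of D]]
          in \<open>auto intro: Lp_meas_sig L2_integrable\<close>)
    finally show ?thesis using 2 by auto
  next
    case 3
    then show ?thesis using ip_self_nonneg[of H] by auto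
  qed
qed

text \<open>The sum over disjoint \<open>B, C\<close> is the full square minus the pairs with \<open>B \<inter> C \<noteq> {}\<close>.\<close>

lemma contraction_pairs_ge:
  assumes F: "degen p F" and G: "degen q G" and pos: "p > 0" and AD: "(A, D) \<in> disjoint_pairs I"
  shows "(\<Sum>(B, C)\<in>disjoint_pairs (I - (A \<union> D)). ip (contraction F G A D B) (contraction F G A D C)) \<ge>
    sq_norm F A * sq_norm G D + (if A = {} \<and> D = {} then (ip (Ustat F) (Ustat G))\<^sup>2 else 0)
    - (\<Sum>B\<in>subsets_outside A D. \<Sum>C\<in>{C\<in>subsets_outside A D. B \<inter> C \<noteq> {}}. sq_norm F (A \<union> B) * sq_norm G (C \<union> D))"
proof -
  let ?h = "contraction F G A D" and ?R = "subsets_outside A D"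
  have AD': "A \<inter> D = {}" using AD by (auto simp: disjoint_pairs_def)
  have finr: "finite ?R" unfolding subsets_outside_def using finite_index by simp
  define H where "H x = (\<Sum>B\<in>?R. ?h B x)" for x
  have "disjoint_pairs (I - (A \<union> D)) = Sigma ?R (\<lambda>B. {C\<in>?R. B \<inter> C = {}})"
    by (auto simp: disjoint_pairs_def subsets_outside_def)
  then have "(\<Sum>(B, C)\<in>disjoint_pairs (I - (A \<union> D)). ip (?h B) (?h C)) = (\<Sum>B\<in>?R. \<Sum>C\<in>{C\<in>?R. B \<inter> C = {}}. ip (?h B) (?h C))"
    using finr by (simp add: sum.Sigma)
  also have "\<dots> = (\<Sum>B\<in>?R. (\<Sum>C\<in>?R. ip (?h B) (?h C)) - (\<Sum>C\<in>{C\<in>?R. B \<inter> C \<noteq> {}}. ip (?h B) (?h C)))"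
  proof (rule sum.cong[OF refl])
    fix B
    have "(\<Sum>C\<in>?R. ip (?h B) (?h C)) = (\<Sum>C\<in>{C\<in>?R. B \<inter> C = {}} \<union> {C\<in>?R. B \<inter> C \<noteq> {}}. ip (?h B) (?h C))"
      by (intro sum.cong) auto
    also have "\<dots> = (\<Sum>C\<in>{C\<in>?R. B \<inter> C = {}}. ip (?h B) (?h C)) + (\<Sum>C\<in>{C\<in>?R. B \<inter> C \<noteq> {}}. ip (?h B) (?h C))"
      using finr by (intro sum.union_disjoint) auto
    finally show "(\<Sum>C\<in>{C\<in>?R. B \<inter> C = {}}. ip (?h B) (?h C)) =
        (\<Sum>C\<in>?R. ip (?h B) (?h C)) - (\<Sum>C\<in>{C\<in>?R. B \<inter> C \<noteq> {}}. ip (?h B) (?h C))" by simp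
  qed
  also have "\<dots> = ip H H - (\<Sum>B\<in>?R. \<Sum>C\<in>{C\<in>?R. B \<inter> C \<noteq> {}}. ip (?h B) (?h C))"
    unfolding sum_subtractf H_def by (subst ip_sum_sum[OF contraction_L2[OF F G] contraction_L2[OF F G]]) auto
  also have "\<dots> \<ge> ip H H - (\<Sum>B\<in>?R. \<Sum>C\<in>{C\<in>?R. B \<inter> C \<noteq> {}}.
      (sq_norm F (A \<union> B) * sq_norm G (C \<union> D) + sq_norm F (A \<union> C) * sq_norm G (B \<union> D)) / 2)"
    by (intro diff_left_mono sum_mono contraction_ip_le[OF F G AD']) (auto simp: subsets_outside_def)
  also have "(\<Sum>B\<in>?R. \<Sum>C\<in>{C\<in>?R. B \<inter> C \<noteq> {}}.
      (sq_norm F (A \<union> B) * sq_norm G (C \<union> D) + sq_norm F (A \<union> C) * sq_norm G (B \<union> D)) / 2) =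
     ((\<Sum>B\<in>?R. \<Sum>C\<in>{C\<in>?R. B \<inter> C \<noteq> {}}. sq_norm F (A \<union> B) * sq_norm G (C \<union> D)) +
      (\<Sum>B\<in>?R. \<Sum>C\<in>{C\<in>?R. B \<inter> C \<noteq> {}}. sq_norm F (A \<union> C) * sq_norm G (B \<union> D))) / 2"
    by (simp add: sum.distrib sum_divide_distrib add_divide_distrib)
  also have "(\<Sum>B\<in>?R. \<Sum>C\<in>{C\<in>?R. B \<inter> C \<noteq> {}}. sq_norm F (A \<union> C) * sq_norm G (B \<union> D)) =
     (\<Sum>C\<in>?R. \<Sum>B\<in>{B\<in>?R. B \<inter> C \<noteq> {}}. sq_norm F (A \<union> C) * sq_norm G (B \<union> D))"
    by (rule sum.swap_restrict[OF finr finr])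
  also have "\<dots> = (\<Sum>B\<in>?R. \<Sum>C\<in>{C\<in>?R. B \<inter> C \<noteq> {}}. sq_norm F (A \<union> B) * sq_norm G (C \<union> D))"
    by (simp add: Int_commute)
  finally show ?thesis
    using contraction_sum_ge[OF F G pos AD] unfolding H_def[symmetric] by simp
qed

lemma sum_disjoint_pairs_sq_norm:
  assumes F: "degen p F" and G: "degen q G"
  shows "(\<Sum>(A, D)\<in>disjoint_pairs I. sq_norm F A * sq_norm G D) = ip (Ustat F) (Ustat F) * ip (Ustat G) (Ustat G) - overlap F G"
proof -
  have "disjoint_pairs I = Sigma (Pow I) (\<lambda>A. {D\<in>Pow I. A \<inter> D = {}})"
    by (auto simp: disjoint_pairs_def)
  then have "(\<Sum>(A, D)\<in>disjoint_pairs I. sq_norm F A * sq_norm G D) = (\<Sum>A\<in>Pow I. \<Sum>D\<in>{D\<in>Pow I. A \<inter> D = {}}. sq_norm F A * sq_norm G D)"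
    using finite_index by (simp add: sum.Sigma)
  also have "\<dots> = (\<Sum>A\<in>Pow I. (\<Sum>D\<in>Pow I. sq_norm F A * sq_norm G D) - (\<Sum>D\<in>{D\<in>Pow I. A \<inter> D \<noteq> {}}. sq_norm F A * sq_norm G D))"
  proof (rule sum.cong[OF refl])
    fix A
    have "(\<Sum>D\<in>Pow I. sq_norm F A * sq_norm G D) = (\<Sum>D\<in>{D\<in>Pow I. A \<inter> D = {}} \<union> {D\<in>Pow I. A \<inter> D \<noteq> {}}. sq_norm F A * sq_norm G D)"
      by (intro sum.cong) auto
    also have "\<dots> = (\<Sum>D\<in>{D\<in>Pow I. A \<inter> D = {}}. sq_norm F A * sq_norm G D) + (\<Sum>D\<in>{D\<in>Pow I. A \<inter> D \<noteq> {}}. sq_norm F A * sq_norm G D)"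
      using finite_index by (intro sum.union_disjoint) auto
    finally show "(\<Sum>D\<in>{D\<in>Pow I. A \<inter> D = {}}. sq_norm F A * sq_norm G D) =
       (\<Sum>D\<in>Pow I. sq_norm F A * sq_norm G D) - (\<Sum>D\<in>{D\<in>Pow I. A \<inter> D \<noteq> {}}. sq_norm F A * sq_norm G D)" by simp
  qed
  also have "\<dots> = ip (Ustat F) (Ustat F) * ip (Ustat G) (Ustat G) - overlap F G"
    unfolding sum_subtractf overlap_def ip_Ustat_self[OF F] ip_Ustat_self[OF G] sum_product ..
  finally show ?thesis .
qed

text \<open>The key estimate: the terms \<open>B = C = {}\<close> contribute the product of the variances, the terms
  \<open>A = D = {}\<close> the squared covariance, and everything else is nonnegative up to overlaps.\<close>

lemma top_energy_lower_bound:
  assumes F: "degen p F" and G: "degen q G" and pos: "p > 0"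
  shows "top_energy F G \<ge> ip (Ustat F) (Ustat F) * ip (Ustat G) (Ustat G) + (ip (Ustat F) (Ustat G))\<^sup>2
     - (1 + 2 ^ (p + q)) * overlap F G"
proof -
  let ?c = "(ip (Ustat F) (Ustat G))\<^sup>2"
  have empty: "({}, {}) \<in> disjoint_pairs I" by (simp add: disjoint_pairs_def)
  have "(\<Sum>(A, D)\<in>disjoint_pairs I. if A = {} \<and> D = {} then ?c else 0) = (\<Sum>z\<in>disjoint_pairs I. if z = ({}, {}) then ?c else 0)"
    by (intro sum.cong) (auto split: if_splits)
  also have "\<dots> = ?c" using empty by (simp add: finite_disjoint_pairs)
  finally have c: "(\<Sum>(A, D)\<in>disjoint_pairs I. if A = {} \<and> D = {} then ?c else 0) = ?c" .
  have "top_energy F G \<ge> (\<Sum>(A, D)\<in>disjoint_pairs I. sq_norm F A * sq_norm G D + (if A = {} \<and> D = {} then ?c else 0)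
    - (\<Sum>B\<in>subsets_outside A D. \<Sum>C\<in>{C\<in>subsets_outside A D. B \<inter> C \<noteq> {}}. sq_norm F (A \<union> B) * sq_norm G (C \<union> D)))"
    unfolding top_energy_quadruples[OF F G]
    by (intro sum_mono) (use contraction_pairs_ge[OF F G pos] in \<open>auto simp: split_def\<close>)
  also have "(\<Sum>(A, D)\<in>disjoint_pairs I. sq_norm F A * sq_norm G D + (if A = {} \<and> D = {} then ?c else 0)
    - (\<Sum>B\<in>subsets_outside A D. \<Sum>C\<in>{C\<in>subsets_outside A D. B \<inter> C \<noteq> {}}. sq_norm F (A \<union> B) * sq_norm G (C \<union> D))) =
    (\<Sum>(A, D)\<in>disjoint_pairs I. sq_norm F A * sq_norm G D) + (\<Sum>(A, D)\<in>disjoint_pairs I. if A = {} \<and> D = {} then ?c else 0)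
    - (\<Sum>(A, D)\<in>disjoint_pairs I. \<Sum>B\<in>subsets_outside A D. \<Sum>C\<in>{C\<in>subsets_outside A D. B \<inter> C \<noteq> {}}. sq_norm F (A \<union> B) * sq_norm G (C \<union> D))"
    unfolding split_def sum_subtractf sum.distrib ..
  finally show ?thesis
    unfolding c sum_disjoint_pairs_sq_norm[OF F G]
    using overlap_count[OF F G] by (simp add: algebra_simps)
qed

text \<open>The quantity whose maximum over \<open>j\<close> is \<open>\<rho>\<^sup>2\<close>.\<close>

definition influence :: "(nat set \<Rightarrow> 'a \<Rightarrow> real) \<Rightarrow> nat \<Rightarrow> real" where
  "influence F j = (\<Sum>J\<in>{J\<in>Pow I. j \<in> J}. sq_norm F J)"

text \<open>Each \<open>J\<close> has \<open>p\<close> elements, and the \<open>K\<close> through a given one of them contribute at most \<open>\<rho>\<close>.\<close>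

lemma overlap_le:
  assumes F: "degen p F" and G: "degen q G" and \<rho>: "\<And>j. j \<in> I \<Longrightarrow> influence G j \<le> \<rho>"
  shows "overlap F G \<le> real p * \<rho> * ip (Ustat F) (Ustat F)"
proof -
  have fin: "finite J" if "J \<in> Pow I" for J using that finite_index finite_subset by auto
  have "(\<Sum>K\<in>{K\<in>Pow I. J \<inter> K \<noteq> {}}. sq_norm F J * sq_norm G K) \<le> real p * \<rho> * sq_norm F J" if J: "J \<in> Pow I" for J
  proof (cases "card J = p")
    case True
    have "(\<Sum>K\<in>{K\<in>Pow I. J \<inter> K \<noteq> {}}. sq_norm G K) \<le> (\<Sum>j\<in>J. \<Sum>K\<in>{K\<in>Pow I. j \<in> K}. sq_norm G K)"
    proof -
      have "(\<Sum>j\<in>J. \<Sum>K\<in>{K\<in>Pow I. j \<in> K}. sq_norm G K) = (\<Sum>K\<in>Pow I. \<Sum>j\<in>{j\<in>J. j \<in> K}. sq_norm G K)"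
        by (rule sum.swap_restrict) (use fin[OF J] finite_index in auto)
      also have "\<dots> \<ge> (\<Sum>K\<in>{K\<in>Pow I. J \<inter> K \<noteq> {}}. \<Sum>j\<in>{j\<in>J. j \<in> K}. sq_norm G K)"
        using finite_index by (intro sum_mono2) (auto intro!: mult_nonneg_nonneg sq_norm_nonneg)
      also have "(\<Sum>K\<in>{K\<in>Pow I. J \<inter> K \<noteq> {}}. \<Sum>j\<in>{j\<in>J. j \<in> K}. sq_norm G K) \<ge> (\<Sum>K\<in>{K\<in>Pow I. J \<inter> K \<noteq> {}}. sq_norm G K)"
      proof (rule sum_mono)
        fix K assume "K \<in> {K\<in>Pow I. J \<inter> K \<noteq> {}}"
        then have "{j\<in>J. j \<in> K} \<noteq> {}" by auto
        then have "1 \<le> card {j\<in>J. j \<in> K}" using fin[OF J] by (simp add: Suc_le_eq card_gt_0_iff)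
        then have "1 * sq_norm G K \<le> real (card {j\<in>J. j \<in> K}) * sq_norm G K"
          by (intro mult_right_mono sq_norm_nonneg) simp
        then show "sq_norm G K \<le> (\<Sum>j\<in>{j\<in>J. j \<in> K}. sq_norm G K)" by simp
      qed
      finally show ?thesis .
    qed
    also have "\<dots> \<le> (\<Sum>j\<in>J. \<rho>)"
      using J \<rho> unfolding influence_def by (intro sum_mono) auto
    also have "\<dots> = real p * \<rho>" using True by simp
    finally show ?thesis
      using sq_norm_nonneg[of F J] unfolding sum_distrib_left[symmetric]
      by (metis mult.commute mult_left_mono)
  next
    case False
    then show ?thesis using sq_norm_0[OF F, of J] by simp
  qed
  then have "overlap F G \<le> (\<Sum>J\<in>Pow I. real p * \<rho> * sq_norm F J)"
    unfolding overlap_def by (rule sum_mono)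
  then show ?thesis by (simp add: ip_Ustat_self[OF F] sum_distrib_left)
qed

lemma low_energy_le:
  assumes F: "degen p F" and G: "degen q G" and pos: "p > 0"
    and \<rho>: "\<And>j. j \<in> I \<Longrightarrow> influence G j \<le> \<rho>"
    and unit: "ip (Ustat F) (Ustat F) = 1" "ip (Ustat G) (Ustat G) = 1"
  shows "low_energy F G \<le> expectation (\<lambda>x. (Ustat F x)\<^sup>2 * (Ustat G x)\<^sup>2) - 1 - 2 * (ip (Ustat F) (Ustat G))\<^sup>2
      + (1 + 2 ^ (p + q)) * real p * \<rho>"
proof -
  have "(1 + 2 ^ (p + q)) * overlap F G \<le> (1 + 2 ^ (p + q)) * (real p * \<rho>)"
    using overlap_le[OF F G \<rho>] unit by (intro mult_left_mono) auto
  then show ?thesis using top_energy_lower_bound[OF F G pos] unit unfolding low_energy_def by (simp add: mult.assoc)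
qed

section \<open>Consequences of small fourth cumulants\<close>

lemma ip_degen_orders_differ: "degen p F \<Longrightarrow> degen q G \<Longrightarrow> p \<noteq> q \<Longrightarrow> ip (Ustat F) (Ustat G) = 0"
  unfolding ip_Ustat
proof (intro sum.neutral ballI)
  fix J assume "degen p F" "degen q G" "p \<noteq> q"
  then have "F J = (\<lambda>_. 0) \<or> G J = (\<lambda>_. 0)" using degen_0[of p F J] degen_0[of q G J] by metis
  then show "ip (F J) (G J) = 0" by auto
qed

text \<open>Apart from the constants, the components of \<open>(Ustat F)\<^sup>2\<close> have order at most \<open>2 p < 2 q\<close>, so only the
  components of \<open>(Ustat G)\<^sup>2\<close> below its top order are met, and their squared norm is \<open>low_energy G G\<close>.\<close>

lemma mixed_moment_orders_differ:
  assumes F: "degen p F" and G: "degen q G" and pos: "p > 0" and less: "p < q"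
    and unit: "ip (Ustat F) (Ustat F) = 1" "ip (Ustat G) (Ustat G) = 1"
  shows "(expectation (\<lambda>x. (Ustat F x)\<^sup>2 * (Ustat G x)\<^sup>2) - 1)\<^sup>2 \<le> expectation (\<lambda>x. Ustat F x ^ 4) * low_energy G G"
proof -
  define Y where "Y = (\<lambda>x. Ustat F x * Ustat F x)"
  define Z where "Z = (\<lambda>x. Ustat G x * Ustat G x)"
  have Y: "Y \<in> L2 I" and Z: "Z \<in> L2 I" unfolding Y_def Z_def using Ustat_mult_L2 F G by blast+
  define A where "A = {N\<in>Pow I. N \<noteq> {} \<and> card N < q + q}"
  have finA: "finite A" unfolding A_def using finite_index by simp
  define U where "U N = (if N \<in> A then hcomp Y N else (\<lambda>_. 0))" for N
  define V where "V N = (if N \<in> A then hcomp Z N else (\<lambda>_. 0))" for N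
  have pU: "J \<subseteq> I \<Longrightarrow> pure J (U J)" and pV: "J \<subseteq> I \<Longrightarrow> pure J (V J)" for J
    unfolding U_def V_def using hcomp_pure[OF _ Y] hcomp_pure[OF _ Z] pure_0 by auto
  have UL: "(\<lambda>x. \<Sum>J\<in>Pow I. U J x) \<in> L2 I" and VL: "(\<lambda>x. \<Sum>J\<in>Pow I. V J x) \<in> L2 I"
    by (intro Lp_sum; auto intro: Lp_mono[OF pure_L2[OF pU]] Lp_mono[OF pure_L2[OF pV]])+
  have sumA: "(\<Sum>J\<in>Pow I. if J \<in> A then f J else 0) = (\<Sum>J\<in>A. f J)" for f :: "nat set \<Rightarrow> real"
    by (subst sum.inter_restrict[symmetric]) (auto simp: finite_index A_def intro!: sum.cong)
  have restr: "(\<Sum>J\<in>Pow I. ip (if J \<in> A then f J else (\<lambda>_. 0)) (if J \<in> A then g J else (\<lambda>_. 0))) = (\<Sum>J\<in>A. ip (f J) (g J))" for f g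
    unfolding sumA[symmetric] by (intro sum.cong refl) auto
  have UV: "ip (\<lambda>x. \<Sum>J\<in>Pow I. U J x) (\<lambda>x. \<Sum>J\<in>Pow I. V J x) = (\<Sum>N\<in>A. ip (hcomp Y N) (hcomp Z N))"
    by (subst ip_sum_pure[OF pU pV]) (auto simp: U_def V_def restr)
  have UU: "ip (\<lambda>x. \<Sum>J\<in>Pow I. U J x) (\<lambda>x. \<Sum>J\<in>Pow I. U J x) = (\<Sum>N\<in>A. ip (hcomp Y N) (hcomp Y N))"
    by (subst ip_sum_pure[OF pU pU]) (auto simp: U_def restr)
  have VV: "ip (\<lambda>x. \<Sum>J\<in>Pow I. V J x) (\<lambda>x. \<Sum>J\<in>Pow I. V J x) = low_energy G G"
  proof -
    have "ip (\<lambda>x. \<Sum>J\<in>Pow I. V J x) (\<lambda>x. \<Sum>J\<in>Pow I. V J x) = (\<Sum>J\<in>Pow I. ip (V J) (V J))"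
      by (rule ip_sum_pure[OF pV pV])
    also have "\<dots> = (\<Sum>N\<in>A. ip (hcomp Z N) (hcomp Z N))" by (simp only: V_def restr)
    also have "\<dots> = low_energy G G" using low_energy_eq[OF G G] less by (simp add: A_def Z_def)
    finally show ?thesis .
  qed
  have "ip Y Z = (\<Sum>N\<in>Pow I. ip (hcomp Y N) (hcomp Z N))" by (rule parseval[OF Y Z])
  also have "\<dots> = (\<Sum>N\<in>insert {} A. ip (hcomp Y N) (hcomp Z N))"
  proof (rule sum.mono_neutral_right)
    show "\<forall>N\<in>Pow I - insert {} A. ip (hcomp Y N) (hcomp Z N) = 0"
    proof
      fix N assume "N \<in> Pow I - insert {} A"
      then have N: "N \<subseteq> I" "card N \<ge> q + q" by (auto simp: A_def)
      have "top_part F F N = (\<lambda>_. 0)" using less N by (intro top_part_0[OF F F]) auto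
      then have "AE x in M. hcomp Y N x = 0"
        using hcomp_top[OF F F, of N] N less by (simp add: Y_def)
      then have "ip (hcomp Y N) (hcomp Z N) = ip (\<lambda>_. 0) (hcomp Z N)"
        using Lp_meas[OF hcomp_L2[OF N(1) Y]] Lp_meas[OF hcomp_L2[OF N(1) Z]] by (intro ip_cong_AE) auto
      then show "ip (hcomp Y N) (hcomp Z N) = 0" by simp
    qed
  qed (use finite_index in \<open>auto simp: A_def\<close>)
  also have "\<dots> = ip (hcomp Y {}) (hcomp Z {}) + (\<Sum>N\<in>A. ip (hcomp Y N) (hcomp Z N))"
    using finA by (intro sum.insert) (auto simp: A_def)
  also have "ip (hcomp Y {}) (hcomp Z {}) = ip (\<lambda>_. expectation Y) (\<lambda>_. expectation Z)"
    by (rule integral_cong_AE)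
      (use hcomp_empty[OF Y] hcomp_empty[OF Z] Lp_meas[OF hcomp_L2[OF _ Y, of "{}"]] Lp_meas[OF hcomp_L2[OF _ Z, of "{}"]] in auto)
  also have "\<dots> = 1" using unit by (simp add: Y_def Z_def prob_space)
  finally have "ip Y Z - 1 = ip (\<lambda>x. \<Sum>J\<in>Pow I. U J x) (\<lambda>x. \<Sum>J\<in>Pow I. V J x)" using UV by simp
  then have "(ip Y Z - 1)\<^sup>2 \<le> (\<Sum>N\<in>A. ip (hcomp Y N) (hcomp Y N)) * low_energy G G"
    using ip_Cauchy_Schwarz[OF UL VL] UU VV by simp
  also have "(\<Sum>N\<in>A. ip (hcomp Y N) (hcomp Y N)) \<le> ip Y Y"
    unfolding parseval[OF Y Y] using finite_index by (intro sum_mono2 ip_self_nonneg) (auto simp: A_def)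
  also have "ip Y Y = expectation (\<lambda>x. Ustat F x ^ 4)"
    unfolding Y_def by (simp add: power4_eq_xxxx mult.assoc)
  also have "ip Y Z = expectation (\<lambda>x. (Ustat F x)\<^sup>2 * (Ustat G x)\<^sup>2)"
    unfolding Y_def Z_def by (simp add: power2_eq_square)
  finally show ?thesis using low_energy_nonneg[OF G G] less by (simp add: mult_right_mono)
qed

text \<open>Meant for \<open>V\<close> the cube of \<open>Apart F j\<close>, whose square may fail to be integrable, so that \<open>Dpart_ip_0\<close> does
  not apply.\<close>

lemma ip_CE_meas_0:
  assumes V: "V \<in> borel_measurable (sig (I - {j}))" and F: "degen p F"
    and int: "integrable M (\<lambda>x. V x * Dpart F j x)"
  shows "expectation (\<lambda>x. V x * Dpart F j x) = 0"
proof -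
  have ae: "AE x in M. CE (I - {j}) (Dpart F j) x = 0"
    by (rule CE_eqI[OF Dpart_L2[OF F] Lp_const]) (use Dpart_ip_0[OF F, of _ "I - {j}" j] in auto)
  have "expectation (\<lambda>x. V x * Dpart F j x) = expectation (\<lambda>x. V x * CE (I - {j}) (Dpart F j) x)"
    by (rule ce.real_cond_exp_intg(2)[OF int V Lp_meas[OF Dpart_L2[OF F]], symmetric])
  also have "\<dots> = expectation (\<lambda>x. 0)"
    by (rule integral_cong_AE[OF borel_measurable_times[OF measurable_sig[OF V] measurable_sig[OF CE_measurable]]])
      (use ae in auto)
  finally show ?thesis by simp
qed

lemma L4_mult4_integrable:
  assumes "f \<in> L4 J" "g \<in> L4 J'" "h \<in> L4 K" "k \<in> L4 K'"
  shows "integrable M (\<lambda>x. f x * g x * h x * k x)"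
  using L2_mult_integrable[OF L4_mult[OF assms(1,2)] L4_mult[OF assms(3,4)]] by (simp add: mult.assoc)

text \<open>With \<open>f = a + d\<close>, both \<open>E[f\<^sup>2 (d\<^sup>2 + w)]\<close> and \<open>E[f\<^sup>3 d]\<close> are combinations of \<open>E[a\<^sup>2 d\<^sup>2]\<close>, \<open>E[a d\<^sup>3]\<close>, \<open>E[d^4]\<close> and
  \<open>E[w\<^sup>2]\<close>. In the combination on the right the first two cancel, and what is left is \<open>E[d^4] + 3 E[w\<^sup>2]\<close>.\<close>

lemma fourth_moment_Dpart_le:
  assumes F: "degen p F" and j: "j \<in> I"
  defines "w \<equiv> CE (I - {j}) (\<lambda>x. Dpart F j x * Dpart F j x)"
  shows "expectation (\<lambda>x. Dpart F j x ^ 4) \<le>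
    3 * expectation (\<lambda>x. (Ustat F x * Ustat F x) * (Dpart F j x * Dpart F j x + w x))
    - 2 * expectation (\<lambda>x. Ustat F x * Ustat F x * Ustat F x * Dpart F j x)"
proof -
  let ?a = "Apart F j" and ?d = "Dpart F j" and ?f = "Ustat F" and ?K = "I - {j}"
  note a4 = Apart_L4[OF F, of j] and d4 = Dpart_L4[OF F, of j] and f4 = Ustat_L4[OF F]
  have am: "?a \<in> borel_measurable (sig ?K)" by (rule Lp_meas_sig[OF a4])
  have w2: "w \<in> L2 ?K" unfolding w_def by (rule CE_L2[OF Dpart_mult_L2[OF F F]])
  have wm: "w \<in> borel_measurable (sig ?K)" by (rule Lp_meas_sig[OF w2])
  have iaaad: "integrable M (\<lambda>x. ?a x * ?a x * ?a x * ?d x)" by (rule L4_mult4_integrable[OF a4 a4 a4 d4])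
  have iaadd: "integrable M (\<lambda>x. ?a x * ?a x * ?d x * ?d x)" by (rule L4_mult4_integrable[OF a4 a4 d4 d4])
  have iaddd: "integrable M (\<lambda>x. ?a x * ?d x * ?d x * ?d x)" by (rule L4_mult4_integrable[OF a4 d4 d4 d4])
  have idddd: "integrable M (\<lambda>x. ?d x * ?d x * ?d x * ?d x)" by (rule L4_mult4_integrable[OF d4 d4 d4 d4])
  have iaaw: "integrable M (\<lambda>x. (?a x * ?a x) * w x)"
    by (rule L2_mult_integrable[OF L4_mult[OF a4 a4] w2])
  have iadw: "integrable M (\<lambda>x. (?a x * w x) * ?d x)"
    using L2_mult_integrable[OF L4_mult[OF a4 d4] w2] by (simp add: ac_simps)
  have iddw: "integrable M (\<lambda>x. (?d x * ?d x) * w x)"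
    by (rule L2_mult_integrable[OF L4_mult[OF d4 d4] w2])
  have z1: "expectation (\<lambda>x. ?a x * ?a x * ?a x * ?d x) = 0"
    by (rule ip_CE_meas_0[OF _ F iaaad]) (use am in measurable)
  have z2: "expectation (\<lambda>x. (?a x * w x) * ?d x) = 0"
    by (rule ip_CE_meas_0[OF _ F iadw]) (use am wm in measurable)
  have aaw: "expectation (\<lambda>x. (?a x * ?a x) * w x) = expectation (\<lambda>x. ?a x * ?a x * ?d x * ?d x)"
    using CE_ip[OF Dpart_mult_L2[OF F F] L4_mult[OF a4 a4], of j] unfolding w_def by (simp add: ac_simps)
  have ddw: "expectation (\<lambda>x. (?d x * ?d x) * w x) = ip w w"
    using CE_ip[OF Dpart_mult_L2[OF F F] w2, of j] unfolding w_def by (simp add: ac_simps)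
  have "expectation (\<lambda>x. ?f x * ?f x * ?f x * ?d x) =
    expectation (\<lambda>x. (?a x * ?a x * ?a x * ?d x) + 3 * (?a x * ?a x * ?d x * ?d x) + 3 * (?a x * ?d x * ?d x * ?d x) + (?d x * ?d x * ?d x * ?d x))"
    by (intro Bochner_Integration.integral_cong refl) (simp add: Ustat_split[OF j] algebra_simps)
  also have "\<dots> = 3 * expectation (\<lambda>x. ?a x * ?a x * ?d x * ?d x) + 3 * expectation (\<lambda>x. ?a x * ?d x * ?d x * ?d x)
     + expectation (\<lambda>x. ?d x * ?d x * ?d x * ?d x)"
    using iaaad iaadd iaddd idddd z1 by simp
  finally have e1: "expectation (\<lambda>x. ?f x * ?f x * ?f x * ?d x) = \<dots>" .
  have "expectation (\<lambda>x. (?f x * ?f x) * (?d x * ?d x + w x)) =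
    expectation (\<lambda>x. (?a x * ?a x * ?d x * ?d x) + 2 * (?a x * ?d x * ?d x * ?d x) + (?d x * ?d x * ?d x * ?d x)
      + (?a x * ?a x) * w x + 2 * ((?a x * w x) * ?d x) + (?d x * ?d x) * w x)"
    by (intro Bochner_Integration.integral_cong refl) (simp add: Ustat_split[OF j] algebra_simps)
  also have "\<dots> = 2 * expectation (\<lambda>x. ?a x * ?a x * ?d x * ?d x) + 2 * expectation (\<lambda>x. ?a x * ?d x * ?d x * ?d x)
     + expectation (\<lambda>x. ?d x * ?d x * ?d x * ?d x) + ip w w"
    using iaadd iaddd idddd iaaw iadw iddw z2 aaw ddw by simp
  finally have e2: "expectation (\<lambda>x. (?f x * ?f x) * (?d x * ?d x + w x)) = \<dots>" .
  have "expectation (\<lambda>x. ?d x ^ 4) = expectation (\<lambda>x. ?d x * ?d x * ?d x * ?d x)"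
    by (simp add: power4_eq_xxxx)
  then show ?thesis using e1 e2 ip_self_nonneg[of w] by simp
qed

definition fourth_sum :: "(nat set \<Rightarrow> 'a \<Rightarrow> real) \<Rightarrow> real" where
  "fourth_sum F = (\<Sum>j\<in>I. expectation (\<lambda>x. Dpart F j x ^ 4))"

text \<open>Summing over \<open>j\<close> gives \<open>3 E[f\<^sup>2 \<Gamma>\<^sub>2(f, f)] - 2 p E f^4\<close>; replacing \<open>\<Gamma>\<^sub>2\<close> by its mean \<open>2 p\<close> costs a
  square root of its variance. The bound vanishes when the fourth moment is \<open>3\<close> and \<open>low_energy F F\<close> is \<open>0\<close>.\<close>

lemma fourth_sum_le:
  assumes F: "degen p F" and pos: "p > 0" and unit: "ip (Ustat F) (Ustat F) = 1"
  shows "fourth_sum F \<le> 6 * real p - 2 * real p * expectation (\<lambda>x. Ustat F x ^ 4)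
     + 6 * real p * sqrt (expectation (\<lambda>x. Ustat F x ^ 4) * low_energy F F)"
proof -
  let ?f = "Ustat F" and ?d = "Dpart F"
  let ?w = "\<lambda>j. CE (I - {j}) (\<lambda>x. ?d j x * ?d j x)"
  have fm: "(\<lambda>x. ?f x * ?f x) \<in> L2 I" by (rule Ustat_mult_L2[OF F F])
  have gm: "(\<lambda>x. ?d j x * ?d j x + ?w j x) \<in> L2 I" for j
    by (intro Lp_add Dpart_mult_L2[OF F F] Lp_mono[OF CE_L2[OF Dpart_mult_L2[OF F F]]]) auto
  have "fourth_sum F \<le> (\<Sum>j\<in>I. 3 * expectation (\<lambda>x. (?f x * ?f x) * (?d j x * ?d j x + ?w j x))
    - 2 * expectation (\<lambda>x. ?f x * ?f x * ?f x * ?d j x))"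
    unfolding fourth_sum_def by (intro sum_mono fourth_moment_Dpart_le[OF F])
  also have "\<dots> = 3 * (\<Sum>j\<in>I. expectation (\<lambda>x. (?f x * ?f x) * (?d j x * ?d j x + ?w j x)))
     - 2 * (\<Sum>j\<in>I. expectation (\<lambda>x. ?f x * ?f x * ?f x * ?d j x))"
    by (simp add: sum_subtractf sum_distrib_left)
  also have "(\<Sum>j\<in>I. expectation (\<lambda>x. (?f x * ?f x) * (?d j x * ?d j x + ?w j x))) = ip (\<lambda>x. ?f x * ?f x) (Gamma2 F F)"
    unfolding Gamma2_def sum_distrib_left
    by (rule Bochner_Integration.integral_sum[symmetric]) (rule L2_mult_integrable[OF fm gm])
  also have "(\<Sum>j\<in>I. expectation (\<lambda>x. ?f x * ?f x * ?f x * ?d j x)) = expectation (\<lambda>x. \<Sum>j\<in>I. ?f x * ?f x * ?f x * ?d j x)"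
    by (rule Bochner_Integration.integral_sum[symmetric])
      (rule L4_mult4_integrable[OF Ustat_L4[OF F] Ustat_L4[OF F] Ustat_L4[OF F] Dpart_L4[OF F]])
  also have "\<dots> = real p * expectation (\<lambda>x. ?f x ^ 4)"
    unfolding sum_distrib_left[symmetric] sum_Dpart[OF F] by (simp add: power4_eq_xxxx ac_simps)
  finally have q: "fourth_sum F \<le> 3 * ip (\<lambda>x. ?f x * ?f x) (Gamma2 F F) - 2 * (real p * expectation (\<lambda>x. ?f x ^ 4))" .
  let ?\<mu> = "real (p + p) * ip ?f ?f"
  let ?g = "\<lambda>x. Gamma2 F F x - ?\<mu>"
  note gv = Gamma2_variance[OF F F]
  have g2: "?g \<in> L2 I" using gv(1) pos by simp
  have "ip (\<lambda>x. ?f x * ?f x) (Gamma2 F F) = expectation (\<lambda>x. (?f x * ?f x) * ?g x + ?\<mu> * (?f x * ?f x))"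
    by (intro Bochner_Integration.integral_cong refl) (simp add: algebra_simps)
  also have "\<dots> = ip (\<lambda>x. ?f x * ?f x) ?g + ?\<mu> * ip ?f ?f"
    using L2_mult_integrable[OF fm g2] L2_integrable[OF fm] by simp
  finally have e: "ip (\<lambda>x. ?f x * ?f x) (Gamma2 F F) = ip (\<lambda>x. ?f x * ?f x) ?g + 2 * real p" using unit by simp
  have "(ip (\<lambda>x. ?f x * ?f x) ?g)\<^sup>2 \<le> ip (\<lambda>x. ?f x * ?f x) (\<lambda>x. ?f x * ?f x) * ip ?g ?g"
    by (rule ip_Cauchy_Schwarz[OF fm g2])
  also have "\<dots> \<le> expectation (\<lambda>x. ?f x ^ 4) * ((real (p + p))\<^sup>2 * low_energy F F)"
  proof -
    have a: "ip (\<lambda>x. ?f x * ?f x) (\<lambda>x. ?f x * ?f x) = expectation (\<lambda>x. ?f x ^ 4)"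
      by (simp add: power4_eq_xxxx mult.assoc)
    have b: "ip ?g ?g \<le> (real (p + p))\<^sup>2 * low_energy F F"
      using gv(2) pos by (simp add: power2_eq_square)
    show ?thesis unfolding a by (rule mult_left_mono[OF b]) simp
  qed
  finally have "ip (\<lambda>x. ?f x * ?f x) ?g \<le> sqrt (expectation (\<lambda>x. ?f x ^ 4) * ((real (p + p))\<^sup>2 * low_energy F F))"
    by (rule real_le_rsqrt)
  also have "\<dots> = sqrt ((real (2 * p))\<^sup>2 * (expectation (\<lambda>x. ?f x ^ 4) * low_energy F F))"
    by (simp add: ac_simps mult_2)
  also have "\<dots> = 2 * real p * sqrt (expectation (\<lambda>x. ?f x ^ 4) * low_energy F F)"
    by (simp add: real_sqrt_mult)
  finally show ?thesis using q e by simp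
qed

lemma Dpart_norm: "degen p F \<Longrightarrow> ip (Dpart F j) (Dpart F j) = influence F j"
proof -
  assume F: "degen p F"
  have "ip (Dpart F j) (Dpart F j) = ip (\<lambda>x. \<Sum>J\<in>Pow I. (if j \<in> J then F J else (\<lambda>_. 0)) x) (\<lambda>x. \<Sum>J\<in>Pow I. (if j \<in> J then F J else (\<lambda>_. 0)) x)"
  proof -
    have "Dpart F j x = (\<Sum>J\<in>Pow I. (if j \<in> J then F J else (\<lambda>_. 0)) x)" for x
      unfolding Dpart_def using finite_index by (intro sum.mono_neutral_cong_left) auto
    then show ?thesis by simp
  qed
  also have "\<dots> = (\<Sum>J\<in>Pow I. ip (if j \<in> J then F J else (\<lambda>_. 0)) (if j \<in> J then F J else (\<lambda>_. 0)))"
    by (rule ip_sum_pure) (use degen_pure[OF F] pure_0 in auto)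
  also have "\<dots> = influence F j"
    unfolding influence_def sq_norm_def using finite_index by (intro sum.mono_neutral_cong_right) auto
  finally show ?thesis .
qed

lemma sum_influence: "degen p F \<Longrightarrow> (\<Sum>j\<in>I. influence F j) = real p * ip (Ustat F) (Ustat F)"
proof -
  assume F: "degen p F"
  have "(\<Sum>j\<in>I. influence F j) = (\<Sum>J\<in>Pow I. real (card J) * sq_norm F J)"
    unfolding influence_def by (rule sum_over_members)
  also have "\<dots> = (\<Sum>J\<in>Pow I. real p * sq_norm F J)"
    using sq_norm_0[OF F] by (intro sum.cong refl) auto
  finally show ?thesis by (simp add: ip_Ustat_self[OF F] sum_distrib_left)
qed

end

section \<open>Integration by parts and characteristic functions\<close>

text \<open>What is needed of a test function \<open>\<psi>\<close> and its derivative \<open>\<psi>'\<close>; the instances are \<open>cos\<close> and \<open>sin\<close>, which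
  replace the complex exponential.\<close>

definition smooth_pair :: "(real \<Rightarrow> real) \<Rightarrow> (real \<Rightarrow> real) \<Rightarrow> bool" where
  "smooth_pair \<psi> \<psi>' \<longleftrightarrow> \<psi> \<in> borel_measurable borel \<and> \<psi>' \<in> borel_measurable borel \<and>
    (\<forall>x. \<bar>\<psi> x\<bar> \<le> 1) \<and> (\<forall>x. \<bar>\<psi>' x\<bar> \<le> 1) \<and>
    (\<forall>a d. \<bar>\<psi> (a + d) - \<psi> a - \<psi>' a * d\<bar> \<le> d\<^sup>2 / 2) \<and> (\<forall>a d. \<bar>\<psi>' (a + d) - \<psi>' a\<bar> \<le> \<bar>d\<bar>)"

lemma iexp_taylor:
  fixes a d :: real
  shows "\<bar>cos (a + d) - cos a + sin a * d\<bar> \<le> d\<^sup>2 / 2" "\<bar>sin (a + d) - sin a - cos a * d\<bar> \<le> d\<^sup>2 / 2"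
    "\<bar>cos (a + d) - cos a\<bar> \<le> \<bar>d\<bar>" "\<bar>sin (a + d) - sin a\<bar> \<le> \<bar>d\<bar>"
proof -
  have 1: "cmod (iexp a * (iexp d - (\<Sum>k\<le>1. (\<i> * d)^k / fact k))) \<le> d\<^sup>2 / 2"
    using iexp_approx1[of d 1] by (simp add: norm_mult power2_eq_square)
  have 2: "cmod (iexp a * (iexp d - (\<Sum>k\<le>0. (\<i> * d)^k / fact k))) \<le> \<bar>d\<bar>"
    using iexp_approx1[of d 0] by (simp add: norm_mult)
  have e: "iexp a = Complex (cos a) (sin a)" for a :: real
    by (simp add: complex_eq_iff Re_exp Im_exp)
  show "\<bar>cos (a + d) - cos a + sin a * d\<bar> \<le> d\<^sup>2 / 2"
    using order_trans[OF abs_Re_le_cmod 1] by (simp add: e cos_add algebra_simps)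
  show "\<bar>sin (a + d) - sin a - cos a * d\<bar> \<le> d\<^sup>2 / 2"
    using order_trans[OF abs_Im_le_cmod 1] by (simp add: e sin_add algebra_simps)
  show "\<bar>cos (a + d) - cos a\<bar> \<le> \<bar>d\<bar>"
    using order_trans[OF abs_Re_le_cmod 2] by (simp add: e cos_add algebra_simps)
  show "\<bar>sin (a + d) - sin a\<bar> \<le> \<bar>d\<bar>"
    using order_trans[OF abs_Im_le_cmod 2] by (simp add: e sin_add algebra_simps)
qed

text \<open>The error in the integration by parts for the \<open>k\<close>-th statistic against a function of \<open>\<Sum>\<^sub>l u\<^sub>l f\<^sub>l\<close>. The first
  term comes from the variances of \<open>\<Gamma>\<^sub>2\<close>, the second from the expansion of the test function: there \<open>\<eta>\<close>
  multiplies a bounded quantity and \<open>1 / \<eta>\<close> one that tends to \<open>0\<close>.\<close>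

definition stein_error ::
    "('r::finite \<Rightarrow> nat) \<Rightarrow> ('r \<Rightarrow> 'r \<Rightarrow> real) \<Rightarrow> ('r \<Rightarrow> real) \<Rightarrow> ('r \<Rightarrow> real) \<Rightarrow> real \<Rightarrow> 'r \<Rightarrow> real" where
  "stein_error p lo qu u \<eta> k = (\<Sum>l\<in>UNIV. \<bar>u l\<bar> * (real (p k + p l) * sqrt (lo k l)))
      + 3 / 2 * (\<Sum>l\<in>UNIV. (u l)\<^sup>2) * (\<eta> * (\<Sum>l\<in>UNIV. real (p l)) + (\<Sum>l\<in>UNIV. qu k + qu l) / (2 * \<eta>))"

lemma smooth_pair_sin: "smooth_pair sin cos"
  unfolding smooth_pair_def using iexp_taylor by auto

lemma smooth_pair_cos: "smooth_pair cos (\<lambda>x. - sin x)"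
  unfolding smooth_pair_def using iexp_taylor(1,4) by (auto simp: abs_minus_commute)

lemma smooth_pair_uminus: "smooth_pair \<psi> \<psi>' \<Longrightarrow> smooth_pair (\<lambda>x. - \<psi> x) (\<lambda>x. - \<psi>' x)"
proof -
  assume s: "smooth_pair \<psi> \<psi>'"
  have e: "\<bar>- \<psi> (a + d) - - \<psi> a - - \<psi>' a * d\<bar> = \<bar>\<psi> (a + d) - \<psi> a - \<psi>' a * d\<bar>"
    "\<bar>- \<psi>' (a + d) - - \<psi>' a\<bar> = \<bar>\<psi>' (a + d) - \<psi>' a\<bar>" for a d
  proof -
    have "- \<psi> (a + d) - - \<psi> a - - \<psi>' a * d = - (\<psi> (a + d) - \<psi> a - \<psi>' a * d)"
      "- \<psi>' (a + d) - - \<psi>' a = - (\<psi>' (a + d) - \<psi>' a)" by simp_all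
    then show "\<bar>- \<psi> (a + d) - - \<psi> a - - \<psi>' a * d\<bar> = \<bar>\<psi> (a + d) - \<psi> a - \<psi>' a * d\<bar>"
      "\<bar>- \<psi>' (a + d) - - \<psi>' a\<bar> = \<bar>\<psi>' (a + d) - \<psi>' a\<bar>" by (simp_all only: abs_minus_cancel)
  qed
  show ?thesis using s unfolding smooth_pair_def e by auto
qed

context indep_family begin

lemma bounded_comp:
  assumes "smooth_pair \<psi> \<psi>'" "V \<in> L2 J"
  shows "(\<lambda>x. \<psi> (V x)) \<in> borel_measurable (sig J)" "(\<lambda>x. \<psi>' (V x)) \<in> borel_measurable (sig J)"
    "\<And>x. \<bar>\<psi> (V x)\<bar> \<le> 1" "\<And>x. \<bar>\<psi>' (V x)\<bar> \<le> 1"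
proof -
  have [measurable]: "\<psi> \<in> borel_measurable borel" "\<psi>' \<in> borel_measurable borel" "V \<in> borel_measurable (sig J)"
    using assms Lp_meas_sig by (auto simp: smooth_pair_def)
  show "(\<lambda>x. \<psi> (V x)) \<in> borel_measurable (sig J)" "(\<lambda>x. \<psi>' (V x)) \<in> borel_measurable (sig J)" by measurable
qed (use assms in \<open>auto simp: smooth_pair_def\<close>)

lemma bounded_L2:
  assumes "f \<in> borel_measurable (sig J)" "\<And>x. \<bar>f x\<bar> \<le> 1"
  shows "f \<in> L2 J"
  using L2_mult_bounded[OF Lp_const[of 1 2 J] assms] by simp

text \<open>Expand \<open>\<psi>(A + D)\<close> around \<open>A\<close>. The zeroth order term is killed by \<open>d\<^sub>j f\<close>. In the first order term,
  \<open>E[d\<^sub>j f D \<psi>'(A)]\<close> equals \<open>E[w \<psi>'(A)]\<close>, so one half of it may be written with \<open>w\<close>; this symmetrization is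
  what produces the carre du champ, whose spectral form is known, in place of \<open>\<Sum>\<^sub>j d\<^sub>j f D\<close>. Each error
  term is a product of three factors of the size of \<open>d\<^sub>j\<close> and is split by Young's inequality with a free
  parameter \<open>\<eta>\<close>.\<close>

lemma stein_local:
  assumes F: "degen p F" and A: "A \<in> L2 (I - {j})" and D: "D \<in> L4 I" and \<psi>: "smooth_pair \<psi> \<psi>'"
    and S: "\<And>x. S x = A x + D x" and \<eta>: "\<eta> > 0"
  defines "w \<equiv> CE (I - {j}) (\<lambda>x. Dpart F j x * D x)"
  shows "\<bar>2 * expectation (\<lambda>x. Dpart F j x * \<psi> (S x)) - expectation (\<lambda>x. (Dpart F j x * D x + w x) * \<psi>' (S x))\<bar>
     \<le> 3 / 2 * (\<eta> * ip D D + ip (\<lambda>x. Dpart F j x * D x) (\<lambda>x. Dpart F j x * D x) / \<eta>)"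
proof -
  let ?d = "Dpart F j" and ?K = "I - {j}"
  let ?dD = "\<lambda>x. ?d x * D x"
  have dD: "?dD \<in> L2 I" using L4_mult[OF Dpart_L4[OF F] D] by simp
  have D2: "D \<in> L2 I" by (rule L4_L2[OF D])
  have w2': "w \<in> L2 ?K" unfolding w_def by (rule CE_L2[OF dD])
  have w2: "w \<in> L2 I" by (rule Lp_mono[OF w2']) auto
  have S2: "S \<in> L2 I"
  proof -
    have "(\<lambda>x. A x + D x) \<in> L2 I" by (rule Lp_add[OF _ Lp_mono[OF A] D2]) auto
    then show ?thesis by (simp add: S[symmetric])
  qed
  note d2 = Dpart_L2[OF F, of j]
  note bA = bounded_comp[OF \<psi> A] and bS = bounded_comp[OF \<psi> S2]
  have pA: "(\<lambda>x. \<psi> (A x)) \<in> L2 ?K" and p'A: "(\<lambda>x. \<psi>' (A x)) \<in> L2 ?K"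
    using bounded_L2 bA by auto
  have pS: "(\<lambda>x. \<psi> (S x)) \<in> L2 I" and p'S: "(\<lambda>x. \<psi>' (S x)) \<in> L2 I"
    using bounded_L2 bS by auto
  have dDw: "(\<lambda>x. ?dD x + w x) \<in> L2 I" by (intro Lp_add dD w2) simp
  \<comment> \<open>The part of \<open>2 d \<psi>(S) - (d D + w) \<psi>'(S)\<close> that remains once the terms with vanishing or equal means
    are split off: the remainder of the expansion of \<open>\<psi>\<close> at \<open>A\<close> and the change of \<open>\<psi>'\<close> from \<open>A\<close> to \<open>S\<close>.\<close>
  define R where "R x = 2 * (?d x * (\<psi> (S x) - \<psi> (A x) - \<psi>' (A x) * D x)) + (?dD x + w x) * (\<psi>' (A x) - \<psi>' (S x))" for x
  have z1: "ip ?d (\<lambda>x. \<psi> (A x)) = 0" by (rule Dpart_ip_0[OF F pA]) simp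
  have z2: "ip w (\<lambda>x. \<psi>' (A x)) = ip ?dD (\<lambda>x. \<psi>' (A x))" unfolding w_def by (rule CE_ip[OF dD p'A])
  note ints = L2_mult_integrable[OF d2 pA] L2_mult_integrable[OF d2 pS] L2_mult_integrable[OF dD p'A]
    L2_mult_integrable[OF w2 p'A] L2_mult_integrable[OF dDw p'S]
  have Req: "R x = 2 * (?d x * \<psi> (S x)) - (?dD x + w x) * \<psi>' (S x) - 2 * (?d x * \<psi> (A x)) - ?dD x * \<psi>' (A x) + w x * \<psi>' (A x)" for x
    unfolding R_def by (simp add: algebra_simps)
  have iR: "integrable M R" unfolding Req using ints by simp
  have ER: "expectation R = 2 * expectation (\<lambda>x. ?d x * \<psi> (S x)) - expectation (\<lambda>x. (?dD x + w x) * \<psi>' (S x))"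
    unfolding Req using ints z1 z2 by simp
  define B where "B x = (\<eta> * (D x * D x) + (?dD x * ?dD x) / \<eta>) + (\<eta> * (D x * D x) + (w x * w x) / \<eta>) / 2" for x
  note intsB = L2_mult_integrable[OF D2 D2] L2_mult_integrable[OF dD dD] L2_mult_integrable[OF w2 w2]
  have iB: "integrable M B" unfolding B_def using intsB by simp
  have RB: "\<bar>R x\<bar> \<le> B x" for x
  proof -
    have r: "\<bar>\<psi> (S x) - \<psi> (A x) - \<psi>' (A x) * D x\<bar> \<le> (D x)\<^sup>2 / 2" "\<bar>\<psi>' (A x) - \<psi>' (S x)\<bar> \<le> \<bar>D x\<bar>"
      using \<psi> unfolding smooth_pair_def S by (auto simp: abs_minus_commute)
    have "\<bar>R x\<bar> \<le> \<bar>2 * (?d x * (\<psi> (S x) - \<psi> (A x) - \<psi>' (A x) * D x))\<bar> + \<bar>(?dD x + w x) * (\<psi>' (A x) - \<psi>' (S x))\<bar>"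
      unfolding R_def by (rule abs_triangle_ineq)
    also have "\<dots> \<le> \<bar>?dD x\<bar> * \<bar>D x\<bar> + (\<bar>?dD x\<bar> + \<bar>w x\<bar>) * \<bar>D x\<bar>"
    proof (rule add_mono)
      have "\<bar>2 * (?d x * (\<psi> (S x) - \<psi> (A x) - \<psi>' (A x) * D x))\<bar> = 2 * (\<bar>?d x\<bar> * \<bar>\<psi> (S x) - \<psi> (A x) - \<psi>' (A x) * D x\<bar>)"
        by (simp add: abs_mult)
      also have "\<dots> \<le> 2 * (\<bar>?d x\<bar> * ((D x)\<^sup>2 / 2))" by (intro mult_left_mono r) auto
      also have "\<dots> = \<bar>?dD x\<bar> * \<bar>D x\<bar>" by (simp add: abs_mult power2_eq_square[of "D x"] mult.assoc[symmetric])
      finally show "\<bar>2 * (?d x * (\<psi> (S x) - \<psi> (A x) - \<psi>' (A x) * D x))\<bar> \<le> \<bar>?dD x\<bar> * \<bar>D x\<bar>" .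
      show "\<bar>(?dD x + w x) * (\<psi>' (A x) - \<psi>' (S x))\<bar> \<le> (\<bar>?dD x\<bar> + \<bar>w x\<bar>) * \<bar>D x\<bar>"
        unfolding abs_mult[of "?dD x + w x"] by (intro mult_mono r abs_triangle_ineq) auto
    qed
    also have "\<dots> = 2 * (\<bar>?dD x\<bar> * \<bar>D x\<bar>) + \<bar>w x\<bar> * \<bar>D x\<bar>" by (simp add: algebra_simps)
    also have "\<dots> \<le> B x"
    proof -
      have "2 * (\<bar>?dD x\<bar> * \<bar>D x\<bar>) + \<bar>w x\<bar> * \<bar>D x\<bar> \<le>
          2 * ((\<eta> * (D x)\<^sup>2 + (?dD x)\<^sup>2 / \<eta>) / 2) + (\<eta> * (D x)\<^sup>2 + (w x)\<^sup>2 / \<eta>) / 2"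
        by (intro add_mono mult_left_mono young[OF \<eta>]) simp
      moreover have "2 * (c / 2) = c" for c :: real by simp
      ultimately show ?thesis by (simp only: B_def power2_eq_square)
    qed
    finally show ?thesis .
  qed
  have ww: "ip w w \<le> ip ?dD ?dD"
    unfolding w_def using CE_Lp(2)[of 2 ?dD I ?K] dD L2_integrable[OF dD] by (simp add: power2_eq_square)
  have "\<bar>expectation R\<bar> \<le> expectation (\<lambda>x. \<bar>R x\<bar>)" by (rule integral_abs_bound)
  also have "\<dots> \<le> expectation B" using RB iR iB by (intro integral_mono) auto
  also have "\<dots> = (\<eta> * ip D D + ip ?dD ?dD / \<eta>) + (\<eta> * ip D D + ip w w / \<eta>) / 2"
    unfolding B_def using intsB by simp
  also have "\<dots> \<le> (\<eta> * ip D D + ip ?dD ?dD / \<eta>) + (\<eta> * ip D D + ip ?dD ?dD / \<eta>) / 2"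
    using ww \<eta> by (simp add: divide_right_mono)
  also have "\<dots> = 3 / 2 * (\<eta> * ip D D + ip ?dD ?dD / \<eta>)"
  proof -
    have "c + c / 2 = 3 / 2 * c" for c :: real by simp
    then show ?thesis .
  qed
  finally show ?thesis unfolding ER .
qed

lemma L4_quartic_le:
  assumes f: "f \<in> L4 I" and g: "g \<in> L4 I"
  shows "ip (\<lambda>x. f x * g x) (\<lambda>x. f x * g x) \<le> (expectation (\<lambda>x. f x ^ 4) + expectation (\<lambda>x. g x ^ 4)) / 2"
proof -
  note ints = L4_mult4_integrable[OF f g f g] Lp_power_integrable[OF f] Lp_power_integrable[OF g]
  have "ip (\<lambda>x. f x * g x) (\<lambda>x. f x * g x) \<le> expectation (\<lambda>x. (f x ^ 4 + g x ^ 4) / 2)"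
  proof (rule integral_mono)
    show "integrable M (\<lambda>x. f x * g x * (f x * g x))" using ints(1) by (simp add: mult.assoc)
    show "integrable M (\<lambda>x. (f x ^ 4 + g x ^ 4) / 2)" using ints by simp
    show "f x * g x * (f x * g x) \<le> (f x ^ 4 + g x ^ 4) / 2" for x
      using sum_squares_bound[of "f x * f x" "g x * g x"]
      by (simp add: power2_eq_square power4_eq_xxxx ac_simps)
  qed
  then show ?thesis using ints by simp
qed

text \<open>The sum over \<open>j\<close> of \<open>stein_local\<close>, with \<open>\<Gamma>\<^sub>2\<close> replaced by its mean.\<close>

lemma stein_bound:
  fixes F :: "'r::finite \<Rightarrow> nat set \<Rightarrow> 'a \<Rightarrow> real" and u :: "'r \<Rightarrow> real"
  assumes F: "\<And>l. degen (p l) (F l)" and pos: "\<And>l. p l > 0" and \<psi>: "smooth_pair \<psi> \<psi>'" and \<eta>: "\<eta> > 0"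
    and unit: "\<And>l. ip (Ustat (F l)) (Ustat (F l)) = 1"
  defines "S \<equiv> \<lambda>x. \<Sum>l\<in>UNIV. u l * Ustat (F l) x"
  shows "\<bar>2 * real (p k) * expectation (\<lambda>x. Ustat (F k) x * \<psi> (S x))
     - 2 * real (p k) * (\<Sum>l\<in>UNIV. u l * ip (Ustat (F k)) (Ustat (F l))) * expectation (\<lambda>x. \<psi>' (S x))\<bar>
    \<le> stein_error p (\<lambda>k l. low_energy (F k) (F l)) (\<lambda>k. fourth_sum (F k)) u \<eta> k"
proof -
  define D where "D j x = (\<Sum>l\<in>UNIV. u l * Dpart (F l) j x)" for j x
  define A where "A j x = (\<Sum>l\<in>UNIV. u l * Apart (F l) j x)" for j x
  let ?d = "Dpart (F k)"
  let ?w = "\<lambda>j. CE (I - {j}) (\<lambda>x. ?d j x * D j x)"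
  have D4: "D j \<in> L4 I" for j unfolding D_def by (intro Lp_sum Lp_cmult Dpart_L4[OF F]) simp
  have A2: "A j \<in> L2 (I - {j})" for j unfolding A_def by (intro Lp_sum Lp_cmult L4_L2[OF Apart_L4[OF F]]) simp
  have S2: "S \<in> L2 I" unfolding S_def by (intro Lp_sum Lp_cmult Ustat_L2[OF F]) simp
  have Ssplit: "S x = A j x + D j x" if "j \<in> I" for j x
    unfolding S_def A_def D_def sum.distrib[symmetric] Ustat_split[OF that] by (simp add: distrib_left)
  note bS = bounded_comp[OF \<psi> S2]
  have pS: "(\<lambda>x. \<psi> (S x)) \<in> L2 I" and p'S: "(\<lambda>x. \<psi>' (S x)) \<in> L2 I"
    using bounded_L2 bS by auto
  have dD: "(\<lambda>x. ?d j x * D j x) \<in> L2 I" for j using L4_mult[OF Dpart_L4[OF F] D4] by simp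
  have dDw: "(\<lambda>x. ?d j x * D j x + ?w j x) \<in> L2 I" for j
    by (intro Lp_add dD Lp_mono[OF CE_L2[OF dD]]) auto
  let ?U = "\<Sum>l\<in>UNIV. (u l)\<^sup>2"
  let ?err = "\<lambda>j. 3 / 2 * (\<eta> * ip (D j) (D j) + ip (\<lambda>x. ?d j x * D j x) (\<lambda>x. ?d j x * D j x) / \<eta>)"
  have lhs1: "2 * real (p k) * expectation (\<lambda>x. Ustat (F k) x * \<psi> (S x)) = (\<Sum>j\<in>I. 2 * expectation (\<lambda>x. ?d j x * \<psi> (S x)))"
  proof -
    have "(\<Sum>j\<in>I. expectation (\<lambda>x. ?d j x * \<psi> (S x))) = expectation (\<lambda>x. (\<Sum>j\<in>I. ?d j x) * \<psi> (S x))"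
      by (rule ip_sum_left[OF Dpart_L2[OF F] pS, symmetric])
    also have "\<dots> = real (p k) * expectation (\<lambda>x. Ustat (F k) x * \<psi> (S x))"
      unfolding sum_Dpart[OF F] by (simp add: mult.assoc)
    finally show ?thesis by (simp add: sum_distrib_left[symmetric])
  qed
  have lhs2: "(\<Sum>j\<in>I. expectation (\<lambda>x. (?d j x * D j x + ?w j x) * \<psi>' (S x))) =
     (\<Sum>l\<in>UNIV. u l * ip (Gamma2 (F k) (F l)) (\<lambda>x. \<psi>' (S x)))"
  proof -
    have ae: "AE x in M. \<forall>j\<in>I. ?w j x = (\<Sum>l\<in>UNIV. u l * CE (I - {j}) (\<lambda>x. ?d j x * Dpart (F l) j x) x)"
    proof (rule AE_finite_allI[OF finite_index])
      fix j
      have i: "integrable M (\<lambda>x. ?d j x * Dpart (F l) j x)" for l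
        by (rule L2_integrable[OF Dpart_mult_L2[OF F F]])
      have "AE x in M. CE (I - {j}) (\<lambda>x. \<Sum>l\<in>UNIV. u l * (?d j x * Dpart (F l) j x)) x =
          (\<Sum>l\<in>UNIV. CE (I - {j}) (\<lambda>x. u l * (?d j x * Dpart (F l) j x)) x)"
        using i by (intro ce.real_cond_exp_sum) auto
      moreover have "AE x in M. \<forall>l\<in>UNIV. CE (I - {j}) (\<lambda>x. u l * (?d j x * Dpart (F l) j x)) x = u l * CE (I - {j}) (\<lambda>x. ?d j x * Dpart (F l) j x) x"
        using i by (intro AE_finite_allI ce.real_cond_exp_cmult) auto
      ultimately show "AE x in M. ?w j x = (\<Sum>l\<in>UNIV. u l * CE (I - {j}) (\<lambda>x. ?d j x * Dpart (F l) j x) x)"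
      proof eventually_elim
        case (elim x)
        have "(\<lambda>x. ?d j x * D j x) = (\<lambda>x. \<Sum>l\<in>UNIV. u l * (?d j x * Dpart (F l) j x))"
          unfolding D_def sum_distrib_left by (simp add: ac_simps)
        then show ?case using elim by simp
      qed
    qed
    have gm: "Gamma2 (F k) (F l) \<in> L2 I" for l
      unfolding Gamma2_def
      by (intro Lp_sum Lp_add Dpart_mult_L2[OF F F] Lp_mono[OF CE_L2[OF Dpart_mult_L2[OF F F]]]) auto
    have "(\<Sum>j\<in>I. expectation (\<lambda>x. (?d j x * D j x + ?w j x) * \<psi>' (S x))) = ip (\<lambda>x. \<Sum>j\<in>I. ?d j x * D j x + ?w j x) (\<lambda>x. \<psi>' (S x))"
      by (rule ip_sum_left[OF dDw p'S, symmetric])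
    also have "\<dots> = ip (\<lambda>x. \<Sum>l\<in>UNIV. u l * Gamma2 (F k) (F l) x) (\<lambda>x. \<psi>' (S x))"
    proof (rule ip_cong_AE)
      show "AE x in M. (\<Sum>j\<in>I. ?d j x * D j x + ?w j x) = (\<Sum>l\<in>UNIV. u l * Gamma2 (F k) (F l) x)"
        using ae
      proof eventually_elim
        case (elim x)
        have "(\<Sum>j\<in>I. ?d j x * D j x + ?w j x) = (\<Sum>j\<in>I. \<Sum>l\<in>UNIV. u l * (?d j x * Dpart (F l) j x + CE (I - {j}) (\<lambda>x. ?d j x * Dpart (F l) j x) x))"
          using elim by (intro sum.cong refl) (simp add: D_def sum_distrib_left distrib_left sum.distrib ac_simps)
        also have "\<dots> = (\<Sum>l\<in>UNIV. \<Sum>j\<in>I. u l * (?d j x * Dpart (F l) j x + CE (I - {j}) (\<lambda>x. ?d j x * Dpart (F l) j x) x))"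
          by (rule sum.swap)
        also have "\<dots> = (\<Sum>l\<in>UNIV. u l * Gamma2 (F k) (F l) x)"
          unfolding Gamma2_def sum_distrib_left ..
        finally show ?case .
      qed
      show "(\<lambda>x. \<Sum>j\<in>I. ?d j x * D j x + ?w j x) \<in> borel_measurable M"
        by (rule Lp_meas[OF Lp_sum[OF _ dDw]]) simp
      show "(\<lambda>x. \<Sum>l\<in>UNIV. u l * Gamma2 (F k) (F l) x) \<in> borel_measurable M"
        by (rule Lp_meas[OF Lp_sum[OF _ Lp_cmult[OF gm]]]) simp
    qed (rule Lp_meas[OF p'S])
    also have "\<dots> = (\<Sum>l\<in>UNIV. ip (\<lambda>x. u l * Gamma2 (F k) (F l) x) (\<lambda>x. \<psi>' (S x)))"
      by (rule ip_sum_left[OF Lp_cmult[OF gm] p'S])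
    finally show ?thesis by (simp add: mult.assoc)
  qed
  have step1: "\<bar>2 * real (p k) * expectation (\<lambda>x. Ustat (F k) x * \<psi> (S x))
      - (\<Sum>l\<in>UNIV. u l * ip (Gamma2 (F k) (F l)) (\<lambda>x. \<psi>' (S x)))\<bar> \<le> (\<Sum>j\<in>I. ?err j)"
    unfolding lhs1 lhs2[symmetric] sum_subtractf[symmetric]
  proof (rule order_trans[OF sum_abs], rule sum_mono)
    fix j assume "j \<in> I"
    show "\<bar>2 * expectation (\<lambda>x. ?d j x * \<psi> (S x)) - expectation (\<lambda>x. (?d j x * D j x + ?w j x) * \<psi>' (S x))\<bar> \<le> ?err j"
      by (rule stein_local[OF F A2 D4 \<psi> Ssplit[OF \<open>j \<in> I\<close>] \<eta>])
  qed
  \<comment> \<open>\<open>\<Gamma>\<^sub>2\<close> is replaced by its mean; that mean is \<open>2 p\<^sub>k c\<^sub>k\<^sub>l\<close> also when the orders differ, as then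
    \<open>c\<^sub>k\<^sub>l = 0\<close>.\<close>
  have step2: "\<bar>(\<Sum>l\<in>UNIV. u l * ip (Gamma2 (F k) (F l)) (\<lambda>x. \<psi>' (S x)))
      - 2 * real (p k) * (\<Sum>l\<in>UNIV. u l * ip (Ustat (F k)) (Ustat (F l))) * expectation (\<lambda>x. \<psi>' (S x))\<bar>
     \<le> (\<Sum>l\<in>UNIV. \<bar>u l\<bar> * (real (p k + p l) * sqrt (low_energy (F k) (F l))))"
  proof -
    let ?c = "\<lambda>l. ip (Ustat (F k)) (Ustat (F l))"
    have one: "\<bar>ip (Gamma2 (F k) (F l)) (\<lambda>x. \<psi>' (S x)) - 2 * real (p k) * ?c l * expectation (\<lambda>x. \<psi>' (S x))\<bar>
       \<le> real (p k + p l) * sqrt (low_energy (F k) (F l))" for l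
    proof -
      let ?\<mu> = "real (p k + p l) * ?c l"
      let ?g = "\<lambda>x. Gamma2 (F k) (F l) x - ?\<mu>"
      have pp: "p k + p l > 0" using pos[of k] by simp
      note gv = Gamma2_variance[OF F[of k] F[of l] pp]
      have mu: "?\<mu> = 2 * real (p k) * ?c l"
        using ip_degen_orders_differ[OF F[of k] F[of l]] by (cases "p k = p l") auto
      have "ip (Gamma2 (F k) (F l)) (\<lambda>x. \<psi>' (S x)) = expectation (\<lambda>x. ?g x * \<psi>' (S x) + ?\<mu> * \<psi>' (S x))"
        by (intro Bochner_Integration.integral_cong refl) (simp add: algebra_simps)
      also have "\<dots> = ip ?g (\<lambda>x. \<psi>' (S x)) + ?\<mu> * expectation (\<lambda>x. \<psi>' (S x))"
        using L2_mult_integrable[OF gv(1) p'S] L2_integrable[OF p'S] by simp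
      finally have e: "ip (Gamma2 (F k) (F l)) (\<lambda>x. \<psi>' (S x)) - 2 * real (p k) * ?c l * expectation (\<lambda>x. \<psi>' (S x)) = ip ?g (\<lambda>x. \<psi>' (S x))"
        using mu by simp
      have "(ip ?g (\<lambda>x. \<psi>' (S x)))\<^sup>2 \<le> ip ?g ?g * ip (\<lambda>x. \<psi>' (S x)) (\<lambda>x. \<psi>' (S x))"
        by (rule ip_Cauchy_Schwarz[OF gv(1) p'S])
      also have "\<dots> \<le> ip ?g ?g * 1"
      proof (rule mult_left_mono[OF _ ip_self_nonneg])
        have "ip (\<lambda>x. \<psi>' (S x)) (\<lambda>x. \<psi>' (S x)) \<le> expectation (\<lambda>x. 1)"
          using L2_mult_integrable[OF p'S p'S] bS(4)
          by (intro integral_mono) (auto simp: power2_eq_square[symmetric] abs_le_square_iff[of _ 1, simplified])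
        then show "ip (\<lambda>x. \<psi>' (S x)) (\<lambda>x. \<psi>' (S x)) \<le> 1" by (simp add: prob_space)
      qed
      also have "\<dots> \<le> (real (p k + p l))\<^sup>2 * low_energy (F k) (F l)"
        using gv(2) by (simp add: power2_eq_square)
      finally have "\<bar>ip ?g (\<lambda>x. \<psi>' (S x))\<bar>\<^sup>2 \<le> (real (p k + p l))\<^sup>2 * low_energy (F k) (F l)"
        by (simp only: power2_abs)
      then have "\<bar>ip ?g (\<lambda>x. \<psi>' (S x))\<bar> \<le> sqrt ((real (p k + p l))\<^sup>2 * low_energy (F k) (F l))"
        by (rule real_le_rsqrt)
      then show ?thesis unfolding e by (simp add: real_sqrt_mult)
    qed
    have "(\<Sum>l\<in>UNIV. u l * ip (Gamma2 (F k) (F l)) (\<lambda>x. \<psi>' (S x)))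
      - 2 * real (p k) * (\<Sum>l\<in>UNIV. u l * ?c l) * expectation (\<lambda>x. \<psi>' (S x))
      = (\<Sum>l\<in>UNIV. u l * (ip (Gamma2 (F k) (F l)) (\<lambda>x. \<psi>' (S x)) - 2 * real (p k) * ?c l * expectation (\<lambda>x. \<psi>' (S x))))"
      by (simp add: sum_distrib_left sum_distrib_right sum_subtractf right_diff_distrib ac_simps)
    also have "\<bar>\<dots>\<bar> \<le> (\<Sum>l\<in>UNIV. \<bar>u l\<bar> * (real (p k + p l) * sqrt (low_energy (F k) (F l))))"
      by (rule order_trans[OF sum_abs], rule sum_mono, unfold abs_mult[of "u _"]) (intro mult_left_mono one abs_ge_zero)
    finally show ?thesis .
  qed
  have Dsq: "(D j x)\<^sup>2 \<le> ?U * (\<Sum>l\<in>UNIV. (Dpart (F l) j x)\<^sup>2)" for j x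
    unfolding D_def by (rule Cauchy_Schwarz_ineq_sum)
  have DD: "ip (D j) (D j) \<le> ?U * (\<Sum>l\<in>UNIV. influence (F l) j)" for j
  proof -
    have "ip (D j) (D j) \<le> expectation (\<lambda>x. ?U * (\<Sum>l\<in>UNIV. Dpart (F l) j x * Dpart (F l) j x))"
      using Dsq[of j] L2_mult_integrable[OF L4_L2[OF D4] L4_L2[OF D4], of j j] L2_integrable[OF Dpart_mult_L2[OF F F]]
      by (intro integral_mono) (auto simp: power2_eq_square)
    also have "\<dots> = ?U * (\<Sum>l\<in>UNIV. ip (Dpart (F l) j) (Dpart (F l) j))"
      using L2_integrable[OF Dpart_mult_L2[OF F F]] by simp
    finally show ?thesis by (simp add: Dpart_norm[OF F])
  qed
  have dDdD: "ip (\<lambda>x. ?d j x * D j x) (\<lambda>x. ?d j x * D j x) \<le>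
      ?U * (\<Sum>l\<in>UNIV. (expectation (\<lambda>x. ?d j x ^ 4) + expectation (\<lambda>x. Dpart (F l) j x ^ 4)) / 2)" for j
  proof -
    have i: "integrable M (\<lambda>x. (?d j x * Dpart (F l) j x) * (?d j x * Dpart (F l) j x))" for l
      by (rule L2_mult_integrable[OF Dpart_mult_L2[OF F F] Dpart_mult_L2[OF F F]])
    have "ip (\<lambda>x. ?d j x * D j x) (\<lambda>x. ?d j x * D j x) \<le>
       expectation (\<lambda>x. ?U * (\<Sum>l\<in>UNIV. (?d j x * Dpart (F l) j x) * (?d j x * Dpart (F l) j x)))"
    proof (rule integral_mono)
      show "integrable M (\<lambda>x. ?d j x * D j x * (?d j x * D j x))" by (rule L2_mult_integrable[OF dD dD])
      show "integrable M (\<lambda>x. ?U * (\<Sum>l\<in>UNIV. (?d j x * Dpart (F l) j x) * (?d j x * Dpart (F l) j x)))"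
        using i by simp
      fix x
      have "?d j x * D j x * (?d j x * D j x) = (?d j x)\<^sup>2 * (D j x)\<^sup>2" by (simp add: power2_eq_square ac_simps)
      also have "\<dots> \<le> (?d j x)\<^sup>2 * (?U * (\<Sum>l\<in>UNIV. (Dpart (F l) j x)\<^sup>2))"
        by (rule mult_left_mono[OF Dsq]) simp
      also have "\<dots> = ?U * (\<Sum>l\<in>UNIV. (?d j x * Dpart (F l) j x) * (?d j x * Dpart (F l) j x))"
        by (simp add: sum_distrib_left power2_eq_square ac_simps)
      finally show "?d j x * D j x * (?d j x * D j x) \<le> \<dots>" .
    qed
    also have "\<dots> = ?U * (\<Sum>l\<in>UNIV. ip (\<lambda>x. ?d j x * Dpart (F l) j x) (\<lambda>x. ?d j x * Dpart (F l) j x))"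
      using i by simp
    also have "\<dots> \<le> ?U * (\<Sum>l\<in>UNIV. (expectation (\<lambda>x. ?d j x ^ 4) + expectation (\<lambda>x. Dpart (F l) j x ^ 4)) / 2)"
      by (intro mult_left_mono sum_mono L4_quartic_le Dpart_L4[OF F] sum_nonneg) simp
    finally show ?thesis .
  qed
  have "(\<Sum>j\<in>I. ?err j) \<le> (\<Sum>j\<in>I. 3 / 2 * (\<eta> * (?U * (\<Sum>l\<in>UNIV. influence (F l) j))
      + (?U * (\<Sum>l\<in>UNIV. (expectation (\<lambda>x. ?d j x ^ 4) + expectation (\<lambda>x. Dpart (F l) j x ^ 4)) / 2)) / \<eta>))"
    using \<eta> by (intro sum_mono mult_left_mono add_mono divide_right_mono DD dDdD) auto
  also have "\<dots> = 3 / 2 * (\<eta> * (?U * (\<Sum>j\<in>I. \<Sum>l\<in>UNIV. influence (F l) j))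
      + (?U * (\<Sum>j\<in>I. \<Sum>l\<in>UNIV. (expectation (\<lambda>x. ?d j x ^ 4) + expectation (\<lambda>x. Dpart (F l) j x ^ 4)) / 2)) / \<eta>)"
    by (simp only: sum_distrib_left[symmetric] sum.distrib sum_divide_distrib[symmetric])
  also have "(\<Sum>j\<in>I. \<Sum>l\<in>UNIV. influence (F l) j) = (\<Sum>l\<in>UNIV. real (p l))"
    by (subst sum.swap) (simp add: sum_influence[OF F] unit)
  also have "(\<Sum>j\<in>I. \<Sum>l\<in>UNIV. (expectation (\<lambda>x. ?d j x ^ 4) + expectation (\<lambda>x. Dpart (F l) j x ^ 4)) / 2)
      = (\<Sum>l\<in>UNIV. fourth_sum (F k) + fourth_sum (F l)) / 2"
    unfolding sum_divide_distrib
    by (subst sum.swap) (simp add: fourth_sum_def sum.distrib sum_divide_distrib add_divide_distrib)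
  also have "3 / 2 * (\<eta> * (?U * (\<Sum>l\<in>UNIV. real (p l))) + (?U * ((\<Sum>l\<in>UNIV. fourth_sum (F k) + fourth_sum (F l)) / 2)) / \<eta>)
     = 3 / 2 * ?U * (\<eta> * (\<Sum>l\<in>UNIV. real (p l)) + (\<Sum>l\<in>UNIV. fourth_sum (F k) + fourth_sum (F l)) / (2 * \<eta>))"
    by (simp add: algebra_simps)
  finally show ?thesis unfolding stein_error_def using step1 step2 by linarith
qed

lemma deriv_expectation:
  assumes Y: "Y \<in> L2 I" and \<psi>: "smooth_pair \<psi> \<psi>'"
  shows "((\<lambda>s. expectation (\<lambda>x. \<psi> (s * Y x))) has_real_derivative expectation (\<lambda>x. Y x * \<psi>' (s * Y x))) (at s)"
proof -
  let ?\<phi> = "\<lambda>s. expectation (\<lambda>x. \<psi> (s * Y x))"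
  let ?d = "expectation (\<lambda>x. Y x * \<psi>' (s * Y x))"
  have taylor: "\<bar>\<psi> (a + d) - \<psi> a - \<psi>' a * d\<bar> \<le> d\<^sup>2 / 2" for a d
    using \<psi> by (simp add: smooth_pair_def)
  have sY: "(\<lambda>x. s * Y x) \<in> L2 I" for s by (rule Lp_cmult[OF Y])
  have i0: "integrable M (\<lambda>x. \<psi> (s * Y x))" for s
    by (rule L2_integrable[OF bounded_L2]) (use bounded_comp[OF \<psi> sY] in auto)
  have i1: "integrable M (\<lambda>x. Y x * \<psi>' (s * Y x))"
    by (rule L2_mult_integrable[OF Y bounded_L2]) (use bounded_comp[OF \<psi> sY] in auto)
  have bound: "\<bar>?\<phi> (s + h) - ?\<phi> s - h * ?d\<bar> \<le> h\<^sup>2 * (ip Y Y / 2)" for h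
  proof -
    have eq: "?\<phi> (s + h) - ?\<phi> s - h * ?d = expectation (\<lambda>x. \<psi> ((s + h) * Y x) - \<psi> (s * Y x) - h * (Y x * \<psi>' (s * Y x)))"
    proof -
      have "expectation (\<lambda>x. \<psi> ((s + h) * Y x) - \<psi> (s * Y x) - h * (Y x * \<psi>' (s * Y x))) =
          expectation (\<lambda>x. \<psi> ((s + h) * Y x) - \<psi> (s * Y x)) - expectation (\<lambda>x. h * (Y x * \<psi>' (s * Y x)))"
        by (intro Bochner_Integration.integral_diff Bochner_Integration.integrable_diff integrable_mult_right i0 i1)
      also have "expectation (\<lambda>x. \<psi> ((s + h) * Y x) - \<psi> (s * Y x)) = ?\<phi> (s + h) - ?\<phi> s"
        by (intro Bochner_Integration.integral_diff i0)
      finally show ?thesis by simp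
    qed
    have "\<bar>?\<phi> (s + h) - ?\<phi> s - h * ?d\<bar> \<le> expectation (\<lambda>x. \<bar>\<psi> ((s + h) * Y x) - \<psi> (s * Y x) - h * (Y x * \<psi>' (s * Y x))\<bar>)"
      unfolding eq by (rule integral_abs_bound)
    also have "\<dots> \<le> expectation (\<lambda>x. h\<^sup>2 / 2 * (Y x * Y x))"
    proof (rule integral_mono)
      fix x
      show "\<bar>\<psi> ((s + h) * Y x) - \<psi> (s * Y x) - h * (Y x * \<psi>' (s * Y x))\<bar> \<le> h\<^sup>2 / 2 * (Y x * Y x)"
      proof -
        have "(s + h) * Y x = s * Y x + h * Y x" "\<psi>' (s * Y x) * (h * Y x) = h * (Y x * \<psi>' (s * Y x))"
          "(h * Y x)\<^sup>2 / 2 = h\<^sup>2 / 2 * (Y x * Y x)"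
          by (simp_all add: distrib_right power2_eq_square)
        with taylor[of "s * Y x" "h * Y x"] show ?thesis by (simp only:)
      qed
    next
      show "integrable M (\<lambda>x. \<bar>\<psi> ((s + h) * Y x) - \<psi> (s * Y x) - h * (Y x * \<psi>' (s * Y x))\<bar>)"
        by (intro integrable_abs Bochner_Integration.integrable_diff integrable_mult_right i0 i1)
      show "integrable M (\<lambda>x. h\<^sup>2 / 2 * (Y x * Y x))"
        by (intro integrable_mult_right L2_mult_integrable[OF Y Y])
    qed
    also have "\<dots> = h\<^sup>2 * (ip Y Y / 2)" by simp
    finally show ?thesis .
  qed
  have "((\<lambda>h. (?\<phi> (s + h) - ?\<phi> s) / h - ?d) \<longlongrightarrow> 0) (at 0)"
  proof (rule Lim_null_comparison)
    show "\<forall>\<^sub>F h in at 0. norm ((?\<phi> (s + h) - ?\<phi> s) / h - ?d) \<le> \<bar>h\<bar> * (ip Y Y / 2)"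
    proof (rule eventually_mono[OF eventually_neq_at_within])
      fix h :: real assume h: "h \<noteq> 0"
      have "\<bar>h\<bar> * \<bar>(?\<phi> (s + h) - ?\<phi> s) / h - ?d\<bar> = \<bar>?\<phi> (s + h) - ?\<phi> s - h * ?d\<bar>"
      proof -
        have "h * (a / h - d) = a - h * d" for a d using h by (simp add: right_diff_distrib)
        then show ?thesis by (simp only: abs_mult[symmetric])
      qed
      also have "\<dots> \<le> \<bar>h\<bar> * (\<bar>h\<bar> * (ip Y Y / 2))"
      proof -
        have "h\<^sup>2 * c = \<bar>h\<bar> * (\<bar>h\<bar> * c)" for c by (simp add: power2_eq_square mult.assoc[symmetric])
        then show ?thesis using bound[of h] by (simp only:)
      qed
      finally show "norm ((?\<phi> (s + h) - ?\<phi> s) / h - ?d) \<le> \<bar>h\<bar> * (ip Y Y / 2)"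
        unfolding real_norm_def by (rule mult_left_le_imp_le) (use h in simp)
    qed
    show "((\<lambda>h. \<bar>h\<bar> * (ip Y Y / 2)) \<longlongrightarrow> 0) (at 0)"
      by (auto intro!: tendsto_eq_intros)
  qed
  then show ?thesis unfolding DERIV_def by (rule LIM_zero_cancel)
qed

text \<open>The derivative of \<open>s \<mapsto> E \<psi>(s Y)\<close> is \<open>E[Y \<psi>'(s Y)]\<close>. As with sine and cosine, the derivative of \<open>\<psi>'\<close> is \<open>- \<psi>\<close>,
  so integration by parts turns this back into \<open>- s q E \<psi>(s Y)\<close> up to an error.\<close>

lemma char_bound:
  fixes F :: "'r::finite \<Rightarrow> nat set \<Rightarrow> 'a \<Rightarrow> real" and u :: "'r \<Rightarrow> real"
  assumes F: "\<And>l. degen (p l) (F l)" and pos: "\<And>l. p l > 0" and \<eta>: "\<eta> > 0"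
    and \<psi>: "smooth_pair \<psi> \<psi>'" "smooth_pair \<psi>' (\<lambda>x. - \<psi> x)"
    and unit: "\<And>l. ip (Ustat (F l)) (Ustat (F l)) = 1"
  defines "Y \<equiv> \<lambda>x. \<Sum>l\<in>UNIV. u l * Ustat (F l) x"
  defines "q \<equiv> \<Sum>k\<in>UNIV. \<Sum>l\<in>UNIV. u k * u l * ip (Ustat (F k)) (Ustat (F l))"
  shows "\<bar>expectation (\<lambda>x. \<psi> (Y x)) - exp (- q / 2) * \<psi> 0\<bar> \<le>
    (\<Sum>k\<in>UNIV. \<bar>u k\<bar> * stein_error p (\<lambda>k l. low_energy (F k) (F l)) (\<lambda>k. fourth_sum (F k)) u \<eta> k)"
proof -
  define R where "R v = stein_error p (\<lambda>k l. low_energy (F k) (F l)) (\<lambda>k. fourth_sum (F k)) v \<eta>" for v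
  let ?\<epsilon> = "\<Sum>k\<in>UNIV. \<bar>u k\<bar> * R u k"
  let ?\<phi> = "\<lambda>s. expectation (\<lambda>x. \<psi> (s * Y x))"
  let ?\<phi>' = "\<lambda>s. expectation (\<lambda>x. Y x * \<psi>' (s * Y x))"
  let ?c = "\<lambda>k l. ip (Ustat (F k)) (Ustat (F l))"
  have Y2: "Y \<in> L2 I" unfolding Y_def by (intro Lp_sum Lp_cmult Ustat_L2[OF F]) simp
  have fourth_sum_nn: "fourth_sum (F k) \<ge> 0" for k unfolding fourth_sum_def by (intro sum_nonneg Bochner_Integration.integral_nonneg) simp
  have low_energy_nn: "low_energy (F k) (F l) \<ge> 0" for k l by (rule low_energy_nonneg[OF F F]) (use pos[of k] in simp)
  have q: "q = ip Y Y"
    unfolding q_def Y_def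
    by (subst ip_sum_sum[of _ _ I _ _ I]) (auto intro: Lp_cmult Ustat_L2[OF F] simp: ac_simps)
  have q0: "q \<ge> 0" unfolding q by (rule ip_self_nonneg)
  \<comment> \<open>The Gaussian solution of \<open>\<phi>' = - s q \<phi>\<close> is \<open>exp (- s\<^sup>2 q / 2)\<close>, hence the integrating factor in \<open>?h\<close>.\<close>
  have main: "\<bar>?\<phi>' s + s * q * ?\<phi> s\<bar> \<le> ?\<epsilon>" if s: "0 \<le> s" "s \<le> 1" for s
  proof -
    have sY: "(\<Sum>l\<in>UNIV. s * u l * Ustat (F l) x) = s * Y x" for x
      unfolding Y_def sum_distrib_left by (simp add: mult.assoc)
    have p'2: "(\<lambda>x. \<psi>' (s * Y x)) \<in> L2 I"
      by (rule bounded_L2) (use bounded_comp[OF \<psi>(2) Lp_cmult[OF Y2]] in auto)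
    have k1: "\<bar>expectation (\<lambda>x. Ustat (F k) x * \<psi>' (s * Y x)) + s * (\<Sum>l\<in>UNIV. u l * ?c k l) * ?\<phi> s\<bar> \<le> R u k" for k
    proof -
      let ?t = "expectation (\<lambda>x. Ustat (F k) x * \<psi>' (s * Y x)) + s * (\<Sum>l\<in>UNIV. u l * ?c k l) * ?\<phi> s"
      have "\<bar>2 * real (p k) * expectation (\<lambda>x. Ustat (F k) x * \<psi>' (s * Y x))
         - 2 * real (p k) * (\<Sum>l\<in>UNIV. s * u l * ?c k l) * expectation (\<lambda>x. - \<psi> (s * Y x))\<bar> \<le> R (\<lambda>l. s * u l) k"
        using stein_bound[where F = F and p = p and u = "\<lambda>l. s * u l" and k = k, OF F pos \<psi>(2) \<eta> unit] unfolding sY R_def .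
      moreover have "2 * real (p k) * expectation (\<lambda>x. Ustat (F k) x * \<psi>' (s * Y x))
         - 2 * real (p k) * (\<Sum>l\<in>UNIV. s * u l * ?c k l) * expectation (\<lambda>x. - \<psi> (s * Y x)) = 2 * real (p k) * ?t"
        by (simp add: sum_distrib_left distrib_left mult.assoc)
      moreover have "1 * \<bar>?t\<bar> \<le> 2 * real (p k) * \<bar>?t\<bar>" using pos[of k] by (intro mult_right_mono) auto
      ultimately have "\<bar>?t\<bar> \<le> R (\<lambda>l. s * u l) k" by (simp add: abs_mult)
      also have "\<dots> \<le> R u k"
      proof -
        have a: "\<bar>s * u l\<bar> \<le> \<bar>u l\<bar>" for l using s by (simp add: abs_mult mult_left_le_one_le)
        then have b: "(s * u l)\<^sup>2 \<le> (u l)\<^sup>2" for l by (simp add: abs_le_square_iff)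
        show ?thesis unfolding R_def stein_error_def
          by (intro add_mono sum_mono mult_right_mono a mult_left_mono b mult_nonneg_nonneg add_nonneg_nonneg
              divide_nonneg_nonneg sum_nonneg fourth_sum_nn real_sqrt_ge_zero low_energy_nn)
            (use \<eta> in auto)
      qed
      finally show ?thesis .
    qed
    have "?\<phi>' s = (\<Sum>k\<in>UNIV. u k * expectation (\<lambda>x. Ustat (F k) x * \<psi>' (s * Y x)))"
    proof -
      have "?\<phi>' s = (\<Sum>k\<in>UNIV. ip (\<lambda>x. u k * Ustat (F k) x) (\<lambda>x. \<psi>' (s * Y x)))"
        by (subst (1) Y_def) (rule ip_sum_left[OF Lp_cmult[OF Ustat_L2[OF F]] p'2])
      then show ?thesis by (simp add: mult.assoc)
    qed
    moreover have "s * q * ?\<phi> s = (\<Sum>k\<in>UNIV. u k * (s * (\<Sum>l\<in>UNIV. u l * ?c k l) * ?\<phi> s))"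
      unfolding q_def by (simp add: sum_distrib_left sum_distrib_right ac_simps)
    ultimately have "?\<phi>' s + s * q * ?\<phi> s = (\<Sum>k\<in>UNIV. u k * (expectation (\<lambda>x. Ustat (F k) x * \<psi>' (s * Y x)) + s * (\<Sum>l\<in>UNIV. u l * ?c k l) * ?\<phi> s))"
      by (simp only: sum.distrib distrib_left)
    also have "\<bar>\<dots>\<bar> \<le> ?\<epsilon>"
      by (rule order_trans[OF sum_abs], rule sum_mono, unfold abs_mult[of "u _"]) (intro mult_left_mono k1 abs_ge_zero)
    finally show ?thesis .
  qed
  have eps0: "?\<epsilon> \<ge> 0" using main[of 0] by (meson abs_ge_zero order_trans order_refl zero_le_one)
  let ?h = "\<lambda>s. exp (s\<^sup>2 * q / 2) * ?\<phi> s"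
  have "(?h has_real_derivative exp (s\<^sup>2 * q / 2) * (?\<phi>' s + s * q * ?\<phi> s)) (at s)" for s
    by (rule derivative_eq_intros deriv_expectation[OF Y2 \<psi>(1)] refl | simp add: field_simps)+
  then obtain z where z: "0 < z" "z < 1" "?h 1 - ?h 0 = (1 - 0) * (exp (z\<^sup>2 * q / 2) * (?\<phi>' z + z * q * ?\<phi> z))"
    using MVT2[of 0 1 ?h "\<lambda>s. exp (s\<^sup>2 * q / 2) * (?\<phi>' s + s * q * ?\<phi> s)"] by auto
  have "\<bar>?h 1 - ?h 0\<bar> = exp (z\<^sup>2 * q / 2) * \<bar>?\<phi>' z + z * q * ?\<phi> z\<bar>"
    unfolding z(3) by (simp add: abs_mult)
  also have "\<dots> \<le> exp (q / 2) * ?\<epsilon>"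
  proof (rule mult_mono)
    have "z\<^sup>2 \<le> 1" using z by (simp add: power_le_one)
    then have "z\<^sup>2 * q \<le> 1 * q" using q0 by (rule mult_right_mono)
    then show "exp (z\<^sup>2 * q / 2) \<le> exp (q / 2)" by simp
  qed (use main[of z] z eps0 in auto)
  finally have hb: "\<bar>?h 1 - ?h 0\<bar> \<le> exp (q / 2) * ?\<epsilon>" .
  have "expectation (\<lambda>x. \<psi> (Y x)) - exp (- q / 2) * \<psi> 0 = exp (- q / 2) * (?h 1 - ?h 0)"
    by (simp add: right_diff_distrib mult.assoc[symmetric] exp_add[symmetric] prob_space)
  then have "\<bar>expectation (\<lambda>x. \<psi> (Y x)) - exp (- q / 2) * \<psi> 0\<bar> = exp (- q / 2) * \<bar>?h 1 - ?h 0\<bar>"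
    by (simp add: abs_mult)
  also have "\<dots> \<le> exp (- q / 2) * (exp (q / 2) * ?\<epsilon>)" by (rule mult_left_mono[OF hb]) simp
  also have "\<dots> = ?\<epsilon>" by (simp add: mult.assoc[symmetric] exp_add[symmetric])
  finally show ?thesis unfolding R_def .
qed

section \<open>Kernels from a given Hoeffding decomposition\<close>

text \<open>The almost sure uniqueness of the Hoeffding decomposition: conditioning on \<open>\<F>\<^sub>K\<close> leaves the components
  with \<open>L \<subseteq> K\<close>, and Moebius inversion recovers them from \<open>T\<close>.\<close>

lemma hoeffding_component:
  assumes H: "hoeffding_decomposition M E X n T H" and I: "I = {1..n}" and T: "T \<in> L2 I" and J: "J \<subseteq> I"
  shows "AE x in M. H J x = hcomp T J x"
proof -
  have sig: "gen_sigma M E X K = sig K" if "K \<subseteq> I" for K using that by (simp add: sig_def Int_absorb2)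
  have H_int: "integrable M (H K)" and H_gen: "H K \<in> borel_measurable (gen_sigma M E X K)" if "K \<subseteq> I" for K
    using H that unfolding hoeffding_decomposition_def I[symmetric] by blast+
  have H_sum: "AE x in M. T x = (\<Sum>J\<in>Pow I. H J x)"
    using H unfolding hoeffding_decomposition_def I[symmetric] by blast
  have H_ce: "AE x in M. real_cond_exp M (gen_sigma M E X K) (H J) x = 0" if "J \<subseteq> I" "K \<subseteq> I" "\<not> J \<subseteq> K" for J K
    using H that unfolding hoeffding_decomposition_def I[symmetric] by blast
  have Hi: "integrable M (H K)" "H K \<in> borel_measurable (sig K)" if "K \<subseteq> I" for K
    using H_int[OF that] H_gen[OF that] sig[OF that] by simp_all
  have ce: "AE x in M. CE K T x = (\<Sum>L\<in>Pow K. H L x)" if K: "K \<subseteq> I" for K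
  proof -
    have Hm: "H L \<in> borel_measurable M" if "L \<subseteq> I" for L using Hi(2)[OF that] by (rule measurable_sig)
    have "AE x in M. CE K T x = CE K (\<lambda>x. \<Sum>J\<in>Pow I. H J x) x"
      by (intro ce.real_cond_exp_cong[OF H_sum] Lp_meas[OF T] borel_measurable_sum) (auto intro: Hm)
    moreover have "AE x in M. CE K (\<lambda>x. \<Sum>J\<in>Pow I. H J x) x = (\<Sum>J\<in>Pow I. CE K (H J) x)"
    proof -
      define H' where "H' J = (if J \<subseteq> I then H J else (\<lambda>_. 0))" for J
      have "AE x in M. CE K (\<lambda>x. \<Sum>J\<in>Pow I. H' J x) x = (\<Sum>J\<in>Pow I. CE K (H' J) x)"
        by (rule ce.real_cond_exp_sum) (auto simp: H'_def Hi)
      moreover have "(\<Sum>J\<in>Pow I. H' J x) = (\<Sum>J\<in>Pow I. H J x)" "(\<Sum>J\<in>Pow I. CE K (H' J) x) = (\<Sum>J\<in>Pow I. CE K (H J) x)" for x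
        by (auto simp: H'_def)
      ultimately show ?thesis by simp
    qed
    moreover have "AE x in M. \<forall>J\<in>Pow I. CE K (H J) x = (if J \<subseteq> K then H J x else 0)"
    proof (rule AE_finite_allI)
      show "finite (Pow I)" using finite_index by simp
      fix J assume "J \<in> Pow I"
      then have J: "J \<subseteq> I" by simp
      show "AE x in M. CE K (H J) x = (if J \<subseteq> K then H J x else 0)"
      proof (cases "J \<subseteq> K")
        case True
        have "H J \<in> borel_measurable (sig K)" by (rule measurable_sig_mono[OF Hi(2)[OF J]]) (use True in auto)
        then show ?thesis using True ce.real_cond_exp_F_meas[OF Hi(1)[OF J]] by auto
      next
        case False
        then show ?thesis using H_ce[OF J K False] sig[OF K] by simp
      qed
    qed
    ultimately show ?thesis
    proof eventually_elim
      case (elim x)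
      have "CE K T x = (\<Sum>J\<in>Pow I. if J \<subseteq> K then H J x else 0)" using elim by simp
      also have "\<dots> = (\<Sum>J\<in>Pow K. H J x)"
        using K finite_index by (intro sum.mono_neutral_cong_right) auto
      finally show ?case .
    qed
  qed
  have "AE x in M. \<forall>K\<in>Pow I. CE K T x = (\<Sum>L\<in>Pow K. H L x)"
    using ce finite_index by (intro AE_finite_allI) auto
  then show ?thesis
  proof eventually_elim
    case (elim x)
    define f where "f S = (if S \<subseteq> I then H S x else 0)" for S
    have g: "CE S T x = sum f (Pow S)" if "finite S" for S
    proof -
      have "sig S = sig (S \<inter> I)" by (simp add: sig_def)
      then have "CE S T x = (\<Sum>L\<in>Pow (S \<inter> I). H L x)" using elim by simp
      also have "\<dots> = sum f (Pow S)"
        unfolding f_def using that by (intro sum.mono_neutral_cong_left) auto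
      finally show ?thesis .
    qed
    have finJ: "finite J" using J finite_index finite_subset by blast
    have "H J x = f J" using J by (simp add: f_def)
    also have "\<dots> = (\<Sum>L\<in>Pow J. (-1) ^ (card J - card L) * CE L T x)"
      by (rule inclusion_exclusion_mobius[OF g finJ])
    also have "\<dots> = (\<Sum>L\<in>Pow J. (-1) ^ card J * ((-1) ^ card L * CE L T x))"
    proof (rule sum.cong[OF refl])
      fix L assume "L \<in> Pow J"
      then have "card L \<le> card J" using finJ by (auto intro: card_mono)
      then have "(-1) ^ (card J - card L) = ((-1) ^ card J * (-1) ^ card L :: real)"
        by (metis neg_one_power_add_eq_neg_one_power_diff power_add)
      then show "(-1) ^ (card J - card L) * CE L T x = (-1) ^ card J * ((-1) ^ card L * CE L T x)" by simp
    qed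
    also have "\<dots> = hcomp T J x" by (simp add: hcomp_def sum_distrib_left)
    finally show ?case .
  qed
qed

lemma Lp_cong_AE:
  assumes "f \<in> Lp k J" "g \<in> borel_measurable (sig J)" "AE x in M. g x = f x"
  shows "g \<in> Lp k J"
proof (rule LpI[OF assms(2)])
  have "integrable M (\<lambda>x. g x ^ k) = integrable M (\<lambda>x. f x ^ k)"
    by (rule integrable_cong_AE)
      (use measurable_sig[OF assms(2)] Lp_meas[OF assms(1)] assms(3) in auto)
  then show "integrable M (\<lambda>x. g x ^ k)" using Lp_power_integrable[OF assms(1)] by simp
qed

lemma pure_cong_AE:
  assumes "pure J f" "g \<in> borel_measurable (sig J)" "AE x in M. g x = f x"
  shows "pure J g"
  unfolding pure_def
proof (intro conjI allI impI)
  show g: "g \<in> L2 J" by (rule Lp_cong_AE[OF pure_L2[OF assms(1)] assms(2,3)])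
  fix K V assume "\<not> J \<subseteq> K" "V \<in> L2 K"
  then show "ip g V = 0"
    using ip_cong_AE[OF assms(3) Lp_meas[OF g] Lp_meas[OF pure_L2[OF assms(1)]] Lp_meas] pure_ip[OF assms(1)] by metis
qed (rule pure_subset[OF assms(1)])

text \<open>By uniqueness the given components inherit the fourth moments of \<open>T\<close>, and those of the wrong order
  vanish almost surely and may be replaced by \<open>0\<close>.\<close>

lemma degen_of_hoeffding:
  assumes H: "hoeffding_decomposition M E X n T H" and D: "degenerate_U_statistic M E X n p T"
    and I: "I = {1..n}" and int: "integrable M (\<lambda>x. T x ^ 4)" and p: "p > 0"
  defines "F \<equiv> \<lambda>J. if J \<subseteq> I \<and> card J = p then H J else (\<lambda>_. 0)"
  shows "degen p F" "AE x in M. T x = Ustat F x"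
    "j \<in> I \<Longrightarrow> influence F j = (\<Sum>J | J \<subseteq> {1..n} \<and> card J = p \<and> j \<in> J. variance (H J))"
proof -
  have sig: "gen_sigma M E X K = sig K" if "K \<subseteq> I" for K using that by (simp add: sig_def Int_absorb2)
  have "T \<in> borel_measurable (gen_sigma M E X I)"
    using H unfolding hoeffding_decomposition_def I[symmetric] by blast
  then have "T \<in> borel_measurable (sig I)" by (simp add: sig)
  then have T4: "T \<in> L4 I" using int by (rule LpI)
  have T2: "T \<in> L2 I" by (rule L4_L2[OF T4])
  obtain H' where H': "hoeffding_decomposition M E X n T H'"
    and H'0: "\<And>J. J \<subseteq> {1..n} \<Longrightarrow> card J \<noteq> p \<Longrightarrow> AE x in M. H' J x = 0"
    using D unfolding degenerate_U_statistic_def by blast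
  have Hm: "H J \<in> borel_measurable (sig J)" if "J \<subseteq> I" for J
  proof -
    have "H J \<in> borel_measurable (gen_sigma M E X J)"
      using H that unfolding hoeffding_decomposition_def I[symmetric] by blast
    then show ?thesis by (simp add: sig[OF that])
  qed
  have Hz: "AE x in M. H J x = 0" if "J \<subseteq> I" "card J \<noteq> p" for J
    using hoeffding_component[OF H I T2 that(1)] hoeffding_component[OF H' I T2 that(1)] H'0[of J] that
    unfolding I by auto
  have FL: "pure J (H J) \<and> H J \<in> L4 J" if "J \<subseteq> I" for J
    using pure_cong_AE[OF hcomp_pure[OF that T2] Hm[OF that] hoeffding_component[OF H I T2 that]]
      Lp_cong_AE[OF hcomp_L4[OF that T4] Hm[OF that] hoeffding_component[OF H I T2 that]] by blast
  show deg: "degen p F" unfolding degen_def F_def using FL by auto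
  have "AE x in M. \<forall>J\<in>Pow I. H J x = F J x"
    using Hz finite_index by (intro AE_finite_allI) (auto simp: F_def)
  moreover have "AE x in M. T x = (\<Sum>J\<in>Pow I. H J x)"
    using H unfolding hoeffding_decomposition_def I[symmetric] by blast
  ultimately show "AE x in M. T x = Ustat F x"
    unfolding Ustat_def by eventually_elim simp
  assume "j \<in> I"
  have var: "variance (H J) = sq_norm F J" if "J \<subseteq> I" "card J = p" for J
  proof -
    have "J \<noteq> {}" using that p by auto
    then have "ip (H J) (\<lambda>x. 1) = 0"
      using pure_ip[of J "H J" "{}" "\<lambda>x. 1"] FL[OF that(1)] Lp_const[of 1 2 "{}"] by auto
    then show ?thesis using that unfolding sq_norm_def F_def by (simp add: power2_eq_square)
  qed
  have "influence F j = (\<Sum>J\<in>{J. J \<subseteq> {1..n} \<and> card J = p \<and> j \<in> J}. sq_norm F J)"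
    unfolding influence_def
  proof (rule sum.mono_neutral_right)
    show "\<forall>J\<in>{J \<in> Pow I. j \<in> J} - {J. J \<subseteq> {1..n} \<and> card J = p \<and> j \<in> J}. sq_norm F J = 0"
      using sq_norm_0[OF deg] unfolding I[symmetric] by blast
  qed (use finite_index in \<open>auto simp: I\<close>)
  also have "\<dots> = (\<Sum>J | J \<subseteq> {1..n} \<and> card J = p \<and> j \<in> J. variance (H J))"
    unfolding I[symmetric] by (intro sum.cong refl var[symmetric]) auto
  finally show "influence F j = (\<Sum>J | J \<subseteq> {1..n} \<and> card J = p \<and> j \<in> J. variance (H J))" .
qed

end

section \<open>Weak convergence from trigonometric test functions\<close>

text \<open>Real trigonometric polynomials with arbitrary frequency vectors.\<close>

inductive trig :: "(real ^ 'r::finite \<Rightarrow> real) \<Rightarrow> bool" where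
  trig_cos: "trig (\<lambda>x. a * cos (u \<bullet> x))"
| trig_sin: "trig (\<lambda>x. a * sin (u \<bullet> x))"
| trig_add: "trig f \<Longrightarrow> trig g \<Longrightarrow> trig (\<lambda>x. f x + g x)"

lemma trig_const: "trig (\<lambda>x. c)"
  using trig_cos[of c 0] by simp

lemma trig_sum: "(\<And>i. i \<in> A \<Longrightarrow> trig (f i)) \<Longrightarrow> trig (\<lambda>x. \<Sum>i\<in>A. f i x)"
  by (induction A rule: infinite_finite_induct) (auto intro: trig_const trig_add)

lemma trig_cos_mult: "trig g \<Longrightarrow> trig (\<lambda>x. a * cos (u \<bullet> x) * g x)"
proof (induction rule: trig.induct)
  case (trig_cos b v)
  have "trig (\<lambda>x. a * b / 2 * cos ((u - v) \<bullet> x) + a * b / 2 * cos ((u + v) \<bullet> x))"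
    by (intro trig.intros)
  then show ?case by (simp add: inner_diff_left inner_add_left cos_add cos_diff field_simps)
next
  case (trig_sin b v)
  have "trig (\<lambda>x. a * b / 2 * sin ((u + v) \<bullet> x) + (- (a * b / 2)) * sin ((u - v) \<bullet> x))"
    by (intro trig.intros)
  then show ?case by (simp add: inner_diff_left inner_add_left sin_add sin_diff field_simps)
next
  case (trig_add f g)
  then show ?case using trig.trig_add by (simp add: distrib_left)
qed

lemma trig_sin_mult: "trig g \<Longrightarrow> trig (\<lambda>x. a * sin (u \<bullet> x) * g x)"
proof (induction rule: trig.induct)
  case (trig_cos b v)
  have "trig (\<lambda>x. a * b / 2 * sin ((u + v) \<bullet> x) + a * b / 2 * sin ((u - v) \<bullet> x))"
    by (intro trig.intros)
  then show ?case by (simp add: inner_diff_left inner_add_left sin_add sin_diff field_simps)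
next
  case (trig_sin b v)
  have "trig (\<lambda>x. a * b / 2 * cos ((u - v) \<bullet> x) + (- (a * b / 2)) * cos ((u + v) \<bullet> x))"
    by (intro trig.intros)
  then show ?case by (simp add: inner_diff_left inner_add_left cos_add cos_diff field_simps)
next
  case (trig_add f g)
  then show ?case using trig.trig_add by (simp add: distrib_left)
qed

lemma trig_mult: "trig f \<Longrightarrow> trig g \<Longrightarrow> trig (\<lambda>x. f x * g x)"
proof (induction rule: trig.induct)
  case (trig_add f h)
  then show ?case using trig.trig_add by (simp add: distrib_right)
qed (auto intro: trig_cos_mult trig_sin_mult)

lemma trig_continuous: "trig f \<Longrightarrow> continuous_on UNIV f"
  by (induction rule: trig.induct) (auto intro!: continuous_intros)

lemma trig_bounded: "trig f \<Longrightarrow> \<exists>B. \<forall>x. \<bar>f x\<bar> \<le> B"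
proof (induction rule: trig.induct)
  case (trig_cos a u)
  then show ?case by (intro exI[of _ "\<bar>a\<bar>"]) (auto simp: abs_mult mult_left_le)
next
  case (trig_sin a u)
  then show ?case by (intro exI[of _ "\<bar>a\<bar>"]) (auto simp: abs_mult mult_left_le)
next
  case (trig_add f g)
  then obtain B C where B: "\<And>x. \<bar>f x\<bar> \<le> B" and C: "\<And>x. \<bar>g x\<bar> \<le> C" by auto
  have "\<bar>f x + g x\<bar> \<le> B + C" for x using abs_triangle_ineq[of "f x" "g x"] B[of x] C[of x] by linarith
  then show ?case by blast
qed

text \<open>A real vector modulo \<open>2 pi / c\<close> in each coordinate, as a point of a compact set in Euclidean space.\<close>

definition torus :: "real \<Rightarrow> real ^ 'r::finite \<Rightarrow> (real ^ 'r) \<times> (real ^ 'r)" where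
  "torus c x = ((\<chi> k. cos (c * x $ k)), (\<chi> k. sin (c * x $ k)))"

lemma continuous_torus: "continuous_on S (torus c)"
  unfolding torus_def by (intro continuous_intros)

lemma trig_torus_polynomial:
  assumes "real_polynomial_function P"
  shows "trig (\<lambda>x :: real ^ 'r::finite. P (torus c x))"
  using assms
proof (induction rule: real_polynomial_function.induct)
  case (linear f)
  interpret bounded_linear f by fact
  have ax: "c * x $ k = (c *\<^sub>R axis k 1) \<bullet> x" for k and x :: "real ^ 'r"
    by (simp add: inner_axis')
  have "f (torus c x) = (\<Sum>k\<in>UNIV. f (axis k 1, 0) * cos ((c *\<^sub>R axis k 1) \<bullet> x)) + (\<Sum>k\<in>UNIV. f (0, axis k 1) * sin ((c *\<^sub>R axis k 1) \<bullet> x))" for x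
  proof -
    have v: "v = (\<Sum>k\<in>UNIV. v $ k *\<^sub>R axis k 1)" for v :: "real ^ 'r"
      by (simp add: basis_expansion scalar_mult_eq_scaleR[symmetric])
    have "torus c x = (\<Sum>k\<in>UNIV. cos (c * x $ k) *\<^sub>R (axis k 1, 0)) + (\<Sum>k\<in>UNIV. sin (c * x $ k) *\<^sub>R (0, axis k 1))"
      unfolding torus_def
      by (subst (1) v, subst (2) v) (simp add: sum_prod[symmetric] prod_eq_iff fst_sum snd_sum)
    then have "f (torus c x) = (\<Sum>k\<in>UNIV. cos (c * x $ k) * f (axis k 1, 0)) + (\<Sum>k\<in>UNIV. sin (c * x $ k) * f (0, axis k 1))"
      by (simp only: add sum scaleR real_scaleR_def)
    then show ?thesis unfolding ax by (simp add: mult.commute)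
  qed
  moreover have "trig (\<lambda>x. (\<Sum>k\<in>UNIV. f (axis k 1, 0) * cos ((c *\<^sub>R axis k 1) \<bullet> x)) + (\<Sum>k\<in>UNIV. f (0, axis k 1) * sin ((c *\<^sub>R axis k 1) \<bullet> x)))"
    by (intro trig_add trig_sum trig_cos trig_sin)
  ultimately show ?case by simp
qed (auto intro: trig_const trig_add trig_mult)

lemma cos_sin_eq_imp:
  fixes x y L :: real
  assumes "L > 0" "\<bar>x\<bar> \<le> L" "\<bar>y\<bar> \<le> L" "cos (pi / L * x) = cos (pi / L * y)" "sin (pi / L * x) = sin (pi / L * y)"
  shows "x = y \<or> (\<bar>x\<bar> = L \<and> \<bar>y\<bar> = L)"
proof -
  have "cos (pi / L * x - pi / L * y) = 1"
    using assms(4,5) sin_cos_squared_add3[of "pi / L * y"] by (simp add: cos_diff)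
  then obtain n :: int where n: "pi / L * x - pi / L * y = real_of_int n * 2 * pi"
    using cos_one_2pi_int by blast
  then have "pi * (x - y) = pi * (2 * L * real_of_int n)" using assms(1) by (simp add: field_simps)
  then have e: "x - y = 2 * L * real_of_int n" unfolding mult_cancel_left using pi_neq_zero by blast
  have "\<bar>x - y\<bar> \<le> 2 * L" using assms by linarith
  then have "2 * L * \<bar>real_of_int n\<bar> \<le> 2 * L * 1" unfolding e using assms(1) by (simp add: abs_mult)
  then have "\<bar>real_of_int n\<bar> \<le> 1" using assms(1) by (simp only: mult_le_cancel_left_pos)
  then have "n = 0 \<or> n = 1 \<or> n = -1" by linarith
  then show ?thesis using e assms by auto
qed

text \<open>The map identifies different points of the cube only if both lie on its boundary, which is outside the
  open ball of radius \<open>L\<close>.\<close>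

lemma torus_eq_imp:
  fixes x y :: "real ^ 'r::finite"
  assumes L: "L > 0" and x: "\<And>k. \<bar>x $ k\<bar> \<le> L" and y: "\<And>k. \<bar>y $ k\<bar> \<le> L" and eq: "torus (pi / L) x = torus (pi / L) y"
  shows "x = y \<or> (norm x \<ge> L \<and> norm y \<ge> L)"
proof (rule ccontr)
  assume *: "\<not> ?thesis"
  then obtain k where k: "x $ k \<noteq> y $ k" by (auto simp: vec_eq_iff)
  have "cos (pi / L * x $ k) = cos (pi / L * y $ k)" "sin (pi / L * x $ k) = sin (pi / L * y $ k)"
    using eq unfolding torus_def by (auto simp: vec_eq_iff)
  with cos_sin_eq_imp[OF L x y, of k k] k have "\<bar>x $ k\<bar> = L \<and> \<bar>y $ k\<bar> = L" by auto
  then show False using * component_le_norm_cart[of x k] component_le_norm_cart[of y k] by auto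
qed

lemma torus_reduce:
  fixes x :: "real ^ 'r::finite"
  assumes L: "L > 0"
  shows "\<exists>y. (\<forall>k. \<bar>y $ k\<bar> \<le> L) \<and> torus (pi / L) x = torus (pi / L) y"
proof -
  define n where "n k = round (x $ k / (2 * L))" for k
  define y where "y = (\<chi> k. x $ k - 2 * L * real_of_int (n k))"
  have "\<bar>y $ k\<bar> \<le> L" for k
  proof -
    have "\<bar>real_of_int (n k) - x $ k / (2 * L)\<bar> \<le> 1 / 2" unfolding n_def by (rule of_int_round_abs_le)
    then have "2 * L * \<bar>real_of_int (n k) - x $ k / (2 * L)\<bar> \<le> 2 * L * (1 / 2)"
      using L by (intro mult_left_mono) auto
    also have "2 * L * \<bar>real_of_int (n k) - x $ k / (2 * L)\<bar> = \<bar>2 * L * (real_of_int (n k) - x $ k / (2 * L))\<bar>"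
      using L by (simp add: abs_mult)
    also have "2 * L * (real_of_int (n k) - x $ k / (2 * L)) = - (y $ k)"
      using L by (simp add: y_def right_diff_distrib)
    finally show ?thesis by simp
  qed
  moreover have "cos (pi / L * x $ k) = cos (pi / L * y $ k)" "sin (pi / L * x $ k) = sin (pi / L * y $ k)" for k
  proof -
    have e: "pi / L * y $ k = pi / L * x $ k - 2 * pi * real_of_int (n k)"
      using L by (simp add: y_def field_simps)
    show "cos (pi / L * x $ k) = cos (pi / L * y $ k)" "sin (pi / L * x $ k) = sin (pi / L * y $ k)"
      unfolding e by (simp_all add: cos_diff sin_diff)
  qed
  ultimately show ?thesis by (intro exI[of _ y]) (simp add: torus_def vec_eq_iff)
qed

text \<open>A function that vanishes near the boundary of the cube descends to a continuous function on the
  compact image of \<open>torus\<close>, which polynomials approximate uniformly; on the torus, polynomials are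
  trigonometric polynomials. Periodicity extends the bound for \<open>h\<close> from the cube to the whole space,
  which a plain approximation on a compact set would not give.\<close>

lemma periodic_trig_approximation:
  fixes g :: "real ^ 'r::finite \<Rightarrow> real"
  assumes L: "L > 0" and g: "continuous_on UNIV g" and g0: "\<And>x. norm x \<ge> L \<Longrightarrow> g x = 0" and \<epsilon>: "\<epsilon> > 0"
    and B: "\<And>x. \<bar>g x\<bar> \<le> B"
  obtains h where "trig h" "\<And>x. norm x \<le> L \<Longrightarrow> \<bar>g x - h x\<bar> \<le> \<epsilon>" "\<And>x. \<bar>h x\<bar> \<le> B + \<epsilon>"
proof -
  define D where "D = cbox (\<chi> k. - L) (\<chi> k. L :: real ^ 'r)"
  have D: "x \<in> D \<longleftrightarrow> (\<forall>k. \<bar>x $ k\<bar> \<le> L)" for x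
    unfolding D_def mem_box_cart by (auto simp: abs_le_iff minus_le_iff)
  let ?T = "torus (pi / L) :: real ^ 'r \<Rightarrow> _"
  let ?K = "?T ` D"
  have cD: "compact D" unfolding D_def by (rule compact_cbox)
  have cK: "compact ?K" by (rule compact_continuous_image[OF continuous_torus cD])
  define \<phi> where "\<phi> z = g (SOME x. x \<in> D \<and> ?T x = z)" for z
  have \<phi>: "\<phi> (?T x) = g x" if x: "x \<in> D" for x
  proof -
    define y where "y = (SOME y. y \<in> D \<and> ?T y = ?T x)"
    have y: "y \<in> D \<and> ?T y = ?T x" unfolding y_def by (rule someI[of _ x]) (use x in simp)
    have "x = y \<or> (norm x \<ge> L \<and> norm y \<ge> L)"
      by (rule torus_eq_imp[OF L]) (use x y D in auto)
    then have "g y = g x" using g0[of x] g0[of y] by auto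
    then show ?thesis unfolding \<phi>_def y_def .
  qed
  have cont: "continuous_on ?K \<phi>"
  proof (subst continuous_on_closed_vimage[OF compact_imp_closed[OF cK]], intro allI impI)
    fix C :: "real set" assume C: "closed C"
    have "\<phi> -` C \<inter> ?K = ?T ` (D \<inter> g -` C)" using \<phi> by auto
    moreover have "closed (g -` C)"
      using g C by (simp add: continuous_closed_vimage continuous_on_eq_continuous_at)
    then have "compact (?T ` (D \<inter> g -` C))"
      using cD by (intro compact_continuous_image[OF continuous_torus] compact_Int_closed)
    ultimately show "closed (\<phi> -` C \<inter> ?K)" by (simp add: compact_imp_closed)
  qed
  obtain P where P: "real_polynomial_function P" "\<And>z. z \<in> ?K \<Longrightarrow> \<bar>\<phi> z - P z\<bar> < \<epsilon>"
    using Stone_Weierstrass_real_polynomial_function[OF cK cont \<epsilon>] by blast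
  show thesis
  proof
    show "trig (\<lambda>x. P (?T x))" by (rule trig_torus_polynomial[OF P(1)])
    show "\<bar>g x - P (?T x)\<bar> \<le> \<epsilon>" if "norm x \<le> L" for x
    proof -
      have "x \<in> D" unfolding D using that component_le_norm_cart[of x] order_trans by blast
      then show ?thesis using P(2)[of "?T x"] \<phi> by auto
    qed
    show "\<bar>P (?T x)\<bar> \<le> B + \<epsilon>" for x
    proof -
      obtain y where y: "y \<in> D" "?T x = ?T y" using torus_reduce[OF L, of x] D by auto
      then have "\<bar>g y - P (?T x)\<bar> < \<epsilon>" using P(2)[of "?T y"] \<phi>[OF y(1)] by auto
      then show ?thesis using B[of y] by linarith
    qed
  qed
qed

lemma trig_expectation_tendsto:
  fixes V :: "nat \<Rightarrow> 'a \<Rightarrow> real ^ 'r::finite" and N :: "'c \<Rightarrow> real ^ 'r"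
  assumes prob: "\<And>m. prob_space (M m)" "prob_space Q"
    and meas: "\<And>m. V m \<in> borel_measurable (M m)" "N \<in> borel_measurable Q"
    and cos: "\<And>u. (\<lambda>m. integral\<^sup>L (M m) (\<lambda>x. cos (u \<bullet> V m x))) \<longlonglongrightarrow> integral\<^sup>L Q (\<lambda>x. cos (u \<bullet> N x))"
    and sin: "\<And>u. (\<lambda>m. integral\<^sup>L (M m) (\<lambda>x. sin (u \<bullet> V m x))) \<longlonglongrightarrow> integral\<^sup>L Q (\<lambda>x. sin (u \<bullet> N x))"
    and h: "trig h"
  shows "(\<lambda>m. integral\<^sup>L (M m) (\<lambda>x. h (V m x))) \<longlonglongrightarrow> integral\<^sup>L Q (\<lambda>x. h (N x))"
  using h
proof (induction rule: trig.induct)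
  case (trig_cos a u)
  then show ?case using tendsto_mult_left[OF cos[of u], of a] by simp
next
  case (trig_sin a u)
  then show ?case using tendsto_mult_left[OF sin[of u], of a] by simp
next
  case (trig_add f g)
  have int: "integrable P (\<lambda>x. f (U x))" if P: "prob_space P" and U: "U \<in> borel_measurable P" and f: "trig f" for P :: "'d measure" and U f
  proof -
    interpret prob_space P by fact
    obtain B where "\<And>x. \<bar>f x\<bar> \<le> B" using trig_bounded[OF f] by blast
    moreover have "f \<in> borel_measurable borel" using trig_continuous[OF f] by (rule borel_measurable_continuous_onI)
    ultimately show ?thesis using U
      by (intro integrable_const_bound[of _ B]) (auto intro: measurable_compose)
  qed
  show ?case
    using tendsto_add[OF trig_add.IH]
    by (simp add: Bochner_Integration.integral_add int[OF prob(1) meas(1)] int[OF prob(2) meas(2)] trig_add.hyps)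
qed

text \<open>A substitute for the multidimensional continuity theorem: the second moments give tightness, and
  \<open>periodic_trig_approximation\<close> reduces a bounded continuous function to trigonometric polynomials.\<close>

lemma weak_convergence_from_trig:
  fixes V :: "nat \<Rightarrow> 'a \<Rightarrow> real ^ 'r::finite" and N :: "'c \<Rightarrow> real ^ 'r"
  assumes prob: "\<And>m. prob_space (M m)" "prob_space Q"
    and meas: "\<And>m. V m \<in> borel_measurable (M m)" "N \<in> borel_measurable Q"
    and int: "\<And>m k. integrable (M m) (\<lambda>x. (V m x $ k)\<^sup>2)" "\<And>k. integrable Q (\<lambda>x. (N x $ k)\<^sup>2)"
    and bnd: "\<And>m k. integral\<^sup>L (M m) (\<lambda>x. (V m x $ k)\<^sup>2) \<le> C" "\<And>k. integral\<^sup>L Q (\<lambda>x. (N x $ k)\<^sup>2) \<le> C"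
    and cos: "\<And>u. (\<lambda>m. integral\<^sup>L (M m) (\<lambda>x. cos (u \<bullet> V m x))) \<longlonglongrightarrow> integral\<^sup>L Q (\<lambda>x. cos (u \<bullet> N x))"
    and sin: "\<And>u. (\<lambda>m. integral\<^sup>L (M m) (\<lambda>x. sin (u \<bullet> V m x))) \<longlonglongrightarrow> integral\<^sup>L Q (\<lambda>x. sin (u \<bullet> N x))"
  shows "converges_in_distribution M V Q N"
  unfolding converges_in_distribution_def
proof (intro allI impI)
  fix f :: "real ^ 'r \<Rightarrow> real"
  assume f: "continuous_on UNIV f" and "bounded (range f)"
  then obtain B where B: "\<And>x. \<bar>f x\<bar> \<le> B" unfolding bounded_iff by auto
  have B0: "B \<ge> 0" using B[of 0] by linarith
  have C0: "C \<ge> 0" using bnd(2) by (meson Bochner_Integration.integral_nonneg order_trans zero_le_power2)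
  let ?r = "real CARD('r)"
  show "(\<lambda>m. integral\<^sup>L (M m) (\<lambda>x. f (V m x))) \<longlonglongrightarrow> integral\<^sup>L Q (\<lambda>x. f (N x))"
  proof (rule LIMSEQ_I)
    fix e :: real assume e: "e > 0"
    define \<epsilon> where "\<epsilon> = min 1 (e / 6)"
    have \<epsilon>: "\<epsilon> > 0" "\<epsilon> \<le> 1" "\<epsilon> \<le> e / 6" using e by (auto simp: \<epsilon>_def)
    \<comment> \<open>The radius makes the Chebyshev bound for the mass outside the ball at most \<open>e / 6\<close>.\<close>
    define R where "R = sqrt (6 * (2 * B + 1) * ?r * (C + 1) / e) + 1"
    have R: "R > 0" unfolding R_def using e B0 C0 by (intro add_nonneg_pos real_sqrt_ge_zero) auto
    have tail: "(2 * B + 1) * (?r * C) / R\<^sup>2 \<le> e / 6"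
    proof -
      have s0: "0 \<le> 6 * (2 * B + 1) * ?r * (C + 1) / e" using e B0 C0 by simp
      have "6 * (2 * B + 1) * ?r * C / e \<le> 6 * (2 * B + 1) * ?r * (C + 1) / e"
        using e B0 by (intro divide_right_mono mult_left_mono) auto
      also have "\<dots> = (sqrt (6 * (2 * B + 1) * ?r * (C + 1) / e))\<^sup>2" using s0 by simp
      also have "\<dots> \<le> R\<^sup>2" unfolding R_def using s0 by (intro power_mono) auto
      finally show ?thesis using e R by (simp add: field_simps)
    qed
    define g where "g x = f x * max 0 (min 1 (2 - norm x / R))" for x
    have gc: "continuous_on UNIV g" unfolding g_def using f R by (intro continuous_intros) auto
    have g0: "g x = 0" if "norm x \<ge> 2 * R" for x
      using that R by (simp add: g_def field_simps)
    have gf: "g x = f x" if "norm x \<le> R" for x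
      using that R by (simp add: g_def field_simps)
    have gB: "\<bar>g x\<bar> \<le> B" for x
    proof -
      have "\<bar>g x\<bar> \<le> \<bar>f x\<bar> * 1" unfolding g_def abs_mult by (intro mult_left_mono) auto
      then show ?thesis using B[of x] by simp
    qed
    obtain h where h: "trig h" "\<And>x. norm x \<le> 2 * R \<Longrightarrow> \<bar>g x - h x\<bar> \<le> \<epsilon>" "\<And>x. \<bar>h x\<bar> \<le> B + \<epsilon>"
      using periodic_trig_approximation[of "2 * R" g \<epsilon> B] gc g0 gB \<epsilon>(1) R by auto
    have fh: "\<bar>f x - h x\<bar> \<le> \<epsilon> + (2 * B + 1) / R\<^sup>2 * (norm x)\<^sup>2" for x
    proof (cases "norm x \<le> R")
      case True
      then have "\<bar>f x - h x\<bar> \<le> \<epsilon>" using h(2)[of x] gf[of x] R by auto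
      moreover have "0 \<le> (2 * B + 1) / R\<^sup>2 * (norm x)\<^sup>2" using B0 by simp
      ultimately show ?thesis by linarith
    next
      case False
      have "\<bar>f x - h x\<bar> \<le> 2 * B + 1" using B[of x] h(3)[of x] \<epsilon>(2) by linarith
      also have "\<dots> = (2 * B + 1) / R\<^sup>2 * R\<^sup>2" using R by simp
      also have "\<dots> \<le> (2 * B + 1) / R\<^sup>2 * (norm x)\<^sup>2"
        using False R B0 by (intro mult_left_mono power_mono) auto
      finally show ?thesis using \<epsilon>(1) by linarith
    qed
    have close: "\<bar>integral\<^sup>L P (\<lambda>x. f (U x)) - integral\<^sup>L P (\<lambda>x. h (U x))\<bar> \<le> e / 3"
      if P: "prob_space P" and U: "U \<in> borel_measurable P" and i: "\<And>k. integrable P (\<lambda>x. (U x $ k)\<^sup>2)"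
        and b: "\<And>k. integral\<^sup>L P (\<lambda>x. (U x $ k)\<^sup>2) \<le> C" for P :: "'d measure" and U
    proof -
      interpret prob_space P by (rule P)
      have fm: "f \<in> borel_measurable borel" and hm: "h \<in> borel_measurable borel"
        using f trig_continuous[OF h(1)] by (auto intro: borel_measurable_continuous_onI)
      have if': "integrable P (\<lambda>x. f (U x))"
        using measurable_compose[OF U fm] B by (intro integrable_const_bound[of _ B]) auto
      have ih: "integrable P (\<lambda>x. h (U x))"
        using measurable_compose[OF U hm] h(3) by (intro integrable_const_bound[of _ "B + \<epsilon>"]) auto
      have sq_norm: "(norm x)\<^sup>2 = (\<Sum>k\<in>UNIV. (x $ k)\<^sup>2)" for x :: "real ^ 'r"
        unfolding norm_vec_def L2_set_def by (simp add: sum_nonneg)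
      have inorm: "integrable P (\<lambda>x. (norm (U x))\<^sup>2)" unfolding sq_norm using i by simp
      have "\<bar>integral\<^sup>L P (\<lambda>x. f (U x)) - integral\<^sup>L P (\<lambda>x. h (U x))\<bar> = \<bar>integral\<^sup>L P (\<lambda>x. f (U x) - h (U x))\<bar>"
        using if' ih by simp
      also have "\<dots> \<le> integral\<^sup>L P (\<lambda>x. \<bar>f (U x) - h (U x)\<bar>)" by (rule integral_abs_bound)
      also have "\<dots> \<le> integral\<^sup>L P (\<lambda>x. \<epsilon> + (2 * B + 1) / R\<^sup>2 * (norm (U x))\<^sup>2)"
        using if' ih inorm fh by (intro integral_mono) auto
      also have "\<dots> = \<epsilon> + (2 * B + 1) / R\<^sup>2 * integral\<^sup>L P (\<lambda>x. (norm (U x))\<^sup>2)"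
        using inorm by (simp add: prob_space)
      also have "\<dots> \<le> \<epsilon> + (2 * B + 1) / R\<^sup>2 * (?r * C)"
      proof (intro add_left_mono mult_left_mono)
        have "integral\<^sup>L P (\<lambda>x. (norm (U x))\<^sup>2) = (\<Sum>k\<in>UNIV. integral\<^sup>L P (\<lambda>x. (U x $ k)\<^sup>2))"
          unfolding sq_norm using i by simp
        also have "\<dots> \<le> (\<Sum>k\<in>(UNIV :: 'r set). C)" by (intro sum_mono b)
        finally show "integral\<^sup>L P (\<lambda>x. (norm (U x))\<^sup>2) \<le> ?r * C" by simp
      qed (use B0 in simp)
      also have "\<epsilon> + (2 * B + 1) / R\<^sup>2 * (?r * C) \<le> e / 6 + e / 6"
        by (rule add_mono[OF \<epsilon>(3)]) (use tail in \<open>simp only: times_divide_eq_left\<close>)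
      finally show ?thesis by simp
    qed
    have "(\<lambda>m. integral\<^sup>L (M m) (\<lambda>x. h (V m x))) \<longlonglongrightarrow> integral\<^sup>L Q (\<lambda>x. h (N x))"
      by (rule trig_expectation_tendsto[OF prob meas cos sin h(1)])
    from LIMSEQ_D[OF this, of "e / 3"] e obtain m0 where
      m0: "\<And>m. m \<ge> m0 \<Longrightarrow> \<bar>integral\<^sup>L (M m) (\<lambda>x. h (V m x)) - integral\<^sup>L Q (\<lambda>x. h (N x))\<bar> < e / 3"
      by auto
    have "\<bar>integral\<^sup>L (M m) (\<lambda>x. f (V m x)) - integral\<^sup>L Q (\<lambda>x. f (N x))\<bar> < e" if "m \<ge> m0" for m
      using m0[OF that] close[OF prob(1)[of m] meas(1) int(1) bnd(1)] close[OF prob(2) meas(2) int(2) bnd(2)]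
      by linarith
    then show "\<exists>no. \<forall>m\<ge>no. norm (integral\<^sup>L (M m) (\<lambda>x. f (V m x)) - integral\<^sup>L Q (\<lambda>x. f (N x))) < e"
      by auto
  qed
qed

section \<open>Moments of Gaussian vectors\<close>

text \<open>Almost surely constant variables count as Gaussian and are treated separately.\<close>

lemma gaussian_rv_moments:
  assumes "prob_space P" and G: "gaussian_rv P Y" and mean: "integral\<^sup>L P Y = 0"
  shows "integrable P (\<lambda>x. Y x ^ k)"
    and "integral\<^sup>L P (\<lambda>x. Y x ^ 4) = 3 * (integral\<^sup>L P (\<lambda>x. Y x ^ 2))\<^sup>2"
    and "integral\<^sup>L P (\<lambda>x. cos (Y x)) = exp (- integral\<^sup>L P (\<lambda>x. Y x ^ 2) / 2)"
    and "integral\<^sup>L P (\<lambda>x. sin (Y x)) = 0"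
proof -
  interpret prob_space P by fact
  have "integrable P (\<lambda>x. Y x ^ k) \<and> integral\<^sup>L P (\<lambda>x. Y x ^ 4) = 3 * (integral\<^sup>L P (\<lambda>x. Y x ^ 2))\<^sup>2 \<and>
    integral\<^sup>L P (\<lambda>x. cos (Y x)) = exp (- integral\<^sup>L P (\<lambda>x. Y x ^ 2) / 2) \<and> integral\<^sup>L P (\<lambda>x. sin (Y x)) = 0"
    using G unfolding gaussian_rv_def
  proof (elim disjE exE conjE)
    fix c assume Y: "Y \<in> borel_measurable P" "AE x in P. Y x = c"
    have "integral\<^sup>L P Y = integral\<^sup>L P (\<lambda>x. c)" using Y by (intro integral_cong_AE) auto
    then have "c = 0" using mean by (simp add: prob_space)
    then have ae: "AE x in P. Y x = 0" using Y by simp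
    have e: "integral\<^sup>L P (\<lambda>x. h (Y x)) = h 0" if "h \<in> borel_measurable borel" for h :: "real \<Rightarrow> real"
    proof -
      have "integral\<^sup>L P (\<lambda>x. h (Y x)) = integral\<^sup>L P (\<lambda>x. h 0)"
        using ae measurable_compose[OF Y(1) that] by (intro integral_cong_AE) auto
      then show ?thesis by (simp add: prob_space)
    qed
    have "integrable P (\<lambda>x. Y x ^ k) \<longleftrightarrow> integrable P (\<lambda>x. 0 ^ k :: real)"
      using ae Y(1) by (intro integrable_cong_AE) auto
    then show ?thesis using e[of "\<lambda>x. x ^ 4"] e[of "\<lambda>x. x ^ 2"] e[of cos] e[of sin] by simp
  next
    fix \<mu> \<sigma> :: real assume \<sigma>: "0 < \<sigma>" and D: "distributed P lborel Y (\<lambda>x. ennreal (normal_density \<mu> \<sigma> x))"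
    have "\<mu> = 0" using normal_distributed_expectation[OF \<sigma> D] mean by simp
    note D = D[unfolded this]
    have int: "integrable P (\<lambda>x. Y x ^ k)" for k
      using distributed_integrable[OF D, of "\<lambda>x. x ^ k"] integrable_normal_moment[OF \<sigma>, of 0 k] by simp
    have mom: "integral\<^sup>L P (\<lambda>x. Y x ^ (2 * k)) = fact (2 * k) / ((2 / \<sigma>\<^sup>2)^k * fact k)" for k
      using distributed_integral[OF D, of "\<lambda>x. x ^ (2 * k)"] integral_normal_moment_even[OF \<sigma>, of 0 k] by simp
    have m2: "integral\<^sup>L P (\<lambda>x. Y x ^ 2) = \<sigma>\<^sup>2" using mom[of 1] by (simp add: numeral_2_eq_2)
    have m4: "integral\<^sup>L P (\<lambda>x. Y x ^ 4) = 3 * \<sigma> ^ 4"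
      using mom[of 2] \<sigma> by (simp add: fact_numeral power_divide power2_eq_square power4_eq_xxxx)
    have std: "distributed P lborel (\<lambda>x. Y x / \<sigma>) std_normal_density"
      using normal_standard_normal_convert[OF \<sigma>, of Y 0] D by simp
    have Zm: "(\<lambda>x. Y x / \<sigma>) \<in> borel_measurable P" using distributed_measurable[OF std] by simp
    have "distr P borel (\<lambda>x. Y x / \<sigma>) = std_normal_distribution"
      using distributed_distr_eq_density[OF std] distr_cong[of P P borel lborel "\<lambda>x. Y x / \<sigma>" "\<lambda>x. Y x / \<sigma>"] by simp
    then have "char std_normal_distribution \<sigma> = char (distr P borel (\<lambda>x. Y x / \<sigma>)) \<sigma>"
      by (simp only:)
    also have "\<dots> = integral\<^sup>L P (\<lambda>x. iexp (\<sigma> * (Y x / \<sigma>)))"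
      unfolding char_def by (rule integral_distr[OF Zm]) simp
    finally have "char std_normal_distribution \<sigma> = integral\<^sup>L P (\<lambda>x. iexp (\<sigma> * (Y x / \<sigma>)))" .
    then have ch: "integral\<^sup>L P (\<lambda>x. iexp (Y x)) = complex_of_real (exp (- (\<sigma>\<^sup>2) / 2))"
      unfolding char_std_normal_distribution using \<sigma> by simp
    have Ym: "Y \<in> borel_measurable P" using distributed_measurable[OF D] by simp
    have ii: "integrable P (\<lambda>x. iexp (Y x))" using Ym by (intro integrable_iexp) auto
    have "integral\<^sup>L P (\<lambda>x. cos (Y x)) = Re (integral\<^sup>L P (\<lambda>x. iexp (Y x)))"
      by (subst integral_Re[OF ii, symmetric]) (simp add: Re_exp)
    moreover have "integral\<^sup>L P (\<lambda>x. sin (Y x)) = Im (integral\<^sup>L P (\<lambda>x. iexp (Y x)))"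
      by (subst integral_Im[OF ii, symmetric]) (simp add: Im_exp)
    ultimately show ?thesis using int m2 m4 unfolding ch by simp
  qed
  then show "integrable P (\<lambda>x. Y x ^ k)"
    "integral\<^sup>L P (\<lambda>x. Y x ^ 4) = 3 * (integral\<^sup>L P (\<lambda>x. Y x ^ 2))\<^sup>2"
    "integral\<^sup>L P (\<lambda>x. cos (Y x)) = exp (- integral\<^sup>L P (\<lambda>x. Y x ^ 2) / 2)"
    "integral\<^sup>L P (\<lambda>x. sin (Y x)) = 0" by auto
qed

lemma centered_gaussian_facts:
  fixes N :: "'c \<Rightarrow> real ^ 'r::finite"
  assumes Q: "prob_space Q" and G: "centered_gaussian_vector Q N S"
  shows "N \<in> borel_measurable Q" and "integrable Q (\<lambda>x. (N x $ k)\<^sup>2)"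
    and "integral\<^sup>L Q (\<lambda>x. N x $ j * N x $ k) = S $ j $ k"
    and "integral\<^sup>L Q (\<lambda>x. cos (u \<bullet> N x)) = exp (- (\<Sum>j\<in>UNIV. \<Sum>k\<in>UNIV. u $ j * u $ k * S $ j $ k) / 2)"
    and "integral\<^sup>L Q (\<lambda>x. sin (u \<bullet> N x)) = 0"
    and "j \<noteq> k \<Longrightarrow> S $ j $ j = 1 \<Longrightarrow> S $ k $ k = 1 \<Longrightarrow>
      integral\<^sup>L Q (\<lambda>x. (N x $ j)\<^sup>2 * (N x $ k)\<^sup>2) = 1 + 2 * (S $ j $ k)\<^sup>2"
proof -
  interpret prob_space Q by fact
  have gv: "gaussian_rv Q (\<lambda>x. u \<bullet> N x)" and c0: "expectation (\<lambda>x. N x $ k) = 0" and cov: "covariance_matrix Q N = S" for u k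
    using G by (auto simp: centered_gaussian_vector_def gaussian_vector_def)
  show meas: "N \<in> borel_measurable Q" using G by (simp add: centered_gaussian_vector_def gaussian_vector_def)
  have ax: "axis k 1 \<bullet> N x = N x $ k" for k x by (simp add: inner_axis')
  have gk: "gaussian_rv Q (\<lambda>x. N x $ k)" for k using gv[of "axis k 1"] by (simp add: ax)
  note mk = gaussian_rv_moments[OF Q gk c0]
  have ik: "integrable Q (\<lambda>x. N x $ k)" for k using mk(1)[of k 1] by simp
  show ik2: "integrable Q (\<lambda>x. (N x $ k)\<^sup>2)" for k using mk(1)[of k 2] by simp
  have Nm: "(\<lambda>x. N x $ k) \<in> borel_measurable Q" for k using ik by (rule borel_measurable_integrable)
  have ijk: "integrable Q (\<lambda>x. N x $ j * N x $ k)" for j k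
  proof (rule Bochner_Integration.integrable_bound)
    show "integrable Q (\<lambda>x. (N x $ j)\<^sup>2 + (N x $ k)\<^sup>2)" using ik2 by simp
    show "AE x in Q. norm (N x $ j * N x $ k) \<le> norm ((N x $ j)\<^sup>2 + (N x $ k)\<^sup>2)"
    proof (rule AE_I2)
      fix x
      have "2 * (\<bar>N x $ j\<bar> * \<bar>N x $ k\<bar>) \<le> (N x $ j)\<^sup>2 + (N x $ k)\<^sup>2"
        using sum_squares_bound[of "\<bar>N x $ j\<bar>" "\<bar>N x $ k\<bar>"] by (simp add: mult.assoc)
      moreover have "0 \<le> \<bar>N x $ j\<bar> * \<bar>N x $ k\<bar>" by simp
      ultimately show "norm (N x $ j * N x $ k) \<le> norm ((N x $ j)\<^sup>2 + (N x $ k)\<^sup>2)"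
        unfolding real_norm_def abs_mult by linarith
    qed
  qed (use Nm in measurable)
  show S: "expectation (\<lambda>x. N x $ j * N x $ k) = S $ j $ k" for j k
    using arg_cong[OF cov, of "\<lambda>A. A $ j $ k"] unfolding covariance_matrix_def by (simp add: c0)
  have uN: "u \<bullet> N x = (\<Sum>k\<in>UNIV. u $ k * N x $ k)" for u x by (simp add: inner_vec_def)
  have mean: "expectation (\<lambda>x. u \<bullet> N x) = 0" for u unfolding uN using ik c0 by simp
  have var: "expectation (\<lambda>x. (u \<bullet> N x) ^ 2) = (\<Sum>j\<in>UNIV. \<Sum>k\<in>UNIV. u $ j * u $ k * S $ j $ k)" for u
  proof -
    have "expectation (\<lambda>x. (u \<bullet> N x) ^ 2) = expectation (\<lambda>x. \<Sum>j\<in>UNIV. \<Sum>k\<in>UNIV. u $ j * u $ k * (N x $ j * N x $ k))"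
      unfolding uN power2_eq_square sum_product by (simp add: ac_simps)
    also have "\<dots> = (\<Sum>j\<in>UNIV. \<Sum>k\<in>UNIV. u $ j * u $ k * S $ j $ k)"
      using ijk S by simp
    finally show ?thesis .
  qed
  note mu = gaussian_rv_moments[OF Q gv mean]
  show "expectation (\<lambda>x. cos (u \<bullet> N x)) = exp (- (\<Sum>j\<in>UNIV. \<Sum>k\<in>UNIV. u $ j * u $ k * S $ j $ k) / 2)"
    using mu(3)[of u] var[of u] by simp
  show "expectation (\<lambda>x. sin (u \<bullet> N x)) = 0" by (rule mu(4))
  assume jk: "j \<noteq> k" and Sj: "S $ j $ j = 1" and Sk: "S $ k $ k = 1"
  have Sym: "S $ k $ j = S $ j $ k" using S[of k j] S[of j k] by (simp add: mult.commute)
  let ?a = "\<lambda>x. N x $ j" and ?b = "\<lambda>x. N x $ k" and ?s = "S $ j $ k"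
  have pm: "(axis j 1 + axis k 1) \<bullet> N x = ?a x + ?b x" "(axis j 1 - axis k 1) \<bullet> N x = ?a x - ?b x" for x
    by (simp_all add: inner_add_left inner_diff_left ax)
  note plus = mu[of "axis j 1 + axis k 1", unfolded pm] and minus = mu[of "axis j 1 - axis k 1", unfolded pm]
  have sq: "(\<lambda>x. (?a x + ?b x)\<^sup>2) = (\<lambda>x. ?a x * ?a x + 2 * (?a x * ?b x) + ?b x * ?b x)"
    "(\<lambda>x. (?a x - ?b x)\<^sup>2) = (\<lambda>x. ?a x * ?a x - 2 * (?a x * ?b x) + ?b x * ?b x)"
    by (auto simp: power2_eq_square algebra_simps)
  have v1: "expectation (\<lambda>x. (?a x + ?b x)\<^sup>2) = 2 + 2 * ?s" and v2: "expectation (\<lambda>x. (?a x - ?b x)\<^sup>2) = 2 - 2 * ?s"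
    unfolding sq using ijk S Sj Sk by simp_all
  have p4: "expectation (\<lambda>x. (?a x + ?b x) ^ 4) = 3 * (2 + 2 * ?s)\<^sup>2" "expectation (\<lambda>x. (?a x - ?b x) ^ 4) = 3 * (2 - 2 * ?s)\<^sup>2"
    using plus(2) minus(2) v1 v2 by simp_all
  have a4: "expectation (\<lambda>x. ?a x ^ 4) = 3" and b4: "expectation (\<lambda>x. ?b x ^ 4) = 3"
    using mk(2)[of j] mk(2)[of k] S[of j j] S[of k k] Sj Sk by (simp_all add: power2_eq_square)
  \<comment> \<open>Polarization turns the mixed moment into fourth moments of Gaussian variables.\<close>
  have pointwise: "(\<lambda>x. ?a x ^ 2 * ?b x ^ 2) = (\<lambda>x. ((?a x + ?b x) ^ 4 + (?a x - ?b x) ^ 4 - 2 * ?a x ^ 4 - 2 * ?b x ^ 4) / 12)"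
    by (rule ext) (simp add: power2_eq_square power4_eq_xxxx algebra_simps)
  show "expectation (\<lambda>x. ?a x ^ 2 * ?b x ^ 2) = 1 + 2 * ?s\<^sup>2"
    unfolding pointwise using plus(1)[of 4] minus(1)[of 4] mk(1)[of j 4] mk(1)[of k 4]
    by (simp add: p4 a4 b4 power2_eq_square algebra_simps)
qed

section \<open>The limit theorem\<close>

lemma borel_measurable_vecI:
  fixes W :: "'a \<Rightarrow> real ^ 'r::finite"
  assumes "\<And>k. (\<lambda>x. W x $ k) \<in> borel_measurable M"
  shows "W \<in> borel_measurable M"
  by (subst borel_measurable_euclidean_space)
    (auto simp: Basis_vec_def inner_axis assms)

text \<open>The estimates for a fixed \<open>m\<close> in terms of \<open>W\<close> alone. The witnesses \<open>lo\<close> and \<open>qu\<close> are \<open>low_energy\<close> and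
  \<open>fourth_sum\<close> of the kernels; hiding them behind an existential quantifier frees the passage to the limit
  from the underlying locale. For \<open>p k > p l\<close> the second bound is used with \<open>k\<close> and \<open>l\<close> exchanged.\<close>

lemma (in indep_family) quantitative_bounds:
  fixes p :: "'r::finite \<Rightarrow> nat" and W :: "'a \<Rightarrow> real ^ 'r" and H :: "'r \<Rightarrow> nat set \<Rightarrow> 'a \<Rightarrow> real"
  assumes I: "I = {1..n}" and pos: "\<And>k. p k > 0"
    and deg: "\<And>k. degenerate_U_statistic M E X n (p k) (\<lambda>x. W x $ k)"
    and hoeff: "\<And>k. hoeffding_decomposition M E X n (\<lambda>x. W x $ k) (H k)"
    and int4: "\<And>k. integrable M (\<lambda>x. (W x $ k) ^ 4)"
    and unit: "\<And>k. expectation (\<lambda>x. (W x $ k)\<^sup>2) = 1"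
  defines "c \<equiv> \<lambda>k l. expectation (\<lambda>x. W x $ k * W x $ l)"
    and "mm \<equiv> \<lambda>k l. expectation (\<lambda>x. (W x $ k)\<^sup>2 * (W x $ l)\<^sup>2)"
    and "m4 \<equiv> \<lambda>k. expectation (\<lambda>x. (W x $ k) ^ 4)"
  shows "\<exists>lo qu. (\<forall>k l. 0 \<le> lo k l \<and> lo k l \<le> mm k l - 1 - 2 * (c k l)\<^sup>2 + (1 + 2 ^ (p k + p l)) * real (p k) * rho_sq M n (p l) (H l)) \<and>
     (\<forall>k l. p k < p l \<longrightarrow> (mm k l - 1)\<^sup>2 \<le> m4 k * lo l l) \<and>
     (\<forall>k l. p k \<noteq> p l \<longrightarrow> c k l = 0) \<and>
     (\<forall>k. 0 \<le> qu k \<and> qu k \<le> 6 * real (p k) - 2 * real (p k) * m4 k + 6 * real (p k) * sqrt (m4 k * lo k k)) \<and>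
     (\<forall>u \<eta>. \<eta> > 0 \<longrightarrow>
        \<bar>expectation (\<lambda>x. cos (u \<bullet> W x)) - exp (- (\<Sum>k\<in>UNIV. \<Sum>l\<in>UNIV. u $ k * u $ l * c k l) / 2)\<bar> \<le>
         (\<Sum>k\<in>UNIV. \<bar>u $ k\<bar> * stein_error p lo qu (\<lambda>l. u $ l) \<eta> k) \<and>
        \<bar>expectation (\<lambda>x. sin (u \<bullet> W x))\<bar> \<le>
         (\<Sum>k\<in>UNIV. \<bar>u $ k\<bar> * stein_error p lo qu (\<lambda>l. u $ l) \<eta> k))"
proof -
  define F where "F k J = (if J \<subseteq> I \<and> card J = p k then H k J else (\<lambda>_. 0))" for k J
  have F_eq: "F k = (\<lambda>J. if J \<subseteq> I \<and> card J = p k then H k J else (\<lambda>_. 0))" for k by (rule ext) (simp add: F_def)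
  note conv = degen_of_hoeffding[OF hoeff deg I int4 pos, folded F_eq]
  have F: "degen (p k) (F k)" for k by (rule conv(1))
  have WU: "AE x in M. \<forall>k\<in>UNIV. W x $ k = Ustat (F k) x"
    by (intro AE_finite_allI) (auto intro: conv(2))
  have Wm: "(\<lambda>x. W x $ k) \<in> borel_measurable M" for k
    using hoeff[of k] unfolding hoeffding_decomposition_def by (intro borel_measurable_integrable) blast
  have Um: "Ustat (F k) \<in> borel_measurable M" for k by (rule Lp_meas[OF Ustat_L2[OF F]])
  have c: "c k l = ip (Ustat (F k)) (Ustat (F l))" for k l
    unfolding c_def by (rule integral_cong_AE) (use WU Wm Um in auto)
  have mm: "mm k l = expectation (\<lambda>x. (Ustat (F k) x)\<^sup>2 * (Ustat (F l) x)\<^sup>2)" for k l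
    unfolding mm_def by (rule integral_cong_AE) (use WU Wm Um in auto)
  have m4: "m4 k = expectation (\<lambda>x. Ustat (F k) x ^ 4)" for k
    unfolding m4_def by (rule integral_cong_AE) (use WU Wm Um in auto)
  have u1: "ip (Ustat (F k)) (Ustat (F k)) = 1" for k
    using unit[of k] c[of k k] unfolding c_def by (simp add: power2_eq_square)
  have uW: "u \<bullet> W x = (\<Sum>k\<in>UNIV. u $ k * W x $ k)" for u x by (simp add: inner_vec_def)
  have cosW: "expectation (\<lambda>x. cos (u \<bullet> W x)) = expectation (\<lambda>x. cos (\<Sum>l\<in>UNIV. u $ l * Ustat (F l) x))" for u
    unfolding uW by (rule integral_cong_AE) (use WU Wm Um in auto)
  have sinW: "expectation (\<lambda>x. sin (u \<bullet> W x)) = expectation (\<lambda>x. sin (\<Sum>l\<in>UNIV. u $ l * Ustat (F l) x))" for u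
    unfolding uW by (rule integral_cong_AE) (use WU Wm Um in auto)
  have infl: "influence (F k) j \<le> rho_sq M n (p k) (H k)" if "j \<in> I" for j k
    unfolding rho_sq_def conv(3)[OF that] by (rule Max_ge) (use that I in auto)
  show ?thesis
  proof (rule exI[of _ "\<lambda>k l. low_energy (F k) (F l)"], rule exI[of _ "\<lambda>k. fourth_sum (F k)"], intro conjI allI impI)
    fix k l
    show "0 \<le> low_energy (F k) (F l)" by (rule low_energy_nonneg[OF F F]) (use pos[of k] in simp)
    show "low_energy (F k) (F l) \<le> mm k l - 1 - 2 * (c k l)\<^sup>2 + (1 + 2 ^ (p k + p l)) * real (p k) * rho_sq M n (p l) (H l)"
      unfolding mm c by (rule low_energy_le[OF F F pos infl u1 u1])
    show "(mm k l - 1)\<^sup>2 \<le> m4 k * low_energy (F l) (F l)" if "p k < p l"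
      unfolding mm m4 by (rule mixed_moment_orders_differ[OF F F pos that u1 u1])
    show "c k l = 0" if "p k \<noteq> p l" unfolding c by (rule ip_degen_orders_differ[OF F F that])
    show "0 \<le> fourth_sum (F k)" unfolding fourth_sum_def by (intro sum_nonneg Bochner_Integration.integral_nonneg) simp
    show "fourth_sum (F k) \<le> 6 * real (p k) - 2 * real (p k) * m4 k + 6 * real (p k) * sqrt (m4 k * low_energy (F k) (F k))"
      unfolding m4 by (rule fourth_sum_le[OF F pos u1])
  next
    fix u :: "real ^ 'r" and \<eta> :: real assume \<eta>: "\<eta> > 0"
    show "\<bar>expectation (\<lambda>x. cos (u \<bullet> W x)) - exp (- (\<Sum>k\<in>UNIV. \<Sum>l\<in>UNIV. u $ k * u $ l * c k l) / 2)\<bar> \<le>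
         (\<Sum>k\<in>UNIV. \<bar>u $ k\<bar> * stein_error p (\<lambda>k l. low_energy (F k) (F l)) (\<lambda>k. fourth_sum (F k)) (\<lambda>l. u $ l) \<eta> k)"
      using char_bound[where F = F and p = p and u = "\<lambda>k. u $ k", OF F pos \<eta> smooth_pair_cos smooth_pair_uminus[OF smooth_pair_sin] u1]
      unfolding cosW c by simp
    show "\<bar>expectation (\<lambda>x. sin (u \<bullet> W x))\<bar> \<le>
         (\<Sum>k\<in>UNIV. \<bar>u $ k\<bar> * stein_error p (\<lambda>k l. low_energy (F k) (F l)) (\<lambda>k. fourth_sum (F k)) (\<lambda>l. u $ l) \<eta> k)"
      using char_bound[where F = F and p = p and u = "\<lambda>k. u $ k", OF F pos \<eta> smooth_pair_sin smooth_pair_cos u1]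
      unfolding sinW by simp
  qed
qed

theorem theorem1p7:
  fixes p :: "'r::finite \<Rightarrow> nat"
    and n :: "nat \<Rightarrow> nat"
    and M :: "nat \<Rightarrow> 'a measure"
    and E :: "nat \<Rightarrow> nat \<Rightarrow> 'b measure"
    and X :: "nat \<Rightarrow> nat \<Rightarrow> 'a \<Rightarrow> 'b"
    and W :: "nat \<Rightarrow> 'a \<Rightarrow> real ^ 'r"
    and H :: "nat \<Rightarrow> 'r \<Rightarrow> nat set \<Rightarrow> 'a \<Rightarrow> real"
    and \<Sigma> :: "real ^ 'r ^ 'r"
    and Q :: "'c measure"
    and N :: "'c \<Rightarrow> real ^ 'r"
  assumes r_ge_2: "CARD('r) \<ge> 2"
    and p_pos: "\<And>k. p k \<ge> 1"
    and n_lim: "filterlim n at_top sequentially"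
    and prob_M: "\<And>m. prob_space (M m)"
    and indep: "\<And>m. prob_space.indep_vars (M m) (E m) (X m) {1..n m}"
    and degenerate: "\<And>m k. degenerate_U_statistic (M m) (E m) (X m) (n m) (p k) (\<lambda>x. W m x $ k)"
    and centered: "\<And>m k. prob_space.expectation (M m) (\<lambda>x. W m x $ k) = 0"
    and unit_variance: "\<And>m k. prob_space.variance (M m) (\<lambda>x. W m x $ k) = 1"
    and fourth_moment: "\<And>m k. integrable (M m) (\<lambda>x. (W m x $ k) ^ 4)"
    and hoeffding:
      "\<And>m k. hoeffding_decomposition (M m) (E m) (X m) (n m) (\<lambda>x. W m x $ k) (H m k)"
    and Sigma_psd: "pos_semidefinite \<Sigma>"
    and Sigma_diag: "\<And>j. \<Sigma> $ j $ j = 1"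
    and prob_Q: "prob_space Q"
    and N_gaussian: "centered_gaussian_vector Q N \<Sigma>"
    and cond_i: "(\<lambda>m. covariance_matrix (M m) (W m)) \<longlonglongrightarrow> \<Sigma>"
    and cond_ii: "\<And>k. (\<lambda>m. rho_sq (M m) (n m) (p k) (H m k)) \<longlonglongrightarrow> 0"
    and cond_iii: "\<And>k. (\<lambda>m. prob_space.expectation (M m) (\<lambda>x. (W m x $ k) ^ 4)) \<longlonglongrightarrow> 3"
    and cond_iv: "\<And>j k. j \<noteq> k \<Longrightarrow> p j = p k \<Longrightarrow>
      (\<lambda>m. prob_space.expectation (M m) (\<lambda>x. (W m x $ j)\<^sup>2 * (W m x $ k)\<^sup>2))
        \<longlonglongrightarrow> prob_space.expectation Q (\<lambda>x. (N x $ j)\<^sup>2 * (N x $ k)\<^sup>2)"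
  shows "(\<forall>j k. j \<noteq> k \<longrightarrow> p j = p k \<longrightarrow>
            prob_space.expectation Q (\<lambda>x. (N x $ j)\<^sup>2 * (N x $ k)\<^sup>2) = 1 + 2 * (\<Sigma> $ j $ k)\<^sup>2)
         \<and> converges_in_distribution M W Q N"
proof (intro conjI allI impI)
  note gauss = centered_gaussian_facts[OF prob_Q N_gaussian]
  show NN: "prob_space.expectation Q (\<lambda>x. (N x $ j)\<^sup>2 * (N x $ k)\<^sup>2) = 1 + 2 * (\<Sigma> $ j $ k)\<^sup>2" if "j \<noteq> k" for j k
    by (rule gauss(6)[OF that Sigma_diag Sigma_diag])
  have pos: "p k > 0" for k using p_pos[of k] by simp
  have fam: "indep_family (M m) (E m) (X m) {1..n m}" for m
    unfolding indep_family_def indep_family_axioms_def using prob_M[of m] indep[of m] by simp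
  have Wint: "integrable (M m) (\<lambda>x. W m x $ k)" for m k
    using hoeffding[of m k] unfolding hoeffding_decomposition_def by blast
  have W2: "integral\<^sup>L (M m) (\<lambda>x. (W m x $ k)\<^sup>2) = 1" for m k
    using unit_variance[of m k] by (simp add: centered)
  have Wi2: "integrable (M m) (\<lambda>x. (W m x $ k)\<^sup>2)" for m k
    using W2[of m k] not_integrable_integral_eq by fastforce
  define c where "c m k l = integral\<^sup>L (M m) (\<lambda>x. W m x $ k * W m x $ l)" for m k l
  define mm where "mm m k l = integral\<^sup>L (M m) (\<lambda>x. (W m x $ k)\<^sup>2 * (W m x $ l)\<^sup>2)" for m k l
  define m4 where "m4 m k = integral\<^sup>L (M m) (\<lambda>x. (W m x $ k) ^ 4)" for m k
  define \<rho> where "\<rho> m l = rho_sq (M m) (n m) (p l) (H m l)" for m l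
  define Err where "Err lo qu u \<eta> =
    (\<Sum>k\<in>UNIV. \<bar>u $ k\<bar> * stein_error p lo qu (\<lambda>l. u $ l) \<eta> k)"
    for lo :: "'r \<Rightarrow> 'r \<Rightarrow> real" and qu :: "'r \<Rightarrow> real" and u :: "real ^ 'r" and \<eta> :: real
  \<comment> \<open>All bounds of \<open>quantitative_bounds\<close>, collected so that \<open>lo\<close> and \<open>qu\<close> can be chosen for every \<open>m\<close>.\<close>
  define good where "good m lo qu \<longleftrightarrow>
     (\<forall>k l. 0 \<le> lo k l \<and> lo k l \<le> mm m k l - 1 - 2 * (c m k l)\<^sup>2 + (1 + 2 ^ (p k + p l)) * real (p k) * \<rho> m l) \<and>
     (\<forall>k l. p k < p l \<longrightarrow> (mm m k l - 1)\<^sup>2 \<le> m4 m k * lo l l) \<and>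
     (\<forall>k l. p k \<noteq> p l \<longrightarrow> c m k l = 0) \<and>
     (\<forall>k. 0 \<le> qu k \<and> qu k \<le> 6 * real (p k) - 2 * real (p k) * m4 m k + 6 * real (p k) * sqrt (m4 m k * lo k k)) \<and>
     (\<forall>u \<eta>. \<eta> > 0 \<longrightarrow>
        \<bar>integral\<^sup>L (M m) (\<lambda>x. cos (u \<bullet> W m x)) - exp (- (\<Sum>k\<in>UNIV. \<Sum>l\<in>UNIV. u $ k * u $ l * c m k l) / 2)\<bar> \<le> Err lo qu u \<eta> \<and>
        \<bar>integral\<^sup>L (M m) (\<lambda>x. sin (u \<bullet> W m x))\<bar> \<le> Err lo qu u \<eta>)" for m lo qu
  have "\<forall>m. \<exists>lo qu. good m lo qu"
    unfolding good_def c_def mm_def m4_def \<rho>_def Err_def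
    by (intro allI indep_family.quantitative_bounds[OF fam refl pos degenerate hoeffding fourth_moment W2])
  then obtain lo qu where good: "\<And>m. good m (lo m) (qu m)" by metis
  have lo: "0 \<le> lo m k l" "lo m k l \<le> mm m k l - 1 - 2 * (c m k l)\<^sup>2 + (1 + 2 ^ (p k + p l)) * real (p k) * \<rho> m l" for m k l
    using good[of m] unfolding good_def by blast+
  have mix: "(mm m k l - 1)\<^sup>2 \<le> m4 m k * lo m l l" if "p k < p l" for m k l
    using good[of m] that unfolding good_def by blast
  have c0: "c m k l = 0" if "p k \<noteq> p l" for m k l
    using good[of m] that unfolding good_def by blast
  have qu: "0 \<le> qu m k" "qu m k \<le> 6 * real (p k) - 2 * real (p k) * m4 m k + 6 * real (p k) * sqrt (m4 m k * lo m k k)" for m k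
    using good[of m] unfolding good_def by blast+
  have cosb: "\<bar>integral\<^sup>L (M m) (\<lambda>x. cos (u \<bullet> W m x)) - exp (- (\<Sum>k\<in>UNIV. \<Sum>l\<in>UNIV. u $ k * u $ l * c m k l) / 2)\<bar> \<le> Err (lo m) (qu m) u \<eta>"
    and sinb: "\<bar>integral\<^sup>L (M m) (\<lambda>x. sin (u \<bullet> W m x))\<bar> \<le> Err (lo m) (qu m) u \<eta>" if "\<eta> > 0" for m u \<eta>
    using good[of m] that unfolding good_def by blast+
  have clim: "(\<lambda>m. c m k l) \<longlonglongrightarrow> \<Sigma> $ k $ l" for k l
    using tendsto_vec_nth[OF tendsto_vec_nth[OF cond_i], of k l]
    unfolding covariance_matrix_def c_def by (simp add: centered)
  have m4lim: "(\<lambda>m. m4 m k) \<longlonglongrightarrow> 3" for k unfolding m4_def by (rule cond_iii)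
  have \<rho>lim: "(\<lambda>m. \<rho> m k) \<longlonglongrightarrow> 0" for k unfolding \<rho>_def by (rule cond_ii)
  have lo_lim: "(\<lambda>m. lo m k l) \<longlonglongrightarrow> 0" if mmlim: "(\<lambda>m. mm m k l) \<longlonglongrightarrow> 1 + 2 * (\<Sigma> $ k $ l)\<^sup>2" for k l
  proof -
    have "(\<lambda>m. mm m k l - 1 - 2 * (c m k l)\<^sup>2 + (1 + 2 ^ (p k + p l)) * real (p k) * \<rho> m l) \<longlonglongrightarrow>
        (1 + 2 * (\<Sigma> $ k $ l)\<^sup>2) - 1 - 2 * (\<Sigma> $ k $ l)\<^sup>2 + (1 + 2 ^ (p k + p l)) * real (p k) * 0"
      by (intro tendsto_intros mmlim clim \<rho>lim)
    then have upper: "(\<lambda>m. mm m k l - 1 - 2 * (c m k l)\<^sup>2 + (1 + 2 ^ (p k + p l)) * real (p k) * \<rho> m l) \<longlonglongrightarrow> 0" by simp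
    show ?thesis by (rule tendsto_sandwich[OF _ _ tendsto_const upper]) (use lo in auto)
  qed
  have lo_diag: "(\<lambda>m. lo m k k) \<longlonglongrightarrow> 0" for k
  proof (rule lo_lim)
    have "mm m k k = m4 m k" for m unfolding mm_def m4_def by (simp add: power2_eq_square power4_eq_xxxx mult.assoc)
    then show "(\<lambda>m. mm m k k) \<longlonglongrightarrow> 1 + 2 * (\<Sigma> $ k $ k)\<^sup>2" using m4lim[of k] by (simp add: Sigma_diag)
  qed
  have mm_less: "(\<lambda>m. mm m k l) \<longlonglongrightarrow> 1" if "p k < p l" for k l
  proof -
    have "(\<lambda>m. m4 m k * lo m l l) \<longlonglongrightarrow> 3 * 0" by (intro tendsto_mult m4lim lo_diag)
    then have upper: "(\<lambda>m. m4 m k * lo m l l) \<longlonglongrightarrow> 0" by simp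
    have "(\<lambda>m. (mm m k l - 1)\<^sup>2) \<longlonglongrightarrow> 0"
      by (rule tendsto_sandwich[OF _ _ tendsto_const upper])
        (rule always_eventually, rule allI, rule zero_le_power2,
         rule always_eventually, rule allI, rule mix[OF that])
    then have "(\<lambda>m. sqrt ((mm m k l - 1)\<^sup>2)) \<longlonglongrightarrow> sqrt 0" by (rule tendsto_real_sqrt)
    then have "(\<lambda>m. \<bar>mm m k l - 1\<bar>) \<longlonglongrightarrow> 0" by (simp only: real_sqrt_abs real_sqrt_zero)
    then have "(\<lambda>m. mm m k l - 1) \<longlonglongrightarrow> 0" by (rule tendsto_rabs_zero_cancel)
    then show ?thesis by (rule LIM_zero_cancel)
  qed
  have lo0: "(\<lambda>m. lo m k l) \<longlonglongrightarrow> 0" for k l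
  proof (cases "k = l")
    case True
    then show ?thesis using lo_diag by simp
  next
    case False
    show ?thesis
    proof (rule lo_lim, cases "p k = p l")
      case True
      then show "(\<lambda>m. mm m k l) \<longlonglongrightarrow> 1 + 2 * (\<Sigma> $ k $ l)\<^sup>2"
        using cond_iv[OF False True] NN[OF False] by (simp add: mm_def)
    next
      case ne: False
      have "\<Sigma> $ k $ l = 0" using clim[of k l] c0[OF ne] by (simp add: LIMSEQ_const_iff)
      moreover have "mm m k l = mm m l k" for m unfolding mm_def by (simp add: mult.commute)
      ultimately show "(\<lambda>m. mm m k l) \<longlonglongrightarrow> 1 + 2 * (\<Sigma> $ k $ l)\<^sup>2"
        using ne mm_less[of k l] mm_less[of l k] by (cases "p k < p l") auto
    qed
  qed
  have qu0: "(\<lambda>m. qu m k) \<longlonglongrightarrow> 0" for k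
  proof -
    have "(\<lambda>m. 6 * real (p k) - 2 * real (p k) * m4 m k + 6 * real (p k) * sqrt (m4 m k * lo m k k)) \<longlonglongrightarrow>
        6 * real (p k) - 2 * real (p k) * 3 + 6 * real (p k) * sqrt (3 * 0)"
      by (intro tendsto_intros m4lim lo0)
    then have upper: "(\<lambda>m. 6 * real (p k) - 2 * real (p k) * m4 m k + 6 * real (p k) * sqrt (m4 m k * lo m k k)) \<longlonglongrightarrow> 0" by simp
    show ?thesis by (rule tendsto_sandwich[OF _ _ tendsto_const upper]) (use qu in auto)
  qed
  have Err_lim: "(\<lambda>m. Err (lo m) (qu m) u \<eta>) \<longlonglongrightarrow>
      \<eta> * ((\<Sum>k\<in>UNIV. \<bar>u $ k\<bar>) * (3 / 2 * (\<Sum>l\<in>UNIV. (u $ l)\<^sup>2) * (\<Sum>l\<in>UNIV. real (p l))))" if "\<eta> > 0" for u \<eta>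
  proof -
    have "(\<lambda>m. Err (lo m) (qu m) u \<eta>) \<longlonglongrightarrow>
      (\<Sum>k\<in>UNIV. \<bar>u $ k\<bar> * ((\<Sum>l\<in>UNIV. \<bar>u $ l\<bar> * (real (p k + p l) * sqrt 0))
      + 3 / 2 * (\<Sum>l\<in>UNIV. (u $ l)\<^sup>2) * (\<eta> * (\<Sum>l\<in>UNIV. real (p l)) + (\<Sum>l\<in>(UNIV :: 'r set). 0 + 0) / (2 * \<eta>))))"
      unfolding Err_def stein_error_def using that by (intro tendsto_intros lo0 qu0) auto
    moreover have "(\<Sum>k\<in>UNIV. \<bar>u $ k\<bar> * ((\<Sum>l\<in>UNIV. \<bar>u $ l\<bar> * (real (p k + p l) * sqrt 0))
      + 3 / 2 * (\<Sum>l\<in>UNIV. (u $ l)\<^sup>2) * (\<eta> * (\<Sum>l\<in>UNIV. real (p l)) + (\<Sum>l\<in>(UNIV :: 'r set). 0 + 0) / (2 * \<eta>))))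
      = (\<Sum>k\<in>UNIV. \<bar>u $ k\<bar> * (3 / 2 * (\<Sum>l\<in>UNIV. (u $ l)\<^sup>2) * (\<eta> * (\<Sum>l\<in>UNIV. real (p l)))))"
      by simp
    moreover have "\<dots> = \<eta> * ((\<Sum>k\<in>UNIV. \<bar>u $ k\<bar>) * (3 / 2 * (\<Sum>l\<in>UNIV. (u $ l)\<^sup>2) * (\<Sum>l\<in>UNIV. real (p l))))"
      unfolding sum_distrib_right[symmetric] by (simp only: ac_simps)
    ultimately show ?thesis by (simp only:)
  qed
  \<comment> \<open>The error tends to a multiple of \<open>\<eta>\<close>, and \<open>\<eta>\<close> is arbitrary.\<close>
  have small: "(\<lambda>m. a m) \<longlonglongrightarrow> 0" if a: "\<And>m \<eta>. \<eta> > 0 \<Longrightarrow> \<bar>a m\<bar> \<le> Err (lo m) (qu m) u \<eta>" for a :: "nat \<Rightarrow> real" and u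
  proof (rule LIMSEQ_I)
    fix e :: real assume e: "e > 0"
    define K where "K = (\<Sum>k\<in>UNIV. \<bar>u $ k\<bar>) * (3 / 2 * (\<Sum>l\<in>UNIV. (u $ l)\<^sup>2) * (\<Sum>l\<in>UNIV. real (p l)))"
    have K: "K \<ge> 0" unfolding K_def by (intro mult_nonneg_nonneg sum_nonneg) auto
    define \<eta> where "\<eta> = e / (K + 1)"
    have \<eta>: "\<eta> > 0" using e K by (simp add: \<eta>_def)
    have "\<eta> * K < e" using e K by (simp add: \<eta>_def field_simps)
    with Err_lim[OF \<eta>, of u] have "\<forall>\<^sub>F m in sequentially. Err (lo m) (qu m) u \<eta> < e"
      unfolding K_def by (rule order_tendstoD(2))
    then obtain m0 where m0: "\<And>m. m \<ge> m0 \<Longrightarrow> Err (lo m) (qu m) u \<eta> < e"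
      by (auto simp: eventually_sequentially)
    have "norm (a m - 0) < e" if "m \<ge> m0" for m
      using a[OF \<eta>, of m] m0[OF that] by simp
    then show "\<exists>no. \<forall>m\<ge>no. norm (a m - 0) < e" by blast
  qed
  show "converges_in_distribution M W Q N"
  proof (rule weak_convergence_from_trig[where C = 1, OF prob_M prob_Q _ gauss(1) Wi2 gauss(2)])
    show "W m \<in> borel_measurable (M m)" for m
      by (rule borel_measurable_vecI) (rule borel_measurable_integrable[OF Wint])
    show "integral\<^sup>L (M m) (\<lambda>x. (W m x $ k)\<^sup>2) \<le> 1" for m k using W2 by simp
    show "integral\<^sup>L Q (\<lambda>x. (N x $ k)\<^sup>2) \<le> 1" for k
      using gauss(3)[of k k] by (simp add: Sigma_diag power2_eq_square)
    show "(\<lambda>m. integral\<^sup>L (M m) (\<lambda>x. cos (u \<bullet> W m x))) \<longlonglongrightarrow> integral\<^sup>L Q (\<lambda>x. cos (u \<bullet> N x))" for u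
    proof -
      let ?e = "\<lambda>m. exp (- (\<Sum>k\<in>UNIV. \<Sum>l\<in>UNIV. u $ k * u $ l * c m k l) / 2)"
      have "?e \<longlonglongrightarrow> exp (- (\<Sum>k\<in>UNIV. \<Sum>l\<in>UNIV. u $ k * u $ l * \<Sigma> $ k $ l) / 2)"
        by (intro tendsto_intros clim) auto
      moreover have "(\<lambda>m. integral\<^sup>L (M m) (\<lambda>x. cos (u \<bullet> W m x)) - ?e m) \<longlonglongrightarrow> 0"
        by (rule small[OF cosb])
      ultimately have "(\<lambda>m. (integral\<^sup>L (M m) (\<lambda>x. cos (u \<bullet> W m x)) - ?e m) + ?e m) \<longlonglongrightarrow>
          0 + exp (- (\<Sum>k\<in>UNIV. \<Sum>l\<in>UNIV. u $ k * u $ l * \<Sigma> $ k $ l) / 2)"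
        by (intro tendsto_add)
      then show ?thesis unfolding gauss(4) by simp
    qed
    show "(\<lambda>m. integral\<^sup>L (M m) (\<lambda>x. sin (u \<bullet> W m x))) \<longlonglongrightarrow> integral\<^sup>L Q (\<lambda>x. sin (u \<bullet> N x))" for u
      unfolding gauss(5) by (rule small[OF sinb])
  qed
qed

end
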